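(* The amoeba-Sacks forcing $\mathbf{AS}$ has pure decision: given a formula $\varphi$ (of the forcing language of $\mathbf{AS}$) and a condition $(p_0,T)\in\mathbf{AS}$, there exists $(p_0,T')\le_0(p_0,T)$ such that $(p_0,T')\in D$, where $D=\{(q,S)\in\mathbf{AS}: (q,S)\Vdash\varphi \text{ or } (q,S)\Vdash\neg\varphi\}$.
   Context: A tree is a subset of $2^{<\omega}$ closed under initial segments; $s\unlhd t$ means that $s$ is an initial segment of $t$. A node $t\in T$ is splitting if $t^\frown 0,t^\frown 1\in T$; $\mathrm{Split}(T)$ is the set of splitting nodes of $T$. $T$ is perfect if every node of $T$ extends to a splitting node of $T$. For a finite tree $p$, $\mathrm{Term}(p)$ is the set of its terminal nodes. For a finite subtree $p$ of $T$, $p\sqsubseteq T$ ("$T$ end-extends $p$") means that for every $t\in T\setminus p$ there is $s\in\mathrm{Term}(p)$ with $s\unlhd t$; $p\sqsubset T$ means $p\sqsubseteq T$ and $p\neq T$. For a tree $T$ (perfect or finite) order $\mathrm{Split}(T)$ by: $s\preccurlyeq t$ iff $s$ has strictly fewer proper initial segments in $\mathrm{Split}(T)$ than $t$ has, or they have equally many and $s$ is lexicographically $\le t$. (For perfect $T$ this is the order induced by the natural isomorphism $\mathrm{Split}(T)\to2^{<\omega}$, comparing first lengths and then lexicographically.) The depth $d(t,T)$ of $t\in\mathrm{Split}(T)$ is the number of $s\in\mathrm{Split}(T)$ with $s\preccurlyeq t$, $s\ne t$. A perfect tree $T$ is good iff for all $s,t\in\mathrm{Split}(T)$, $s\preccurlyeq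 t$ implies $|s|\le|t|$. Amoeba-Sacks $\mathbf{AS}$ is the poset of all pairs $(p,T)$ where $T$ is a good perfect tree and $p\sqsubset T$ is a finite subtree, ordered by $(p',T')\le(p,T)$ iff $T'\subseteq T$ and $p'$ end-extends $p$. For $n\in\omega$, $T\upharpoonright^* n:=\{t\in T:\exists k\le n\ \exists s\in\mathrm{Split}(T)\ \exists i\in\{0,1\}\ (d(s,T)=k\wedge t\unlhd s^\frown i)\}$, and for perfect trees $T'\subseteq_n T$ means $T'\subseteq T$ and $T'\upharpoonright^* n=T\upharpoonright^* n$; $T'\subseteq_{-1}T$ means just $T'\subseteq T$. For $(p_0,T)\in\mathbf{AS}$ let $p\sqsupseteq p_0$ be the $\sqsubseteq$-maximal finite tree such that $p\sqsubset T'$ for every $T'\subseteq T$ with $(p_0,T')\in\mathbf{AS}$ (such $p$ exists), and let $N:=\max\{k\in\omega:\exists t\in\mathrm{Split}(p)\ (d(t,p)=k)\}$, with $N:=-1$ if $\mathrm{Split}(p)=\emptyset$. Define $(p_0',T')\le_n(p_0,T)$ iff $(p_0',T')\le(p_0,T)$, $p_0'=p_0$ and $T'\subseteq_{n+N}T$. *)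

theory Defs
  imports Main "HOL-Library.Sublist"
begin

section \<open>Trees on binary strings\<close>

type_synonym node = "bool list"

definition tree :: "node set \<Rightarrow> bool" where
  "tree T \<longleftrightarrow> (\<forall>t\<in>T. \<forall>s. prefix s t \<longrightarrow> s \<in> T)"

definition splits :: "node set \<Rightarrow> node set" where
  "splits T = {t \<in> T. t @ [False] \<in> T \<and> t @ [True] \<in> T}"

definition perfect :: "node set \<Rightarrow> bool" where
  "perfect T \<longleftrightarrow> tree T \<and> (\<forall>t\<in>T. \<exists>s\<in>splits T. prefix t s)"

definition terminals :: "node set \<Rightarrow> node set" where
  "terminals p = {t \<in> p. \<forall>s\<in>p. prefix t s \<longrightarrow> s = t}"

definition end_ext :: "node set \<Rightarrow> node set \<Rightarrow> bool"  (infix \<open>\<sqsubseteq>\<^sub>e\<close> 50) where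
  "p \<sqsubseteq>\<^sub>e T \<longleftrightarrow> finite p \<and> tree p \<and> p \<subseteq> T \<and> (\<forall>t\<in>T - p. \<exists>s\<in>terminals p. prefix s t)"

definition end_ext_strict :: "node set \<Rightarrow> node set \<Rightarrow> bool"  (infix \<open>\<sqsubset>\<^sub>e\<close> 50) where
  "p \<sqsubset>\<^sub>e T \<longleftrightarrow> p \<sqsubseteq>\<^sub>e T \<and> p \<noteq> T"

definition split_level :: "node set \<Rightarrow> node \<Rightarrow> nat" where
  "split_level T t = card {s \<in> splits T. strict_prefix s t}"

definition split_le :: "node set \<Rightarrow> node \<Rightarrow> node \<Rightarrow> bool" where
  "split_le T s t \<longleftrightarrow> split_level T s < split_level T t \<or>
     (split_level T s = split_level T t \<and> lexordp_eq s t)"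

definition depth :: "node \<Rightarrow> node set \<Rightarrow> nat" where
  "depth t T = card {s \<in> splits T. split_le T s t \<and> s \<noteq> t}"

definition good :: "node set \<Rightarrow> bool" where
  "good T \<longleftrightarrow> perfect T \<and>
     (\<forall>s\<in>splits T. \<forall>t\<in>splits T. split_le T s t \<longrightarrow> length s \<le> length t)"

section \<open>Amoeba-Sacks forcing\<close>

type_synonym cond = "node set \<times> node set"

text \<open>The empty tree is vacuously perfect, but it occurs in no condition: it has no proper
  subtree, and a nonempty tree does not end-extend it.\<close>

definition AS :: "cond set" where
  "AS = {(p, T). good T \<and> p \<sqsubset>\<^sub>e T}"

definition AS_le :: "cond \<Rightarrow> cond \<Rightarrow> bool" where
  "AS_le c' c \<longleftrightarrow> snd c' \<subseteq> snd c \<and> fst c \<sqsubseteq>\<^sub>e fst c'"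

definition restr :: "node set \<Rightarrow> nat \<Rightarrow> node set" where
  "restr T n = {t \<in> T. \<exists>k\<le>n. \<exists>s\<in>splits T. \<exists>i. depth s T = k \<and> prefix t (s @ [i])}"

text \<open>The index is an integer because the value \<open>-1\<close> is needed.\<close>

definition sub_n :: "int \<Rightarrow> node set \<Rightarrow> node set \<Rightarrow> bool" where
  "sub_n n T' T \<longleftrightarrow> T' \<subseteq> T \<and> (n \<ge> 0 \<longrightarrow> restr T' (nat n) = restr T (nat n))"

definition forced_parts :: "node set \<Rightarrow> node set \<Rightarrow> node set set" where
  "forced_parts p0 T =
     {p. finite p \<and> tree p \<and> p0 \<sqsubseteq>\<^sub>e p \<and> (\<forall>T'. T' \<subseteq> T \<and> (p0, T') \<in> AS \<longrightarrow> p \<sqsubset>\<^sub>e T')}"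

lemma perfect_infinite:
  assumes "perfect T" "T \<noteq> {}" shows "infinite T"
proof
  assume fin: "finite T"
  then have fi: "finite (length ` T)" by simp
  have "Max (length ` T) \<in> length ` T" using fi assms(2) by (intro Max_in) auto
  then obtain t where t: "t \<in> T" "Max (length ` T) = length t" by auto
  then obtain s where s: "s \<in> splits T" "prefix t s" using assms(1) by (auto simp: perfect_def)
  then have "s @ [True] \<in> T" by (simp add: splits_def)
  then have "length (s @ [True]) \<le> Max (length ` T)" using fi by (intro Max_ge imageI)
  with t prefix_length_le[OF s(2)] show False by simp
qed

lemma terminal_Un:
  assumes "s \<in> terminals q" "s' \<in> terminals q'" "prefix s s'"
  shows "s' \<in> terminals (q \<union> q')"
  using assms unfolding terminals_def
  by (auto dest: prefix_order.trans prefix_order.antisym)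

lemma end_ext_Un:
  assumes "q \<sqsubseteq>\<^sub>e T" "q' \<sqsubseteq>\<^sub>e T"
  shows "(q \<union> q') \<sqsubseteq>\<^sub>e T"
proof -
  have "\<exists>s\<in>terminals (q \<union> q'). prefix s t" if t: "t \<in> T - (q \<union> q')" for t
  proof -
    obtain s s' where s: "s \<in> terminals q" "prefix s t" "s' \<in> terminals q'" "prefix s' t"
      using assms t unfolding end_ext_def by (metis Diff_iff UnCI)
    then consider "prefix s s'" | "prefix s' s" using prefix_same_cases by blast
    then show ?thesis
      using s terminal_Un[of s q s' q'] terminal_Un[of s' q' s q] by cases (auto simp: Un_commute)
  qed
  moreover have "tree (q \<union> q')" using assms unfolding end_ext_def tree_def by blast
  ultimately show ?thesis using assms unfolding end_ext_def by auto
qed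

lemma end_ext_subset: "p \<sqsubseteq>\<^sub>e T \<Longrightarrow> p \<subseteq> q \<Longrightarrow> q \<subseteq> T \<Longrightarrow> p \<sqsubseteq>\<^sub>e q"
  unfolding end_ext_def by blast

lemma forced_parts_Un:
  assumes "q \<in> forced_parts p0 T" "q' \<in> forced_parts p0 T" "(p0, T) \<in> AS"
  shows "q \<union> q' \<in> forced_parts p0 T" and "q \<sqsubseteq>\<^sub>e q \<union> q'"
proof -
  have sub: "(q \<union> q') \<sqsubseteq>\<^sub>e T'" if "T' \<subseteq> T" "(p0, T') \<in> AS" for T'
    using assms that by (intro end_ext_Un) (auto simp: forced_parts_def end_ext_strict_def)
  have neq: "q \<union> q' \<noteq> T'" if T': "T' \<subseteq> T" "(p0, T') \<in> AS" for T'
  proof -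
    have "perfect T'" "T' \<noteq> {}" using T' by (auto simp: AS_def good_def end_ext_strict_def end_ext_def)
    then have "infinite T'" by (rule perfect_infinite)
    then show ?thesis using sub[OF T'] by (auto simp: end_ext_def)
  qed
  have U: "(q \<union> q') \<sqsubseteq>\<^sub>e T" using sub assms by blast
  have p0: "p0 \<sqsubseteq>\<^sub>e T" using assms by (auto simp: AS_def end_ext_strict_def)
  have qT: "q \<sqsubseteq>\<^sub>e T" using assms by (auto simp: forced_parts_def end_ext_strict_def)
  have "p0 \<subseteq> q" using assms by (auto simp: forced_parts_def end_ext_def)
  then have "p0 \<sqsubseteq>\<^sub>e q \<union> q'" using U by (intro end_ext_subset[OF p0]) (auto simp: end_ext_def)
  then show "q \<union> q' \<in> forced_parts p0 T" using sub neq U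
    by (auto simp: forced_parts_def end_ext_strict_def end_ext_def)
  show "q \<sqsubseteq>\<^sub>e q \<union> q'" using U by (intro end_ext_subset[OF qT]) (auto simp: end_ext_def)
qed

lemma max_forced_part_unique:
  assumes "(p0, T) \<in> AS"
    and "p \<in> forced_parts p0 T" "\<forall>q\<in>forced_parts p0 T. p \<sqsubseteq>\<^sub>e q \<longrightarrow> q = p"
    and "p' \<in> forced_parts p0 T" "\<forall>q\<in>forced_parts p0 T. p' \<sqsubseteq>\<^sub>e q \<longrightarrow> q = p'"
  shows "p = p'"
  using assms forced_parts_Un[of p p0 T p'] forced_parts_Un[of p' p0 T p]
  by (metis Un_commute)

definition max_forced_part :: "node set \<Rightarrow> node set \<Rightarrow> node set" where
  "max_forced_part p0 T =
     (THE p. p \<in> forced_parts p0 T \<and> (\<forall>q\<in>forced_parts p0 T. p \<sqsubseteq>\<^sub>e q \<longrightarrow> q = p))"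

definition max_depth :: "node set \<Rightarrow> int" where
  "max_depth p = (if splits p = {} then -1 else int (Max {k. \<exists>t\<in>splits p. depth t p = k}))"

definition AS_le_n :: "nat \<Rightarrow> cond \<Rightarrow> cond \<Rightarrow> bool" where
  "AS_le_n n c' c \<longleftrightarrow> c' \<in> AS \<and> c \<in> AS \<and> AS_le c' c \<and> fst c' = fst c \<and>
     sub_n (int n + max_depth (max_forced_part (fst c) (snd c))) (snd c') (snd c)"

section \<open>The forcing language and the forcing relation\<close>

text \<open>A universe of names for a poset with carrier \<open>P\<close> is given by a type \<open>'v\<close> and a map \<open>nm\<close>
  sending each name to the set of pairs (name, condition) that are its elements. HOL has no
  class of all names, so the universe is a parameter.\<close>

definition name_universe :: "'p set \<Rightarrow> ('v \<Rightarrow> ('v \<times> 'p) set) \<Rightarrow> bool" where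
  "name_universe P nm \<longleftrightarrow>
     (\<forall>x. snd ` nm x \<subseteq> P) \<and> wf {(y, x). y \<in> fst ` nm x}"

definition dense_below :: "'p set \<Rightarrow> ('p \<Rightarrow> 'p \<Rightarrow> bool) \<Rightarrow> 'p \<Rightarrow> ('p \<Rightarrow> bool) \<Rightarrow> bool" where
  "dense_below P le p D \<longleftrightarrow> (\<forall>r\<in>P. le r p \<longrightarrow> (\<exists>q\<in>P. le q r \<and> D q))"

lemma dense_below_mono [mono]:
  "(\<And>q. D q \<longrightarrow> E q) \<Longrightarrow> dense_below P le p D \<longrightarrow> dense_below P le p E"
  unfolding dense_below_def by blast

text \<open>The usual recursion on names: \<open>p\<close> forces \<open>a = b\<close> iff for each \<open>(c, s)\<close> in \<open>a\<close> it is
  dense below \<open>p\<close> that \<open>q \<le> s\<close> implies that \<open>q\<close> forces \<open>c = d\<close> and \<open>q \<le> r\<close> for some \<open>(d, r)\<close>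
  in \<open>b\<close>, and symmetrically. The recursive occurrences are positive and concern elements of
  \<open>a\<close> and \<open>b\<close>, so over a well-founded universe the inductive predicate is the unique solution.\<close>

inductive forces_eq ::
  "'p set \<Rightarrow> ('p \<Rightarrow> 'p \<Rightarrow> bool) \<Rightarrow> ('v \<Rightarrow> ('v \<times> 'p) set) \<Rightarrow> 'p \<Rightarrow> 'v \<Rightarrow> 'v \<Rightarrow> bool"
  for P le nm where
  "\<lbrakk>\<forall>(c, s)\<in>nm a. dense_below P le p
       (\<lambda>q. le q s \<longrightarrow> (\<exists>(d, r)\<in>nm b. le q r \<and> forces_eq P le nm q c d));
    \<forall>(d, r)\<in>nm b. dense_below P le p
       (\<lambda>q. le q r \<longrightarrow> (\<exists>(c, s)\<in>nm a. le q s \<and> forces_eq P le nm q c d))\<rbrakk>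
   \<Longrightarrow> forces_eq P le nm p a b"

definition forces_mem ::
  "'p set \<Rightarrow> ('p \<Rightarrow> 'p \<Rightarrow> bool) \<Rightarrow> ('v \<Rightarrow> ('v \<times> 'p) set) \<Rightarrow> 'p \<Rightarrow> 'v \<Rightarrow> 'v \<Rightarrow> bool" where
  "forces_mem P le nm p a b \<longleftrightarrow>
     dense_below P le p (\<lambda>q. \<exists>(d, r)\<in>nm b. le q r \<and> forces_eq P le nm q a d)"

text \<open>A sentence of the forcing language is a formula of set theory together with an
  assignment of names to its free variables.\<close>

datatype fm = Eq nat nat | Mem nat nat | Neg fm | Conj fm fm | Ex nat fm

primrec forces ::
  "'p set \<Rightarrow> ('p \<Rightarrow> 'p \<Rightarrow> bool) \<Rightarrow> ('v \<Rightarrow> ('v \<times> 'p) set) \<Rightarrow> 'p \<Rightarrow> fm \<Rightarrow> (nat \<Rightarrow> 'v) \<Rightarrow> bool" where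
  "forces P le nm p (Eq i j) e \<longleftrightarrow> forces_eq P le nm p (e i) (e j)"
| "forces P le nm p (Mem i j) e \<longleftrightarrow> forces_mem P le nm p (e i) (e j)"
| "forces P le nm p (Neg \<phi>) e \<longleftrightarrow> (\<forall>q\<in>P. le q p \<longrightarrow> \<not> forces P le nm q \<phi> e)"
| "forces P le nm p (Conj \<phi> \<psi>) e \<longleftrightarrow> forces P le nm p \<phi> e \<and> forces P le nm p \<psi> e"
| "forces P le nm p (Ex i \<phi>) e \<longleftrightarrow>
     dense_below P le p (\<lambda>q. \<exists>x. forces P le nm q \<phi> (e(i := x)))"

definition AS_deciding :: "('v \<Rightarrow> ('v \<times> cond) set) \<Rightarrow> fm \<Rightarrow> (nat \<Rightarrow> 'v) \<Rightarrow> cond set" where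
  "AS_deciding nm \<phi> e =
     {c \<in> AS. forces AS AS_le nm c \<phi> e \<or> forces AS AS_le nm c (Neg \<phi>) e}"

end

theory Submission
  imports Defs "HOL.Filter"
begin

text \<open>
  A good perfect tree is the downward closure of its splitting nodes, and these, listed in the
  order \<open>\<preceq>\<close>, form a sequence \<open>s\<close> indexed by the nodes of the binary tree in level order: \<open>s\<close>
  sends the two children of \<open>i\<close> above the two successors of \<open>s i\<close>, and its lengths do not
  decrease. Such a sequence is called a skeleton. If the lengths strictly increase, the good
  subtrees are exactly the trees of \<open>s \<circ> \<sigma>\<close>, where \<open>\<sigma>\<close> is a strictly increasing embedding of the
  numbered binary tree into itself; a subtree end-extends the part spanned by the first \<open>n\<close>
  splitting nodes iff \<open>\<sigma>\<close> fixes every \<open>i < n\<close>. Pure decision thereby becomes a statement about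
  the monoid of embeddings, \<open>abstract_pure_decision\<close>.

  That statement is proved like the Prikry property of Mathias forcing. Call a stage undecided
  if no pure extension decides there. If stage \<open>n\<close> is undecided, one can thin out so that all
  extensions to stage \<open>n + 1\<close> behave alike (\<open>one_step_homogeneity\<close>): all force \<open>\<phi>\<close>, all force
  \<open>\<not>\<phi>\<close>, or all are undecided. In the first two cases stage \<open>n\<close> would already decide, so the
  third one holds. A fusion (\<open>fusion\<close>) does this for all stages at once and makes every finite
  extension undecided, although deciding conditions are dense.

  The Ramsey-theoretic content is in the one-step homogeneity. The next stage is described by
  the new splitting node \<open>x\<close> above one terminal node together with the nodes that the other \<open>n\<close>
  branches pass at that time, and all such tuples must get the same colour on suitable perfect
  subtrees. This is a statement of Halpern-Laeuchli type. A tuple of \<open>n + 1\<close> binary words of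
  equal length is one word over an alphabet with \<open>2 ^ (n + 1)\<close> letters, and the theorem of
  Carlson and Simpson (\<open>carlson_simpson\<close>) on left variable words gives the subtrees; that its
  variable words begin with the variable makes the subtrees split immediately above \<open>x\<close>. It is
  proved with idempotent ultrafilters.

  One more point concerns \<open>p\<close>, the maximal forced part of \<open>(p0, T)\<close>. Its splitting nodes need
  not come first in the order \<open>\<preceq>\<close> of \<open>T\<close>, while \<open>T'\<close> has to keep as many of the first splitting
  nodes of \<open>T\<close> as \<open>p\<close> has. Let \<open>M\<close> be one more than the largest index of a splitting node of
  \<open>p\<close>, and thin out \<open>T\<close> so that from index \<open>M - 1\<close> on the lengths strictly increase. Each
  condition \<open>(p0, S)\<close> below contains the node with index \<open>M - 1\<close> at the same place, and goodness
  of \<open>S\<close> requires all earlier splitting nodes of \<open>S\<close> to be at most as long. Only the first \<open>M\<close>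
  nodes are that short, so \<open>S\<close> has kept all of them (\<open>pinned_initial_part\<close>). Hence \<open>p0\<close> has the
  same pure extensions as the part spanned by the first \<open>M\<close> splitting nodes, and a decision made
  by the latter is one made by \<open>p0\<close>.
\<close>

section \<open>Idempotent ultrafilters of words\<close>

text \<open>The extension of concatenation to filters; on ultrafilters it is the multiplication of the
  Stone-Cech compactification of the semigroup of words. A filter stands for the closed set of
  the ultrafilters below it, so the algebra of closed subsemigroups and left ideals can be
  carried out with filters, and compactness is the fact that a chain of proper filters has a
  proper infimum.\<close>
definition conv :: "'a list filter \<Rightarrow> 'a list filter \<Rightarrow> 'a list filter" (infixl \<open>\<star>\<close> 70) where
  "F \<star> G = Abs_filter (\<lambda>P. \<forall>\<^sub>F x in F. \<forall>\<^sub>F y in G. P (x @ y))"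

lemma eventually_conv:
  "eventually P (F \<star> G) \<longleftrightarrow> (\<forall>\<^sub>F x in F. \<forall>\<^sub>F y in G. P (x @ y))"
  unfolding conv_def
  by (rule eventually_Abs_filter, rule is_filter.intro)
     (auto elim: eventually_elim2 intro: eventually_mono simp: eventually_conj_iff)

lemma conv_assoc: "(F \<star> G) \<star> H = F \<star> (G \<star> H)"
  by (rule filter_eqI) (simp add: eventually_conv)

lemma conv_mono: "F \<le> F' \<Longrightarrow> G \<le> G' \<Longrightarrow> F \<star> G \<le> F' \<star> G'"
proof (rule filter_leI)
  fix P assume FG: "F \<le> F'" "G \<le> G'" and "eventually P (F' \<star> G')"
  then have "\<forall>\<^sub>F x in F. \<forall>\<^sub>F y in G'. P (x @ y)"
    unfolding eventually_conv by (intro filter_leD[OF FG(1)])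
  then show "eventually P (F \<star> G)"
    unfolding eventually_conv by (rule eventually_mono) (rule filter_leD[OF FG(2)])
qed

lemma conv_neq_bot: "F \<noteq> bot \<Longrightarrow> G \<noteq> bot \<Longrightarrow> F \<star> G \<noteq> bot"
  by (simp add: trivial_limit_def eventually_conv)

lemma filtermap_conv:
  assumes "\<And>x y. h (x @ y) = h x @ h y"
  shows "filtermap h (F \<star> G) = filtermap h F \<star> filtermap h G"
  by (rule filter_eqI) (simp add: eventually_conv eventually_filtermap assms)

lemma top_filter_neq_bot: "(top :: 'a filter) \<noteq> bot"
proof
  assume "(top :: 'a filter) = bot"
  then have "eventually (\<lambda>_. False) (top :: 'a filter)" by simp
  then show False unfolding eventually_top by simp
qed

text \<open>Zorn's lemma, in the form that gives ultrafilters, minimal closed subsemigroups and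
  minimal closed left ideals.\<close>
lemma minimal_filter_below:
  fixes C :: "'a filter \<Rightarrow> bool"
  assumes "C F0" "F0 \<noteq> bot"
    and chain: "\<And>B. \<lbrakk>B \<noteq> {}; \<And>F G. F \<in> B \<Longrightarrow> G \<in> B \<Longrightarrow> F \<le> G \<or> G \<le> F; \<And>F. F \<in> B \<Longrightarrow> C F\<rbrakk> \<Longrightarrow> C (Inf B)"
  obtains F where "F \<le> F0" "F \<noteq> bot" "C F" "\<And>G. G \<le> F \<Longrightarrow> G \<noteq> bot \<Longrightarrow> C G \<Longrightarrow> G = F"
proof -
  let ?A = "{F. F \<le> F0 \<and> F \<noteq> bot \<and> C F}" and ?P = "\<lambda>F G :: 'a filter. G \<le> F"
  have "\<exists>m\<in>?A. \<forall>a\<in>?A. ?P m a \<longrightarrow> a = m"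
  proof (rule predicate_Zorn)
    show "partial_order_on ?A (relation_of ?P ?A)"
      by (rule partial_order_on_relation_ofI) auto
    fix B assume "B \<in> Chains (relation_of ?P ?A)"
    then have B: "B \<subseteq> ?A" "\<And>F G. F \<in> B \<Longrightarrow> G \<in> B \<Longrightarrow> F \<le> G \<or> G \<le> F"
      unfolding Chains_def relation_of_def by auto
    show "\<exists>u\<in>?A. \<forall>a\<in>B. ?P a u"
    proof (cases "B = {}")
      case True then show ?thesis using assms by auto
    next
      case False
      have "eventually (\<lambda>_. False) (Inf B) \<longleftrightarrow> (\<exists>b\<in>B. eventually (\<lambda>_. False) b)"
      proof (rule eventually_Inf_base[OF False])
        show "\<exists>x\<in>B. x \<le> inf F G" if "F \<in> B" "G \<in> B" for F G
          using B(2)[OF that] that by (metis inf.absorb1 inf.absorb2 order_refl)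
      qed
      then have "Inf B \<noteq> bot" using B(1) by (auto simp: trivial_limit_def)
      moreover have "C (Inf B)" using False B by (intro chain) auto
      moreover have "Inf B \<le> F0" using False B(1) by (metis (no_types, lifting) CollectD Inf_lower2 ex_in_conv subsetD)
      ultimately show ?thesis by (auto intro!: bexI[of _ "Inf B"] Inf_lower)
    qed
  qed
  then obtain F where F: "F \<le> F0" "F \<noteq> bot" "C F" "\<And>G. G \<in> ?A \<Longrightarrow> G \<le> F \<Longrightarrow> G = F"
    by blast
  show ?thesis
  proof (rule that[OF F(1-3)])
    fix G assume "G \<le> F" "G \<noteq> bot" "C G"
    then show "G = F" using F(1) by (intro F(4)) auto
  qed
qed

definition ultra :: "'a filter \<Rightarrow> bool" where
  "ultra U \<longleftrightarrow> U \<noteq> bot \<and> (\<forall>P. eventually P U \<or> eventually (\<lambda>x. \<not> P x) U)"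

lemma proper_not_eventually_both:
  assumes "F \<noteq> bot" "eventually P F" "eventually (\<lambda>x. \<not> P x) F"
  shows False
proof -
  from assms(2,3) have "eventually (\<lambda>_. False) F" by eventually_elim simp
  with assms(1) show False by (simp add: trivial_limit_def)
qed

lemma ultra_not: "ultra U \<Longrightarrow> eventually (\<lambda>x. \<not> P x) U \<longleftrightarrow> \<not> eventually P U"
  unfolding ultra_def using proper_not_eventually_both by blast

lemma ultra_eq_below: "ultra U \<Longrightarrow> F \<noteq> bot \<Longrightarrow> F \<le> U \<Longrightarrow> F = U"
proof (rule antisym)
  assume U: "ultra U" and F: "F \<noteq> bot" "F \<le> U"
  show "U \<le> F"
  proof (rule filter_leI)
    fix P assume "eventually P F"
    then have "\<not> eventually (\<lambda>x. \<not> P x) F" using F(1) proper_not_eventually_both by blast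
    then show "eventually P U" using U F(2) unfolding ultra_def by (meson filter_leD)
  qed
qed

lemma ultra_filtermap: "ultra U \<Longrightarrow> ultra (filtermap f U)"
  by (auto simp: ultra_def eventually_filtermap filtermap_bot_iff)

text \<open>A minimal proper filter is an ultrafilter, since otherwise intersecting it with a set on
  which it does not decide would give a smaller one.\<close>
lemma ultra_below:
  assumes "F \<noteq> bot" obtains U where "U \<le> F" "ultra U"
proof -
  obtain U where U: "U \<le> F" "U \<noteq> bot" "\<And>G. G \<le> U \<Longrightarrow> G \<noteq> bot \<Longrightarrow> True \<Longrightarrow> G = U"
    by (rule minimal_filter_below[of "\<lambda>_. True" F]) (use assms in auto)
  have "eventually P U \<or> eventually (\<lambda>x. \<not> P x) U" for P
  proof (cases "inf U (principal {x. P x}) = bot")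
    case True
    then show ?thesis
      by (simp add: trivial_limit_def eventually_inf_principal)
  next
    case False
    then have "inf U (principal {x. P x}) = U" using U(3) by simp
    then have "U \<le> principal {x. P x}" by (metis inf.cobounded2)
    then show ?thesis by (simp add: le_principal)
  qed
  with U that show ?thesis by (auto simp: ultra_def)
qed

lemma ultra_finite_range:
  assumes "ultra U" "finite (range c)"
  obtains c0 where "\<forall>\<^sub>F x in U. c x = c0"
proof (rule ccontr)
  assume "\<not> thesis"
  then have "\<forall>\<^sub>F x in U. c x \<noteq> c0" for c0 using that ultra_not[OF assms(1)] by blast
  then have "\<forall>\<^sub>F x in U. \<forall>c0\<in>range c. c x \<noteq> c0" using assms(2) by (intro eventually_ball_finite) auto
  then have "\<forall>\<^sub>F x in U. False" by (rule eventually_mono) blast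
  then show False using assms(1) by (auto simp: ultra_def)
qed

text \<open>For ultrafilters \<open>U\<close> and \<open>V\<close> this filter stands for the closed set of all \<open>x\<close> with
  \<open>x \<star> U = V\<close>.\<close>
definition multipliers :: "'a list filter \<Rightarrow> 'a list filter \<Rightarrow> 'a list filter" where
  "multipliers U V = (INF P\<in>{P. eventually P V}. principal {x. \<forall>\<^sub>F y in U. P (x @ y)})"

lemma eventually_multipliers:
  "eventually Q (multipliers U V) \<longleftrightarrow>
     (\<exists>P. eventually P V \<and> (\<forall>x. (\<forall>\<^sub>F y in U. P (x @ y)) \<longrightarrow> Q x))"
  unfolding multipliers_def
proof (subst eventually_INF_base)
  show "{P. eventually P V} \<noteq> {}" using eventually_True by blast
  fix P Q assume "P \<in> {P. eventually P V}" "Q \<in> {P. eventually P V}"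
  then show "\<exists>x\<in>{P. eventually P V}.
    principal {s. \<forall>\<^sub>F y in U. x (s @ y)} \<le> inf (principal {x. \<forall>\<^sub>F y in U. P (x @ y)}) (principal {x. \<forall>\<^sub>F y in U. Q (x @ y)})"
    by (intro bexI[of _ "\<lambda>x. P x \<and> Q x"]) (auto simp: eventually_conj_iff)
qed (auto simp: eventually_principal)

lemma le_multipliers_iff: "F \<le> multipliers U V \<longleftrightarrow> F \<star> U \<le> V"
proof
  assume le: "F \<le> multipliers U V"
  show "F \<star> U \<le> V"
  proof (rule filter_leI)
    fix P assume "eventually P V"
    then have "eventually (\<lambda>x. \<forall>\<^sub>F y in U. P (x @ y)) (multipliers U V)"
      unfolding eventually_multipliers by blast
    then show "eventually P (F \<star> U)" unfolding eventually_conv by (rule filter_leD[OF le])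
  qed
next
  assume le: "F \<star> U \<le> V"
  show "F \<le> multipliers U V"
  proof (rule filter_leI)
    fix Q assume "eventually Q (multipliers U V)"
    then obtain P where P: "eventually P V" "\<And>x. \<forall>\<^sub>F y in U. P (x @ y) \<Longrightarrow> Q x"
      unfolding eventually_multipliers by blast
    from filter_leD[OF le P(1)] show "eventually Q F"
      unfolding eventually_conv by (rule eventually_mono) (rule P(2))
  qed
qed

text \<open>Every ultrafilter in the closed set \<open>F \<star> U\<close> is a product \<open>x \<star> U\<close> with \<open>x\<close> in \<open>F\<close>: right
  multiplication by \<open>U\<close> maps compact sets to compact sets.\<close>
lemma inf_multipliers_neq_bot:
  assumes "ultra U" "V \<noteq> bot" "V \<le> F \<star> U"
  shows "inf F (multipliers U V) \<noteq> bot"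
proof
  assume "inf F (multipliers U V) = bot"
  then have "eventually (\<lambda>_. False) (inf F (multipliers U V))" by simp
  then obtain Q R where QR: "eventually Q F" "eventually R (multipliers U V)" "\<And>x. Q x \<Longrightarrow> R x \<Longrightarrow> False"
    unfolding eventually_inf by blast
  then obtain P where P: "eventually P V" "\<And>x. (\<forall>\<^sub>F y in U. P (x @ y)) \<Longrightarrow> R x"
    unfolding eventually_multipliers by blast
  have "\<forall>\<^sub>F x in F. \<forall>\<^sub>F y in U. \<not> P (x @ y)"
    using QR(1) by (rule eventually_mono) (use QR P ultra_not[OF assms(1)] in blast)
  then have "\<forall>\<^sub>F x in V. \<not> P x" using assms(3) by (auto simp: eventually_conv le_filter_def)
  with P(1) have "\<forall>\<^sub>F x in V. False" by eventually_elim simp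
  with assms(2) show False by simp
qed

text \<open>The lemma of Ellis and Numakura. In a minimal closed subsemigroup \<open>F\<close> every \<open>U\<close> satisfies
  \<open>F \<star> U = F\<close>; hence the closed subsemigroup of all \<open>x\<close> in \<open>F\<close> with \<open>x \<star> U = U\<close> is nonempty, and
  by minimality it contains \<open>U\<close>.\<close>
lemma idempotent_ultra_below:
  fixes H :: "'a list filter"
  assumes "H \<star> H \<le> H" "H \<noteq> bot"
  obtains U where "U \<le> H" "ultra U" "U \<star> U = U"
proof -
  obtain F where F: "F \<le> H" "F \<noteq> bot" "F \<star> F \<le> F"
    and min: "\<And>G. G \<le> F \<Longrightarrow> G \<noteq> bot \<Longrightarrow> G \<star> G \<le> G \<Longrightarrow> G = F"
  proof (rule minimal_filter_below[of "\<lambda>F. F \<star> F \<le> F" H])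
    fix B :: "'a list filter set"
    assume B: "B \<noteq> {}" "\<And>F G. F \<in> B \<Longrightarrow> G \<in> B \<Longrightarrow> F \<le> G \<or> G \<le> F" "\<And>F. F \<in> B \<Longrightarrow> F \<star> F \<le> F"
    show "Inf B \<star> Inf B \<le> Inf B"
      by (rule Inf_greatest) (meson B(3) Inf_lower conv_mono order.trans)
  qed (use assms in auto)
  obtain U where U: "U \<le> F" "ultra U" using ultra_below F(2) by blast
  have Ub: "U \<noteq> bot" using U(2) by (simp add: ultra_def)
  have le: "F \<star> U \<le> F" using U(1) F(3) by (meson conv_mono order.trans order_refl)
  have "(F \<star> U) \<star> (F \<star> U) \<le> F \<star> (F \<star> U)" by (rule conv_mono[OF le order_refl])
  also have "\<dots> \<le> F \<star> U" unfolding conv_assoc[symmetric] by (rule conv_mono[OF F(3) order_refl])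
  finally have FU: "F \<star> U = F" using min le conv_neq_bot F(2) Ub by blast
  let ?G = "inf F (multipliers U U)"
  have GU: "?G \<star> U \<le> U" unfolding le_multipliers_iff[symmetric] by simp
  have "(?G \<star> ?G) \<star> U \<le> ?G \<star> U" unfolding conv_assoc by (rule conv_mono[OF order_refl GU])
  then have "?G \<star> ?G \<le> multipliers U U" unfolding le_multipliers_iff using GU by (rule order.trans)
  moreover have "?G \<star> ?G \<le> F" by (meson F(3) conv_mono inf.cobounded1 order.trans)
  ultimately have "?G \<star> ?G \<le> ?G" by simp
  moreover have "?G \<noteq> bot" using U Ub FU by (intro inf_multipliers_neq_bot) auto
  ultimately have "?G = F" using min by simp
  then have "F \<le> multipliers U U" by (metis inf.cobounded2)
  then have "U \<star> U \<le> U" using U(1) order.trans unfolding le_multipliers_iff[symmetric] by blast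
  then have "U \<star> U = U" using U(2) Ub conv_neq_bot ultra_eq_below by blast
  with that U F(1) show ?thesis by (meson order.trans)
qed

section \<open>The Carlson-Simpson theorem\<close>

text \<open>Variable words are words over \<open>'k option\<close>, where \<open>None\<close> is the variable.\<close>
definition subst :: "'k \<Rightarrow> 'k option list \<Rightarrow> 'k list" where
  "subst a y = map (case_option a id) y"

lemma subst_simps [simp]:
  "subst a (x @ y) = subst a x @ subst a y" "subst a (map Some z) = z"
  "subst a (None # y) = a # subst a y" "length (subst a y) = length y"
  by (auto simp: subst_def comp_def)

definition word_of :: "(nat \<Rightarrow> 'k option list) \<Rightarrow> (nat \<Rightarrow> 'k) \<Rightarrow> nat \<Rightarrow> 'k list" where
  "word_of Y a m = concat (map (\<lambda>i. subst (a i) (Y i)) [0..<m])"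

lemma word_of_simps [simp]:
  "word_of Y a 0 = []" "word_of Y a (Suc m) = word_of Y a m @ subst (a m) (Y m)"
  by (auto simp: word_of_def)

text \<open>Let \<open>F\<close> be a minimal closed left ideal of the ultrafilters of words, and \<open>w\<close> in it. The
  left variable words form a right ideal and \<open>top \<star> w\<close> is a left ideal in the semigroup of
  variable words, so their intersection contains an idempotent \<open>v\<close>. Substituting \<open>a\<close> for the
  variable is a homomorphism that fixes the words without variable, so it sends \<open>v\<close> to an
  idempotent in \<open>F\<close>. In a minimal left ideal each idempotent is a right identity, which gives
  the last two equations.\<close>
lemma absorbing_ultrafilters:
  obtains w :: "'k list filter" and v :: "'k option list filter" where
    "ultra w" "ultra v" "\<forall>\<^sub>F y in v. \<exists>z. y = None # z"
    "\<And>a. w \<star> filtermap (subst a) v = w"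
    "\<And>a b. filtermap (subst a) v \<star> filtermap (subst b) v = filtermap (subst a) v"
proof -
  obtain F :: "'k list filter" where F: "F \<noteq> bot" "top \<star> F \<le> F"
    and min: "\<And>G. G \<le> F \<Longrightarrow> G \<noteq> bot \<Longrightarrow> top \<star> G \<le> G \<Longrightarrow> G = F"
  proof (rule minimal_filter_below[of "\<lambda>F :: 'k list filter. top \<star> F \<le> F" top])
    fix B :: "'k list filter set"
    assume B: "B \<noteq> {}" "\<And>F. F \<in> B \<Longrightarrow> top \<star> F \<le> F"
    show "top \<star> Inf B \<le> Inf B"
      by (rule Inf_greatest) (meson B(2) Inf_lower conv_mono order.trans order_refl)
  next
    show "(top :: 'k list filter) \<noteq> bot" by (rule top_filter_neq_bot)
  qed auto
  have left_ideal: "top \<star> u = F" if "u \<le> F" "u \<noteq> bot" for u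
  proof (rule min)
    show "top \<star> u \<le> F" using that F(2) by (meson conv_mono order.trans order_refl)
    show "top \<star> u \<noteq> bot" using that by (intro conv_neq_bot top_filter_neq_bot)
    show "top \<star> (top \<star> u) \<le> top \<star> u"
      unfolding conv_assoc[symmetric] by (rule conv_mono) auto
  qed
  \<comment> \<open>By minimality \<open>F = top \<star> e\<close>, so \<open>x = y \<star> e\<close> for some \<open>y\<close>.\<close>
  have absorb: "x \<star> e = x" if x: "x \<le> F" "ultra x" and e: "e \<le> F" "ultra e" "e \<star> e = e" for x e
  proof -
    have "x \<le> top \<star> e" using x(1) left_ideal e by (simp add: ultra_def)
    then have "inf top (multipliers e x) \<noteq> bot" using e(2) x(2) by (intro inf_multipliers_neq_bot) (auto simp: ultra_def)
    then have "multipliers e x \<star> e \<noteq> bot" using e(2) by (intro conv_neq_bot) (auto simp: ultra_def)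
    then have "multipliers e x \<star> e = x" using x(2) le_multipliers_iff[of "multipliers e x"] by (intro ultra_eq_below) auto
    then show ?thesis by (metis conv_assoc e(3))
  qed
  obtain w where w: "w \<le> F" "ultra w" using ultra_below F(1) by blast
  \<comment> \<open>Left variable words that end like words chosen by \<open>w\<close>.\<close>
  define H where "H = inf (principal {y :: 'k option list. \<exists>z. y = None # z}) (top \<star> filtermap (map Some) w)"
  have "H \<star> H \<le> top \<star> (top \<star> filtermap (map Some) w)" unfolding H_def by (intro conv_mono) auto
  also have "\<dots> \<le> top \<star> filtermap (map Some) w" unfolding conv_assoc[symmetric] by (intro conv_mono) auto
  finally have HH: "H \<star> H \<le> top \<star> filtermap (map Some) w" .
  have "H \<le> principal {y. \<exists>z. y = None # z}" by (simp add: H_def)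
  then have "\<forall>\<^sub>F y in H. \<exists>z. y = None # z" by (simp add: le_principal)
  then have "\<forall>\<^sub>F x in H. \<forall>\<^sub>F y in H. \<exists>z. x @ y = None # z"
    by (rule eventually_mono) auto
  then have "H \<star> H \<le> principal {y. \<exists>z. y = None # z}" by (simp add: le_principal eventually_conv)
  with HH have "H \<star> H \<le> H" by (subst (3) H_def) simp
  moreover have "H \<noteq> bot"
  proof
    assume "H = bot"
    then have "\<forall>\<^sub>F y in top \<star> filtermap (map Some) w. \<not> (\<exists>z. y = None # z)"
      by (simp add: H_def inf_commute eventually_inf_principal trivial_limit_def)
    then have "\<forall>\<^sub>F y in w. \<not> (\<exists>z. [None] @ map Some y = None # z)"
      unfolding eventually_conv eventually_filtermap eventually_top by blast
    then show False using w(2) by (auto simp: ultra_def)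
  qed
  ultimately obtain v where v: "v \<le> H" "ultra v" "v \<star> v = v" using idempotent_ultra_below by blast
  have e: "filtermap (subst a) v \<le> F" "ultra (filtermap (subst a) v)"
      "filtermap (subst a) v \<star> filtermap (subst a) v = filtermap (subst a) v" for a
  proof -
    have "filtermap (subst a) v \<le> filtermap (subst a) (top \<star> filtermap (map Some) w)"
      using v(1) by (intro filtermap_mono) (simp add: H_def)
    also have "\<dots> \<le> top \<star> w"
      by (auto simp: filtermap_conv filtermap_filtermap filtermap_ident intro!: conv_mono)
    also have "\<dots> \<le> F" using left_ideal w by (simp add: ultra_def)
    finally show "filtermap (subst a) v \<le> F" .
    show "ultra (filtermap (subst a) v)" using v(2) by (rule ultra_filtermap)
    show "filtermap (subst a) v \<star> filtermap (subst a) v = filtermap (subst a) v"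
      by (metis filtermap_conv subst_simps(1) v(3))
  qed
  have "\<forall>\<^sub>F y in v. \<exists>z. y = None # z" using v(1) by (auto simp: H_def le_principal)
  with that w v(2) e absorb show ?thesis by metis
qed

text \<open>The colour is the one that \<open>w\<close> prefers. The variable words are chosen one after the other,
  so that for each word \<open>x\<close> built so far \<open>x\<close> has the right colour and so has \<open>x @ subst a y\<close> for
  \<open>v\<close>-almost all \<open>y\<close>; the two absorption equations are what lets this invariant continue.\<close>
theorem carlson_simpson:
  fixes c :: "'k list \<Rightarrow> 'c"
  assumes A: "finite A" and c: "finite (range c)"
  obtains w Y c0 where "\<And>i. \<exists>y. Y i = None # y"
    and "\<And>m a. (\<And>i. i < m \<Longrightarrow> a i \<in> A) \<Longrightarrow> c (w @ word_of Y a m) = c0"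
proof -
  obtain w :: "'k list filter" and v where w: "ultra w" and v: "ultra v"
    and var: "\<forall>\<^sub>F y in v. \<exists>z. y = None # z"
    and we: "\<And>a. w \<star> filtermap (subst a) v = w"
    and ee: "\<And>a b. filtermap (subst a) v \<star> filtermap (subst b) v = filtermap (subst a) v"
    using absorbing_ultrafilters by metis
  obtain c0 where c0: "\<forall>\<^sub>F x in w. c x = c0" using ultra_finite_range[OF w c] .
  \<comment> \<open>The invariant for the words built so far.\<close>
  define ok where "ok x \<longleftrightarrow> c x = c0 \<and> (\<forall>a\<in>A. \<forall>\<^sub>F y in v. c (x @ subst a y) = c0)" for x
  have "\<forall>\<^sub>F x in w. \<forall>\<^sub>F y in v. c (x @ subst a y) = c0" for a
    using c0 we[of a] eventually_conv[of "\<lambda>x. c x = c0" w "filtermap (subst a) v"]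
    by (simp add: eventually_filtermap)
  then have "\<forall>\<^sub>F x in w. \<forall>a\<in>A. \<forall>\<^sub>F y in v. c (x @ subst a y) = c0"
    using A by (intro eventually_ball_finite) auto
  with c0 have "\<forall>\<^sub>F x in w. ok x" unfolding ok_def by (rule eventually_conj)
  then obtain w0 where w0: "ok w0" using w eventually_happens' unfolding ultra_def by blast
  have "\<exists>y. (\<exists>z. y = None # z) \<and> (\<forall>x\<in>X. \<forall>a\<in>A. ok (x @ subst a y))"
    if X: "finite X" "\<forall>x\<in>X. ok x" for X
  proof -
    have "\<forall>\<^sub>F y in v. ok (x @ subst a y)" if xa: "x \<in> X" "a \<in> A" for x a
    proof -
      have 1: "\<forall>\<^sub>F y in v. c (x @ subst a y) = c0" using X xa by (auto simp: ok_def)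
      have "\<forall>\<^sub>F y in v. \<forall>\<^sub>F y' in v. c ((x @ subst a y) @ subst b y') = c0" if "b \<in> A" for b
        using 1 ee[of a b] eventually_conv[of "\<lambda>y. c (x @ y) = c0" "filtermap (subst a) v" "filtermap (subst b) v"]
        by (simp add: eventually_filtermap)
      then have "\<forall>\<^sub>F y in v. \<forall>b\<in>A. \<forall>\<^sub>F y' in v. c ((x @ subst a y) @ subst b y') = c0"
        using A by (intro eventually_ball_finite) auto
      with 1 show ?thesis unfolding ok_def by (rule eventually_conj)
    qed
    then have "\<forall>\<^sub>F y in v. \<forall>x\<in>X. \<forall>a\<in>A. ok (x @ subst a y)"
      using A X(1) by (intro eventually_ball_finite ballI) auto
    with var have "\<forall>\<^sub>F y in v. (\<exists>z. y = None # z) \<and> (\<forall>x\<in>X. \<forall>a\<in>A. ok (x @ subst a y))"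
      by (rule eventually_conj)
    then show ?thesis using v eventually_happens' unfolding ultra_def by blast
  qed
  then obtain nxt where nxt: "\<And>X. finite X \<Longrightarrow> \<forall>x\<in>X. ok x \<Longrightarrow>
      (\<exists>z. nxt X = None # z) \<and> (\<forall>x\<in>X. \<forall>a\<in>A. ok (x @ subst a (nxt X)))" by metis
  define X where "X = rec_nat {w0} (\<lambda>_ X. (\<lambda>(x, a). x @ subst a (nxt X)) ` (X \<times> A))"
  have X_simps: "X 0 = {w0}" "X (Suc m) = (\<lambda>(x, a). x @ subst a (nxt (X m))) ` (X m \<times> A)" for m
    by (simp_all add: X_def)
  have X: "finite (X m) \<and> (\<forall>x\<in>X m. ok x)" for m
  proof (induction m)
    case (Suc m) then show ?case using nxt[of "X m"] A by (auto simp: X_simps)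
  qed (simp add: X_simps w0)
  have mem: "w0 @ word_of (\<lambda>i. nxt (X i)) a m \<in> X m" if "\<And>i. i < m \<Longrightarrow> a i \<in> A" for a m
    using that
  proof (induction m)
    case (Suc m)
    then have "w0 @ word_of (\<lambda>i. nxt (X i)) a m \<in> X m" "a m \<in> A" by auto
    then have "(w0 @ word_of (\<lambda>i. nxt (X i)) a m) @ subst (a m) (nxt (X m)) \<in> X (Suc m)"
      unfolding X_simps by (intro image_eqI[of _ _ "(_, a m)"]) auto
    then show ?case by simp
  qed (simp add: X_simps)
  show ?thesis
  proof (rule that[of "\<lambda>i. nxt (X i)" w0 c0])
    show "\<exists>y. nxt (X i) = None # y" for i using nxt X by blast
    show "c (w0 @ word_of (\<lambda>i. nxt (X i)) a m) = c0" if "\<And>i. i < m \<Longrightarrow> a i \<in> A" for m a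
      using mem[of m a, OF that] X[of m] unfolding ok_def by blast
  qed
qed

section \<open>The binary tree numbered level by level\<close>

text \<open>The nodes of the binary tree are numbered in level order, as in a heap: the root is \<open>0\<close>
  and the children of \<open>i\<close> are \<open>2 * i + 1\<close> and \<open>2 * i + 2\<close>. The usual order of the natural
  numbers is then the order by length and, within a level, lexicographically.\<close>
definition child :: "bool \<Rightarrow> nat \<Rightarrow> nat" where
  "child b i = 2 * i + (if b then 2 else 1)"

fun path :: "nat \<Rightarrow> bool list" where
  "path i = (if i = 0 then [] else path ((i - 1) div 2) @ [even i])"

declare path.simps [simp del]

lemma path_0 [simp]: "path 0 = []"
  by (simp add: path.simps)

lemma path_child [simp]: "path (child b i) = path i @ [b]"
  by (subst path.simps) (auto simp: child_def)

lemma nonzero_child: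
  assumes "0 < i" shows "i = child (even i) ((i - 1) div 2)"
  using assms by (auto simp: child_def elim!: evenE oddE)

lemma heap_induct [case_names root child]:
  assumes "P 0" "\<And>b i. P i \<Longrightarrow> P (child b i)"
  shows "P i"
proof (induction i rule: less_induct)
  case (less i)
  show ?case
  proof (cases "i = 0")
    case False
    then have "P ((i - 1) div 2)" by (intro less.IH) linarith
    then show ?thesis using assms(2) nonzero_child[of i] False by (metis neq0_conv)
  qed (simp add: assms)
qed

lemma inj_path: "inj path"
proof (rule injI)
  fix i j assume "path i = path j"
  then show "i = j"
  proof (induction i arbitrary: j rule: heap_induct)
    case root then show ?case by (subst (asm) (2) path.simps) (auto split: if_splits)
  next
    case (child b i)
    then have "0 < j" by (cases "j = 0") auto
    then obtain b' j' where "j = child b' j'" using nonzero_child by blast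
    with child show ?case by auto
  qed
qed

lemma path_eq_iff [simp]: "path i = path j \<longleftrightarrow> i = j"
  using inj_path by (auto dest: injD)

definition desc :: "nat \<Rightarrow> bool list \<Rightarrow> nat" where
  "desc i z = foldl (\<lambda>i b. child b i) i z"

lemma desc_simps [simp]:
  "desc i [] = i" "desc i (b # z) = desc (child b i) z" "desc i (z @ z') = desc (desc i z) z'"
  by (simp_all add: desc_def)

lemma path_desc [simp]: "path (desc i z) = path i @ z"
  by (induction z arbitrary: i) auto

lemma path_surj: obtains i where "path i = z"
  by (rule that[of "desc 0 z"]) simp

lemma prefix_pathE:
  assumes "prefix (path i) (path j)" obtains z where "j = desc i z"
  using assms by (metis path_desc path_eq_iff prefixE)

lemma desc_ge: "i + length z \<le> desc i z"
proof (induction z arbitrary: i)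
  case (Cons b z)
  have "i + 1 \<le> child b i" by (simp add: child_def)
  then show ?case using Cons[of "child b i"] by simp
qed simp

lemma desc_bounds:
  "2 ^ length z * Suc i \<le> Suc (desc i z)" "Suc (desc i z) < 2 ^ length z * Suc (Suc i)"
proof (induction z rule: rev_induct)
  case (snoc b z)
  { case 1 show ?case using snoc(1) by (auto simp: child_def) }
  { case 2 show ?case using snoc(2) by (auto simp: child_def) }
qed auto

lemma prefix_path_le: "prefix (path i) (path j) \<Longrightarrow> i \<le> j"
  by (erule prefix_pathE) (metis desc_ge add_leD1)

lemma prefix_path_child_le: "prefix (path i @ [b]) (path j) \<Longrightarrow> 2 * i + 1 \<le> j"
  using prefix_path_le[of "child b i" j, unfolded path_child] by (auto simp: child_def split: if_splits)

lemma desc_0_path [simp]: "desc 0 (path i) = i"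
  using path_desc[of 0 "path i"] by (metis append_Nil path_0 path_eq_iff)

lemma length_path_mono: "i \<le> j \<Longrightarrow> length (path i) \<le> length (path j)"
proof (rule ccontr)
  assume "i \<le> j" "\<not> length (path i) \<le> length (path j)"
  moreover have "2 ^ length (path i) \<le> Suc i" for i
    using desc_bounds(1)[of "path i" 0] by simp
  moreover have "Suc j < 2 * 2 ^ length (path j)" for j
    using desc_bounds(2)[of 0 "path j"] by simp
  moreover have "(2::nat) ^ Suc (length (path j)) \<le> 2 ^ length (path i)" 
    using calculation(2) by (intro power_increasing) auto
  ultimately show False by (metis Suc_le_mono leD order.strict_trans2 order.trans power_Suc)
qed

text \<open>So the numbering is lexicographic within a level.\<close>
lemma same_level_split:
  assumes "i < j" "length (path i) = length (path j)"
  obtains p where "prefix (path p @ [False]) (path i)" "prefix (path p @ [True]) (path j)"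
proof -
  have "\<exists>p. prefix (path p @ [False]) (path i) \<and> prefix (path p @ [True]) (path j)"
    using assms
  proof (induction i arbitrary: j rule: heap_induct)
    case root
    then have "path j = path 0" by simp
    then show ?case using root by (simp only: path_eq_iff)
  next
    case (child b i)
    then have "0 < j" by simp
    then obtain b' j' where j: "j = child b' j'" using nonzero_child by blast
    then have "i < j' \<or> i = j' \<and> \<not> b \<and> b'"
      using child.prems(1) by (cases b; cases b') (auto simp: child_def)
    then consider "i < j'" | "i = j'" "b = False" "b' = True" by blast
    then show ?case
    proof cases
      case 1
      then obtain p where "prefix (path p @ [False]) (path i)" "prefix (path p @ [True]) (path j')"
        using child.IH child.prems j by auto
      then show ?thesis using j by (auto intro!: exI[of _ p] prefix_prefix)
    qed (use j in auto)
  qed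
  with that show ?thesis by blast
qed

lemma strict_prefix_iff_child: "strict_prefix u v \<longleftrightarrow> (\<exists>b. prefix (u @ [b]) v)"
proof
  assume "strict_prefix u v" then show "\<exists>b. prefix (u @ [b]) v" by (elim strict_prefixE') auto
next
  assume "\<exists>b. prefix (u @ [b]) v" then show "strict_prefix u v"
    by (auto simp: prefix_def intro: strict_prefixI')
qed

lemma strict_prefix_childE:
  assumes "strict_prefix u v" obtains b where "prefix (u @ [b]) v"
  using assms strict_prefix_iff_child[of u v] by blast

lemma strict_prefix_if_child: "prefix (u @ [b]) v \<Longrightarrow> strict_prefix u v"
  using strict_prefix_iff_child[of u v] by blast

lemma heap_cases:
  obtains (eq) "i = j"
  | (above) b where "prefix (path i @ [b]) (path j)"
  | (below) b where "prefix (path j @ [b]) (path i)"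
  | (parallel) p b where "prefix (path p @ [b]) (path i)" "prefix (path p @ [\<not> b]) (path j)"
proof -
  consider "path i = path j" | "strict_prefix (path i) (path j)" | "strict_prefix (path j) (path i)"
    | "path i \<parallel> path j" by (metis prefix_order.le_less parallelI)
  then show ?thesis
  proof cases
    case 2 then show ?thesis using above unfolding strict_prefix_iff_child by blast
  next
    case 3 then show ?thesis using below unfolding strict_prefix_iff_child by blast
  next
    case 4
    then obtain u b x b' y where u: "b \<noteq> b'" "path i = u @ b # x" "path j = u @ b' # y"
      using parallel_decomp[OF 4] by auto
    obtain p where "path p = u" by (rule path_surj)
    with u have "prefix (path p @ [b]) (path i)" "prefix (path p @ [\<not> b]) (path j)" by auto
    then show ?thesis by (rule parallel)
  next
    case 1
    then show ?thesis by (intro eq) simp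
  qed
qed

section \<open>Skeletons and embeddings\<close>

text \<open>A copy of the binary tree inside the binary words. The nodes \<open>s i\<close> will be the splitting
  nodes of a perfect tree.\<close>
definition skeleton :: "(nat \<Rightarrow> bool list) \<Rightarrow> bool" where
  "skeleton s \<longleftrightarrow> (\<forall>i b. prefix (s i @ [b]) (s (child b i)))"

lemma skeleton_path: "skeleton path"
  by (simp add: skeleton_def)

lemma skeleton_desc: "skeleton s \<Longrightarrow> prefix (s i) (s (desc i z))"
proof (induction z arbitrary: i)
  case (Cons b z)
  then have "prefix (s i @ [b]) (s (child b i))" by (simp add: skeleton_def)
  then have "prefix (s i) (s (child b i))" by (rule append_prefixD)
  then show ?case using Cons by (metis desc_simps(2) prefix_order.trans)
qed simp

lemma not_prefix_both: "prefix (u @ [b]) v \<Longrightarrow> prefix (u @ [\<not> b]) v \<Longrightarrow> False"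
  by (auto simp: prefix_def)

text \<open>A skeleton reflects the tree order, because two nodes that are not on a common branch
  separate at a common ancestor, and their images then separate at the image of that ancestor.\<close>
lemma skeleton_prefix_child_iff:
  assumes "skeleton s"
  shows "prefix (s i @ [b]) (s j) \<longleftrightarrow> prefix (path i @ [b]) (path j)"
proof
  have dir: "prefix (s i @ [b]) (s j)" if "prefix (path i @ [b]) (path j)" for i j b
  proof -
    from that have "prefix (path (child b i)) (path j)" by simp
    then obtain z where "j = desc (child b i) z" by (rule prefix_pathE)
    then show ?thesis using assms skeleton_desc[OF assms, of "child b i" z]
      by (auto simp: skeleton_def intro: prefix_order.trans)
  qed
  then show "prefix (path i @ [b]) (path j) \<Longrightarrow> prefix (s i @ [b]) (s j)" .
  assume p: "prefix (s i @ [b]) (s j)"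
  show "prefix (path i @ [b]) (path j)"
  proof (cases i j rule: heap_cases)
    case eq with p show ?thesis by (auto simp: prefix_def)
  next
    case (above b')
    then show ?thesis using dir[OF above] p not_prefix_both[of "s i" b "s j"] by (cases "b' = b") auto
  next
    case (below b')
    then show ?thesis using dir[OF below] p by (auto dest!: prefix_length_le)
  next
    case (parallel q b')
    have "prefix (s q @ [b']) (s j)" using dir[OF parallel(1)] append_prefixD[OF p]
      by (rule prefix_order.trans)
    then show ?thesis using dir[OF parallel(2)] not_prefix_both by blast
  qed
qed

lemma skeleton_inj:
  assumes "skeleton s" "s i = s j" shows "i = j"
proof (cases i j rule: heap_cases)
  case (above b) then have "prefix (s i @ [b]) (s j)" using assms(1) skeleton_prefix_child_iff by blast
  then show ?thesis using assms(2) by (auto simp: prefix_def)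
next
  case (below b) then have "prefix (s j @ [b]) (s i)" using assms(1) skeleton_prefix_child_iff by blast
  then show ?thesis using assms(2) by (auto simp: prefix_def)
next
  case (parallel p b)
  then have "prefix (s p @ [b]) (s i)" "prefix (s p @ [\<not> b]) (s j)" 
    using assms(1) skeleton_prefix_child_iff by blast+
  then show ?thesis using assms(2) not_prefix_both by metis
qed

lemma skeleton_strict_prefix_iff:
  "skeleton s \<Longrightarrow> strict_prefix (s i) (s j) \<longleftrightarrow> strict_prefix (path i) (path j)"
  by (simp add: strict_prefix_iff_child skeleton_prefix_child_iff)

lemma skeleton_prefix_iff:
  "skeleton s \<Longrightarrow> prefix (s i) (s j) \<longleftrightarrow> prefix (path i) (path j)"
  using skeleton_strict_prefix_iff[of s i j] skeleton_inj[of s i j]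
  by (auto simp: prefix_order.le_less)

text \<open>The increasing embeddings of the numbered tree into itself that fix its first \<open>n\<close> nodes.
  Being increasing ensures that good trees are carried to good trees.\<close>
definition Emb :: "nat \<Rightarrow> (nat \<Rightarrow> nat) set" where
  "Emb n = {\<sigma>. strict_mono \<sigma> \<and> skeleton (path \<circ> \<sigma>) \<and> (\<forall>i<n. \<sigma> i = i)}"

lemma EmbD:
  assumes "\<sigma> \<in> Emb n"
  shows Emb_strict_mono: "strict_mono \<sigma>" and Emb_skeleton: "skeleton (path \<circ> \<sigma>)"
    and Emb_fix: "i < n \<Longrightarrow> \<sigma> i = i"
  using assms by (auto simp: Emb_def)

lemma Emb_antimono: "m \<le> n \<Longrightarrow> \<sigma> \<in> Emb n \<Longrightarrow> \<sigma> \<in> Emb m"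
  by (auto simp: Emb_def)

lemma Emb_0: "\<sigma> \<in> Emb n \<Longrightarrow> \<sigma> \<in> Emb 0"
  by (auto simp: Emb_def)

lemma Emb_ge: "\<sigma> \<in> Emb n \<Longrightarrow> i \<le> \<sigma> i"
  by (intro strict_mono_imp_increasing Emb_strict_mono)

lemma id_Emb [simp]: "id \<in> Emb n"
  by (simp add: Emb_def strict_mono_def skeleton_path)

lemma skeleton_comp:
  assumes "skeleton s" "\<tau> \<in> Emb n" shows "skeleton (s \<circ> \<tau>)"
  using Emb_skeleton[OF assms(2)] unfolding skeleton_def comp_def
  by (simp add: skeleton_prefix_child_iff[OF assms(1)])

lemma Emb_comp: "\<sigma> \<in> Emb n \<Longrightarrow> \<tau> \<in> Emb n \<Longrightarrow> \<sigma> \<circ> \<tau> \<in> Emb n"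
  unfolding Emb_def using skeleton_comp[of "path \<circ> \<sigma>" \<tau> n]
  by (auto simp: Emb_def strict_mono_def comp_assoc)

lemma Emb_comp0: "\<sigma> \<in> Emb m \<Longrightarrow> \<tau> \<in> Emb n \<Longrightarrow> \<sigma> \<circ> \<tau> \<in> Emb 0"
  by (meson Emb_0 Emb_comp)

lemma skeleton_factor:
  assumes "skeleton s" "skeleton (s \<circ> \<tau>)" shows "skeleton (path \<circ> \<tau>)"
  using assms(2) unfolding skeleton_def comp_def
  by (simp add: skeleton_prefix_child_iff[OF assms(1)])

text \<open>The inclusion of ranges is the subtree relation. Since embeddings reflect the order, a
  copy inside another copy is a copy relative to it.\<close>
lemma Emb_factor:
  assumes \<pi>: "\<pi> \<in> Emb 0" and \<pi>': "\<pi>' \<in> Emb 0" and "range \<pi>' \<subseteq> range \<pi>" "\<And>i. i < n \<Longrightarrow> \<pi>' i = \<pi> i"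
  obtains \<theta> where "\<theta> \<in> Emb n" "\<pi>' = \<pi> \<circ> \<theta>"
proof -
  have "\<forall>i. \<exists>j. \<pi>' i = \<pi> j" using assms(3) by blast
  then obtain \<theta> where \<theta>: "\<And>i. \<pi>' i = \<pi> (\<theta> i)" by metis
  have sm: "strict_mono \<pi>" "strict_mono \<pi>'" using \<pi> \<pi>' by (auto intro: Emb_strict_mono)
  then have "strict_mono \<theta>" unfolding strict_mono_def by (metis \<theta> sm(1) strict_mono_less)
  moreover have "skeleton ((path \<circ> \<pi>) \<circ> \<theta>)" using Emb_skeleton[OF \<pi>'] \<theta> by (simp add: comp_def)
  then have "skeleton (path \<circ> \<theta>)" using skeleton_factor Emb_skeleton[OF \<pi>] by blast
  moreover have "\<theta> i = i" if "i < n" for i using \<theta> assms(4)[OF that] sm(1) by (metis strict_mono_eq)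
  ultimately show ?thesis using \<theta> by (intro that[of \<theta>]) (auto simp: Emb_def)
qed

lemma Emb_prefix: "\<sigma> \<in> Emb n \<Longrightarrow> prefix (path (\<sigma> i)) (path (\<sigma> j)) \<longleftrightarrow> prefix (path i) (path j)"
  using skeleton_prefix_iff[OF Emb_skeleton] by simp

lemma Emb_prefix_child:
  "\<sigma> \<in> Emb n \<Longrightarrow> prefix (path (\<sigma> i) @ [b]) (path (\<sigma> j)) \<longleftrightarrow> prefix (path i @ [b]) (path j)"
  using skeleton_prefix_child_iff[OF Emb_skeleton] by simp

lemma Emb_above:
  assumes "\<sigma> \<in> Emb m" "f \<le> 2 * m" "prefix (path f) (path j)"
  shows "prefix (path f) (path (\<sigma> j))"
proof (cases "f = 0")
  case False
  then obtain b p where f: "f = child b p" using nonzero_child by blast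
  then have "p < m" using assms(2) by (auto simp: child_def split: if_splits)
  then have "\<sigma> p = p" using assms(1) Emb_fix by blast
  moreover have "prefix (path (\<sigma> p) @ [b]) (path (\<sigma> j))"
    using assms(1,3) by (subst Emb_prefix_child) (auto simp: f)
  ultimately show ?thesis by (simp add: f)
qed simp

text \<open>The nodes \<open>k, \<dots>, 2 * k\<close> are the terminal nodes of the finite tree with inner nodes
  \<open>0, \<dots>, k - 1\<close>; they form a maximal antichain.\<close>
lemma frontier_below:
  assumes "k \<le> j" obtains f where "k \<le> f" "f \<le> 2 * k" "prefix (path f) (path j)"
proof -
  have "\<exists>f. k \<le> f \<and> f \<le> 2 * k \<and> prefix (path f) (path j)" using assms
  proof (induction j rule: heap_induct)
    case (child b j)
    show ?case
    proof (cases "k \<le> j")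
      case True
      then show ?thesis using child by (metis path_child prefix_prefix)
    next
      case False
      then show ?thesis using child by (intro exI[of _ "child b j"]) (auto simp: child_def)
    qed
  qed auto
  with that show ?thesis by blast
qed

lemma frontier_antichain:
  assumes "m \<le> f" "f' \<le> 2 * m" "prefix (path f) (path f')"
  shows "f = f'"
proof (rule ccontr)
  assume "f \<noteq> f'"
  then obtain b where "prefix (path f @ [b]) (path f')"
    using assms(3) by (metis path_eq_iff prefix_order.le_less strict_prefix_iff_child)
  then show False using prefix_path_child_le[of f b f'] assms by simp
qed

text \<open>The values are chosen in the order of the indices, each above the child prescribed by its
  parent and beyond the value chosen before it. \<open>G\<close> allows the values to grow as fast as needed.\<close>
lemma exists_Emb_into:
  fixes W :: "nat set" and G :: "nat \<Rightarrow> nat"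
  assumes W1: "\<And>f N. m \<le> f \<Longrightarrow> f \<le> 2 * m \<Longrightarrow> \<exists>w\<in>W. N \<le> w \<and> prefix (path f) (path w)"
    and W2: "\<And>w b N. w \<in> W \<Longrightarrow> \<exists>w'\<in>W. N \<le> w' \<and> prefix (path w @ [b]) (path w')"
  obtains \<rho> where "\<rho> \<in> Emb m" "\<And>i. m \<le> i \<Longrightarrow> \<rho> i \<in> W" "\<And>i. m \<le> Suc i \<Longrightarrow> G (\<rho> i) \<le> \<rho> (Suc i)"
proof -
  \<comment> \<open>The requirement on the value \<open>r\<close> at \<open>i\<close> when the values before \<open>i\<close> are given by \<open>f\<close>.\<close>
  define P where "P f i r \<longleftrightarrow> (if i < m then r = i else r \<in> W \<and>
    (0 < i \<longrightarrow> Suc (f (i - 1)) \<le> r \<and> G (f (i - 1)) \<le> r \<and> prefix (path (f ((i - 1) div 2)) @ [even i]) (path r)))"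
    for f i and r :: nat
  have "\<exists>\<rho>. \<forall>i. P \<rho> i (\<rho> i)"
  proof (rule dependent_wellorder_choice)
    fix r :: nat and f g :: "nat \<Rightarrow> nat" and i :: nat
    assume fg: "\<And>y. y < i \<Longrightarrow> f y = g y"
    have "f (i - 1) = g (i - 1)" "f ((i - 1) div 2) = g ((i - 1) div 2)" if "0 < i"
      using that by (auto intro!: fg)
    then show "P f i r = P g i r" by (auto simp: P_def)
  next
    fix i f assume IH: "\<And>y. y < i \<Longrightarrow> P f y (f y)"
    let ?N = "max (Suc (f (i - 1))) (G (f (i - 1)))"
    show "\<exists>r. P f i r"
    proof (cases "i < m \<or> i = 0")
      case True
      then show ?thesis using W1[of 0 0] by (auto simp: P_def)
    next
      case False
      let ?p = "(i - 1) div 2" and ?b = "even i"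
      have i: "i = child ?b ?p" "?p < i" using False nonzero_child[of i] by auto
      have "\<exists>r\<in>W. ?N \<le> r \<and> prefix (path (f ?p) @ [?b]) (path r)"
      proof (cases "?p < m")
        case True
        then have "f ?p = ?p" using IH[OF i(2)] by (simp add: P_def)
        then have "path i = path (f ?p) @ [?b]" using i(1) by (metis path_child)
        then show ?thesis using W1[of i ?N] True False by fastforce
      next
        case False
        then have "f ?p \<in> W" using IH[OF i(2)] by (simp add: P_def)
        then show ?thesis by (rule W2)
      qed
      then show ?thesis using False by (auto simp: P_def)
    qed
  qed
  then obtain \<rho> where \<rho>: "\<And>i. P \<rho> i (\<rho> i)" by blast
  have low: "\<rho> i = i" if "i < m" for i using \<rho>[of i] that by (simp add: P_def)
  have "\<rho> i < \<rho> (Suc i)" for i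
  proof (cases "Suc i < m")
    case False then show ?thesis using \<rho>[of "Suc i"] by (simp add: P_def)
  qed (simp add: low)
  then have "strict_mono \<rho>" by (simp add: strict_mono_Suc_iff)
  moreover have "prefix (path (\<rho> i) @ [b]) (path (\<rho> (child b i)))" for i b
  proof (cases "child b i < m")
    case True
    then have "i < m" by (auto simp: child_def split: if_splits)
    then show ?thesis using True by (simp add: low)
  next
    case False
    moreover have "(child b i - 1) div 2 = i" "even (child b i) = b" by (auto simp: child_def)
    moreover have "0 < child b i" by (simp add: child_def)
    ultimately show ?thesis using \<rho>[of "child b i"] by (simp add: P_def)
  qed
  ultimately have "\<rho> \<in> Emb m" using low by (auto simp: Emb_def skeleton_def)
  then show ?thesis
  proof (rule that)
    show "\<rho> i \<in> W" if "m \<le> i" for i using \<rho>[of i] that by (simp add: P_def)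
    show "G (\<rho> i) \<le> \<rho> (Suc i)" if "m \<le> Suc i" for i using \<rho>[of "Suc i"] that by (simp add: P_def)
  qed
qed

section \<open>Fusion of embeddings\<close>

text \<open>The list \<open>g\<close> of length \<open>2 * k + 1\<close> is a finite approximation of \<open>\<tau>\<close>: it gives the first
  \<open>k\<close> values and, for each of the \<open>k + 1\<close> terminal nodes above them, a node which the image of
  that terminal node extends.\<close>
definition conforms :: "nat \<Rightarrow> nat list \<Rightarrow> (nat \<Rightarrow> nat) \<Rightarrow> bool" where
  "conforms k g \<tau> \<longleftrightarrow> (\<forall>i<k. \<tau> i = g ! i) \<and>
     (\<forall>i. k \<le> i \<longrightarrow> i \<le> 2 * k \<longrightarrow> prefix (path (g ! i)) (path (\<tau> i)))"

text \<open>The approximations at time \<open>m\<close>: the values which are already fixed lie below \<open>m\<close>, and the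
  remaining entries lie in the frontier \<open>{m..2 * m}\<close>. An embedding that fixes the numbers below
  \<open>m\<close> does not change such an approximation.\<close>
definition frontier_types :: "nat \<Rightarrow> (nat \<times> nat list) set" where
  "frontier_types m = {(k, g). k \<le> m \<and> length g = Suc (2 * k) \<and> set g \<subseteq> {..2 * m} \<and>
     (\<forall>i<k. g ! i < m) \<and> (\<forall>i. k \<le> i \<longrightarrow> i \<le> 2 * k \<longrightarrow> m \<le> g ! i)}"

lemma finite_frontier_types: "finite (frontier_types m)"
proof (rule finite_subset)
  show "frontier_types m \<subseteq> (SIGMA k:{..m}. {g. set g \<subseteq> {..2 * m} \<and> length g = Suc (2 * k)})"
    by (auto simp: frontier_types_def)
qed (auto intro: finite_lists_length_eq)

lemma frontier_typesD:
  assumes "(k, g) \<in> frontier_types m"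
  shows "k \<le> m" "i < k \<Longrightarrow> g ! i < m" "k \<le> i \<Longrightarrow> i \<le> 2 * k \<Longrightarrow> m \<le> g ! i"
    "i \<le> 2 * k \<Longrightarrow> g ! i \<le> 2 * m"
proof -
  have "g ! i \<in> set g" if "i \<le> 2 * k" using assms that by (auto simp: frontier_types_def)
  moreover have "set g \<subseteq> {..2 * m}" using assms by (simp add: frontier_types_def)
  ultimately show "i \<le> 2 * k \<Longrightarrow> g ! i \<le> 2 * m" by blast
qed (use assms in \<open>auto simp: frontier_types_def\<close>)

lemma conforms_comp:
  assumes "(k, g) \<in> frontier_types m" "\<rho> \<in> Emb m" "conforms k g \<tau>"
  shows "conforms k g (\<rho> \<circ> \<tau>)"
  using assms(3) frontier_typesD[OF assms(1)] Emb_fix[OF assms(2)] Emb_above[OF assms(2)]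
  by (auto simp: conforms_def)

lemma conforms_below:
  assumes "conforms k g \<tau>" "\<tau> \<in> Emb 0" "k \<le> i"
  obtains f where "k \<le> f" "f \<le> 2 * k" "prefix (path (g ! f)) (path (\<tau> i))"
proof -
  obtain f where f: "k \<le> f" "f \<le> 2 * k" "prefix (path f) (path i)"
    using frontier_below[OF assms(3)] .
  then have "prefix (path (\<tau> f)) (path (\<tau> i))" using Emb_prefix[OF assms(2)] by simp
  then show ?thesis using that[OF f(1,2)] assms(1) f(1,2)
    by (auto simp: conforms_def intro: prefix_order.trans)
qed

lemma conforms_comp_right:
  assumes "conforms k g \<pi>" "\<pi> \<in> Emb 0" "\<tau> \<in> Emb k"
  shows "conforms k g (\<pi> \<circ> \<tau>)"
  unfolding conforms_def
proof (intro conjI allI impI)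
  show "(\<pi> \<circ> \<tau>) i = g ! i" if "i < k" for i
    using assms(1) Emb_fix[OF assms(3) that] that by (simp add: conforms_def)
  show "prefix (path (g ! i)) (path ((\<pi> \<circ> \<tau>) i))" if "k \<le> i" "i \<le> 2 * k" for i
  proof -
    have "prefix (path i) (path (\<tau> i))" using Emb_above[OF assms(3) that(2)] by simp
    then have "prefix (path (\<pi> i)) (path (\<pi> (\<tau> i)))" using Emb_prefix[OF assms(2)] by simp
    then show ?thesis using assms(1) that by (auto simp: conforms_def intro: prefix_order.trans)
  qed
qed

text \<open>Two embeddings with the same approximation may still diverge in the cones above it, so the
  decisions reached below \<open>\<pi>\<close> say nothing about others at first. Thinning out all relevant cones
  to the range of \<open>\<pi>\<close>, and not touching the other cones, puts every conforming embedding below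
  \<open>\<pi>\<close>.\<close>
lemma conforming_into_range:
  assumes g: "(k, g) \<in> frontier_types m" and \<pi>: "conforms k g \<pi>" "\<pi> \<in> Emb 0"
  obtains \<rho> where "\<rho> \<in> Emb m"
    "\<And>\<tau>. \<tau> \<in> Emb 0 \<Longrightarrow> conforms k g \<tau> \<Longrightarrow> \<exists>\<theta>\<in>Emb k. \<rho> \<circ> \<tau> = \<pi> \<circ> \<theta>"
proof -
  \<comment> \<open>Inside the cones mentioned by \<open>g\<close> only the range of \<open>\<pi>\<close> is allowed.\<close>
  define W where "W = {w. m \<le> w \<and> (\<forall>i. k \<le> i \<longrightarrow> i \<le> 2 * k \<longrightarrow> prefix (path (g ! i)) (path w) \<longrightarrow> w \<in> range \<pi>)}"
  have big: "N \<le> \<pi> (desc j (replicate N True))" for N j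
    using desc_ge[of j "replicate N True"] Emb_ge[OF \<pi>(2), of "desc j (replicate N True)"] by simp
  obtain \<rho> where \<rho>: "\<rho> \<in> Emb m" "\<And>i. m \<le> i \<Longrightarrow> \<rho> i \<in> W"
  proof (rule exists_Emb_into[of m W "\<lambda>_. 0"])
    fix f N assume f: "m \<le> f" "f \<le> 2 * m"
    show "\<exists>w\<in>W. N \<le> w \<and> prefix (path f) (path w)"
    proof (cases "\<exists>i. k \<le> i \<and> i \<le> 2 * k \<and> g ! i = f")
      case True
      then obtain i where i: "k \<le> i" "i \<le> 2 * k" "g ! i = f" by blast
      let ?w = "\<pi> (desc i (replicate N True))"
      have "prefix (path (\<pi> i)) (path ?w)" using Emb_prefix[OF \<pi>(2)] by simp
      then have "prefix (path f) (path ?w)" using \<pi>(1) i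
        by (auto simp: conforms_def intro: prefix_order.trans)
      then show ?thesis using f big prefix_path_le[of f ?w]
        by (intro bexI[of _ ?w]) (auto simp: W_def)
    next
      case False
      let ?w = "desc f (replicate N True)"
      have "\<not> prefix (path (g ! i)) (path ?w)" if i: "k \<le> i" "i \<le> 2 * k" for i
      proof
        assume "prefix (path (g ! i)) (path ?w)"
        moreover have "prefix (path f) (path ?w)" by simp
        ultimately have "prefix (path (g ! i)) (path f) \<or> prefix (path f) (path (g ! i))"
          using prefix_same_cases by blast
        then have "g ! i = f" using f frontier_typesD(3,4)[OF g, of i] i frontier_antichain by blast
        with False i show False by blast
      qed
      then show ?thesis using f desc_ge[of f "replicate N True"]
        by (intro bexI[of _ ?w]) (auto simp: W_def)
    qed
  next
    fix w b N assume w: "w \<in> W"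
    show "\<exists>w'\<in>W. N \<le> w' \<and> prefix (path w @ [b]) (path w')"
    proof (cases "w \<in> range \<pi>")
      case True
      then obtain j where j: "w = \<pi> j" by blast
      let ?w = "\<pi> (desc (child b j) (replicate N True))"
      have p: "prefix (path w @ [b]) (path ?w)" unfolding j using Emb_prefix_child[OF \<pi>(2)] by simp
      then have "w \<le> ?w" using prefix_path_child_le[OF p] by simp
      then show ?thesis using w big p by (intro bexI[of _ ?w]) (auto simp: W_def)
    next
      case False
      let ?w = "desc (child b w) (replicate N True)"
      have p: "prefix (path w) (path ?w)" by simp
      have "\<not> prefix (path (g ! i)) (path ?w)" if i: "k \<le> i" "i \<le> 2 * k" for i
      proof
        assume "prefix (path (g ! i)) (path ?w)"
        then have "prefix (path (g ! i)) (path w) \<or> prefix (path w) (path (g ! i))"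
          using p prefix_same_cases by blast
        then have "prefix (path (g ! i)) (path w)"
          using w frontier_typesD(3,4)[OF g, of i] i frontier_antichain[of m w "g ! i"] by (auto simp: W_def)
        then show False using w False i by (auto simp: W_def)
      qed
      moreover have "w \<le> ?w" using p by (rule prefix_path_le)
      moreover have "N \<le> ?w" using desc_ge[of "child b w" "replicate N True"] by simp
      ultimately show ?thesis using w by (intro bexI[of _ ?w]) (auto simp: W_def)
    qed
  qed blast
  show ?thesis
  proof (rule that[OF \<rho>(1)])
    fix \<tau> assume \<tau>: "\<tau> \<in> Emb 0" "conforms k g \<tau>"
    have low: "\<rho> (\<tau> i) = \<pi> i" if "i < k" for i
      using \<tau>(2) \<pi>(1) that Emb_fix[OF \<rho>(1)] frontier_typesD(2)[OF g that] by (simp add: conforms_def)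
    have "\<rho> (\<tau> i) \<in> range \<pi>" for i
    proof (cases "i < k")
      case True then show ?thesis using low by simp
    next
      case False
      then obtain f where f: "k \<le> f" "f \<le> 2 * k" "prefix (path (g ! f)) (path (\<tau> i))"
        using conforms_below[OF \<tau>(2,1), of i] by auto
      then have "m \<le> \<tau> i" using frontier_typesD(3)[OF g f(1,2)] prefix_path_le[OF f(3)] by linarith
      then have "\<rho> (\<tau> i) \<in> W" by (rule \<rho>(2))
      moreover have "prefix (path (g ! f)) (path (\<rho> (\<tau> i)))"
        using Emb_above[OF \<rho>(1) frontier_typesD(4)[OF g f(2)] f(3)] .
      ultimately show ?thesis using f by (auto simp: W_def)
    qed
    then have "range (\<rho> \<circ> \<tau>) \<subseteq> range \<pi>" by auto
    then obtain \<theta> where "\<theta> \<in> Emb k" "\<rho> \<circ> \<tau> = \<pi> \<circ> \<theta>"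
      using Emb_factor[of \<pi> "\<rho> \<circ> \<tau>" k] \<pi>(2) Emb_comp0[OF \<rho>(1) \<tau>(1)] low by auto
    then show "\<exists>\<theta>\<in>Emb k. \<rho> \<circ> \<tau> = \<pi> \<circ> \<theta>" by blast
  qed
qed

text \<open>The infinite composition converges because the \<open>j\<close>-th factor fixes the numbers below
  \<open>n + j\<close>.\<close>
lemma Emb_limit:
  fixes t :: "nat \<Rightarrow> nat \<Rightarrow> nat"
  assumes t0: "t 0 = id" and step: "\<And>j. \<exists>\<rho>\<in>Emb (n + j). t (Suc j) = t j \<circ> \<rho>"
  obtains \<tau> where "\<tau> \<in> Emb n" "\<And>j. \<exists>\<theta>\<in>Emb (n + j). \<tau> = t j \<circ> \<theta>"
proof -
  have tE: "t j \<in> Emb n" for j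
  proof (induction j)
    case (Suc j)
    obtain \<rho> where "\<rho> \<in> Emb (n + j)" "t (Suc j) = t j \<circ> \<rho>" using step by blast
    then show ?case using Suc Emb_comp Emb_antimono le_add1 by metis
  next
    case 0
    show ?case unfolding t0 by (rule id_Emb)
  qed
  have factor: "\<exists>\<theta>\<in>Emb (n + j). t (j + d) = t j \<circ> \<theta>" for j d
  proof (induction d)
    case 0
    show ?case by (intro bexI[of _ id]) auto
  next
    case (Suc d)
    then obtain \<theta> where \<theta>: "\<theta> \<in> Emb (n + j)" "t (j + d) = t j \<circ> \<theta>" by blast
    obtain \<rho> where "\<rho> \<in> Emb (n + (j + d))" "t (Suc (j + d)) = t (j + d) \<circ> \<rho>" using step by blast
    then show ?case using \<theta> Emb_comp[of \<theta> "n + j" \<rho>] Emb_antimono[of "n + j" "n + (j + d)" \<rho>]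
      by (intro bexI[of _ "\<theta> \<circ> \<rho>"]) (auto simp: comp_assoc)
  qed
  have stable: "t j' i = t j i" if "i < n + j" "j \<le> j'" for i j j'
    using factor[of j "j' - j"] that Emb_fix by fastforce
  define \<tau> where "\<tau> i = t (Suc i) i" for i
  have \<tau>: "\<tau> i = t j i" if "i < n + j" for i j
    using stable[of i j "max j (Suc i)"] stable[of i "Suc i" "max j (Suc i)"] that by (simp add: \<tau>_def)
  have "strict_mono \<tau>"
    unfolding strict_mono_def
  proof (intro allI impI)
    fix x y :: nat assume "x < y"
    then show "\<tau> x < \<tau> y" using \<tau>[of x "Suc y"] \<tau>[of y "Suc y"] Emb_strict_mono[OF tE[of "Suc y"]]
      by (simp add: strict_mono_less)
  qed
  moreover have "skeleton (path \<circ> \<tau>)"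
    unfolding skeleton_def
  proof (intro allI)
    fix i b
    have "i < n + Suc (child b i)" by (simp add: child_def)
    then show "prefix ((path \<circ> \<tau>) i @ [b]) ((path \<circ> \<tau>) (child b i))"
      using \<tau>[of i "Suc (child b i)"] \<tau>[of "child b i" "Suc (child b i)"]
        Emb_prefix_child[OF tE[of "Suc (child b i)"], of i b "child b i"] by simp
  qed
  moreover have "\<tau> i = i" if "i < n" for i using \<tau>[of i 0] that by (simp add: t0)
  ultimately have E: "\<tau> \<in> Emb n" by (simp add: Emb_def)
  have "\<exists>\<theta>\<in>Emb (n + j). \<tau> = t j \<circ> \<theta>" for j
  proof -
    have "\<tau> i \<in> range (t j)" for i
    proof -
      obtain \<theta> where "t (j + Suc i) = t j \<circ> \<theta>" using factor by blast
      then have "\<tau> i = t j (\<theta> i)" using \<tau>[of i "j + Suc i"] by simp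
      then show ?thesis by simp
    qed
    then have "range \<tau> \<subseteq> range (t j)" by blast
    then obtain \<theta> where "\<theta> \<in> Emb (n + j)" "\<tau> = t j \<circ> \<theta>"
      by (rule Emb_factor[OF Emb_0[OF tE] Emb_0[OF E], of j "n + j"]) (auto simp: \<tau>)
    then show ?thesis by blast
  qed
  with that E show ?thesis by blast
qed

text \<open>At each time \<open>m\<close> only finitely many approximations exist; each of them is treated by
  \<open>conforming_into_range\<close>, and the results for all \<open>m\<close> are composed. The resulting property of
  \<open>Q\<close> depends on an approximation only, which turns it into a colouring of finite objects.\<close>
lemma fusion:
  fixes Q :: "'c \<Rightarrow> nat \<Rightarrow> (nat \<Rightarrow> nat) \<Rightarrow> bool"
  assumes mono: "\<And>c k \<sigma> \<tau>. \<sigma> \<in> Emb 0 \<Longrightarrow> \<tau> \<in> Emb k \<Longrightarrow> Q c k \<sigma> \<Longrightarrow> Q c k (\<sigma> \<circ> \<tau>)"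
    and dense: "\<And>k \<sigma>. \<sigma> \<in> Emb 0 \<Longrightarrow> \<exists>\<tau>\<in>Emb k. \<exists>c\<in>C. Q c k (\<sigma> \<circ> \<tau>)"
    and \<sigma>: "\<sigma> \<in> Emb 0"
  obtains \<tau> where "\<tau> \<in> Emb n"
    "\<And>m k g. n \<le> m \<Longrightarrow> (k, g) \<in> frontier_types m \<Longrightarrow>
       \<exists>c\<in>C. \<forall>\<tau>'\<in>Emb 0. conforms k g \<tau>' \<longrightarrow> Q c k (\<sigma> \<circ> \<tau> \<circ> \<tau>')"
proof -
  \<comment> \<open>The approximation \<open>(k, g)\<close> is homogeneous below \<open>\<sigma>\<close>.\<close>
  define H where "H k g \<sigma> \<longleftrightarrow> (\<exists>c\<in>C. \<forall>\<tau>'\<in>Emb 0. conforms k g \<tau>' \<longrightarrow> Q c k (\<sigma> \<circ> \<tau>'))" for k g \<sigma>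
  have H_comp: "H k g (\<sigma> \<circ> \<rho>)" if "H k g \<sigma>" "(k, g) \<in> frontier_types m" "\<rho> \<in> Emb m" for k g \<sigma> \<rho> m
    using that conforms_comp[OF that(2,3)] Emb_comp0[OF that(3)] unfolding H_def
    by (metis comp_assoc)
  have one: "\<exists>\<rho>\<in>Emb m. H k g (\<sigma> \<circ> \<rho>)" if g: "(k, g) \<in> frontier_types m" and \<sigma>: "\<sigma> \<in> Emb 0" for k g m \<sigma>
  proof (cases "\<exists>\<pi>\<in>Emb 0. conforms k g \<pi>")
    case False
    then show ?thesis using dense[OF \<sigma>] by (intro bexI[of _ id]) (auto simp: H_def)
  next
    case True
    then obtain \<pi>0 where \<pi>0: "\<pi>0 \<in> Emb 0" "conforms k g \<pi>0" by blast
    obtain \<tau> c where \<tau>: "\<tau> \<in> Emb k" "c \<in> C" "Q c k (\<sigma> \<circ> \<pi>0 \<circ> \<tau>)"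
      using dense[OF Emb_comp[OF \<sigma> \<pi>0(1)], of k] by blast
    let ?\<pi> = "\<pi>0 \<circ> \<tau>"
    have \<pi>: "?\<pi> \<in> Emb 0" using Emb_comp0 \<pi>0(1) \<tau>(1) by blast
    obtain \<rho> where \<rho>: "\<rho> \<in> Emb m"
      "\<And>\<tau>. \<tau> \<in> Emb 0 \<Longrightarrow> conforms k g \<tau> \<Longrightarrow> \<exists>\<theta>\<in>Emb k. \<rho> \<circ> \<tau> = ?\<pi> \<circ> \<theta>"
      using conforming_into_range[OF g conforms_comp_right[OF \<pi>0(2,1) \<tau>(1)] \<pi>] by blast
    have "Q c k (\<sigma> \<circ> \<rho> \<circ> \<tau>')" if \<tau>': "\<tau>' \<in> Emb 0" "conforms k g \<tau>'" for \<tau>'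
    proof -
      obtain \<theta> where "\<theta> \<in> Emb k" "\<rho> \<circ> \<tau>' = ?\<pi> \<circ> \<theta>" using \<rho>(2)[OF \<tau>'] by blast
      moreover have "\<sigma> \<circ> \<pi>0 \<circ> \<tau> \<in> Emb 0" using Emb_comp[OF \<sigma> \<pi>] by (simp only: comp_assoc)
      ultimately have "Q c k ((\<sigma> \<circ> \<pi>0 \<circ> \<tau>) \<circ> \<theta>)" using mono \<tau>(3) by blast
      then show ?thesis using \<open>\<rho> \<circ> \<tau>' = ?\<pi> \<circ> \<theta>\<close> by (simp add: comp_assoc)
    qed
    then show ?thesis using \<rho>(1) \<tau>(2) by (auto simp: H_def)
  qed
  have all: "\<exists>\<rho>\<in>Emb m. \<forall>(k, g)\<in>frontier_types m. H k g (\<sigma> \<circ> \<rho>)" if \<sigma>: "\<sigma> \<in> Emb 0" for m \<sigma>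
  proof -
    have "\<exists>\<rho>\<in>Emb m. \<forall>(k, g)\<in>S. H k g (\<sigma> \<circ> \<rho>)" if "finite S" "S \<subseteq> frontier_types m" for S
      using that
    proof (induction S)
      case empty
      show ?case by (intro bexI[of _ id]) auto
    next
      case (insert x S)
      obtain k g where x: "x = (k, g)" by force
      obtain \<rho> where \<rho>: "\<rho> \<in> Emb m" "\<forall>(k, g)\<in>S. H k g (\<sigma> \<circ> \<rho>)"
        using insert.IH insert.prems by blast
      obtain \<rho>' where \<rho>': "\<rho>' \<in> Emb m" "H k g (\<sigma> \<circ> \<rho> \<circ> \<rho>')"
        using one[of k g m "\<sigma> \<circ> \<rho>"] insert.prems x Emb_comp0[OF \<sigma> \<rho>(1)] by blast
      have "H k g (\<sigma> \<circ> (\<rho> \<circ> \<rho>'))" if "(k, g) \<in> insert x S" for k g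
      proof (cases "(k, g) = x")
        case True
        then show ?thesis using \<rho>'(2) x by (simp only: comp_assoc prod.inject)
      next
        case False
        then have "H k g (\<sigma> \<circ> \<rho>)" "(k, g) \<in> frontier_types m" using that \<rho>(2) insert.prems by blast+
        then show ?thesis using H_comp \<rho>'(1) by (metis comp_assoc)
      qed
      then show ?case using Emb_comp[OF \<rho>(1) \<rho>'(1)] by blast
    qed
    then show ?thesis using finite_frontier_types by blast
  qed
  then obtain r where r: "\<And>m \<sigma>. \<sigma> \<in> Emb 0 \<Longrightarrow> r m \<sigma> \<in> Emb m"
    "\<And>m \<sigma> k g. \<sigma> \<in> Emb 0 \<Longrightarrow> (k, g) \<in> frontier_types m \<Longrightarrow> H k g (\<sigma> \<circ> r m \<sigma>)"
  proof -
    have "\<forall>m \<sigma>. \<exists>\<rho>. \<sigma> \<in> Emb 0 \<longrightarrow> \<rho> \<in> Emb m \<and> (\<forall>k g. (k, g) \<in> frontier_types m \<longrightarrow> H k g (\<sigma> \<circ> \<rho>))"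
      using all by blast
    then show thesis using that by metis
  qed
  define t where "t = rec_nat id (\<lambda>j t. t \<circ> r (n + j) (\<sigma> \<circ> t))"
  have t: "t 0 = id" "t (Suc j) = t j \<circ> r (n + j) (\<sigma> \<circ> t j)" for j by (simp_all add: t_def)
  have tE: "t j \<in> Emb 0" for j
  proof (induction j)
    case 0 show ?case unfolding t by (rule id_Emb)
  next
    case (Suc j) then show ?case using t r(1) \<sigma> Emb_comp Emb_comp0 by metis
  qed
  obtain \<tau> where \<tau>: "\<tau> \<in> Emb n" "\<And>j. \<exists>\<theta>\<in>Emb (n + j). \<tau> = t j \<circ> \<theta>"
  proof (rule Emb_limit[of t n])
    show "\<exists>\<rho>\<in>Emb (n + j). t (Suc j) = t j \<circ> \<rho>" for j
      using t r(1) Emb_comp[OF \<sigma> tE] by blast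
  qed (use t in auto)
  show ?thesis
  proof (rule that[OF \<tau>(1)])
    fix m k g assume m: "n \<le> m" and g: "(k, g) \<in> frontier_types m"
    define j where "j = m - n"
    have j: "n + j = m" using m by (simp add: j_def)
    have "H k g (\<sigma> \<circ> t j \<circ> r m (\<sigma> \<circ> t j))" using r(2)[OF Emb_comp[OF \<sigma> tE] g] by simp
    then have H: "H k g (\<sigma> \<circ> t (Suc j))" by (simp add: t j comp_assoc)
    obtain \<theta> where \<theta>: "\<theta> \<in> Emb (n + Suc j)" "\<tau> = t (Suc j) \<circ> \<theta>" using \<tau>(2) by blast
    then have "\<theta> \<in> Emb m" using Emb_antimono[of m "n + Suc j"] j by simp
    then have "H k g (\<sigma> \<circ> \<tau>)" using H_comp[OF H g] \<theta>(2) by (simp add: comp_assoc)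
    then show "\<exists>c\<in>C. \<forall>\<tau>'\<in>Emb 0. conforms k g \<tau>' \<longrightarrow> Q c k (\<sigma> \<circ> \<tau> \<circ> \<tau>')" by (simp add: H_def)
  qed
qed

text \<open>Each embedding conforms to an approximation taken right after its first \<open>k\<close> values, so
  what the fusion gives for approximations holds for all embeddings.\<close>
lemma conforming_type:
  assumes "\<tau> \<in> Emb n" "n \<le> k"
  obtains m g where "n \<le> m" "(k, g) \<in> frontier_types m" "conforms k g \<tau>"
proof -
  define m where "m = (if k = 0 then 0 else Suc (\<tau> (k - 1)))"
  have mono: "strict_mono \<tau>" using assms(1) by (rule Emb_strict_mono)
  have low: "\<tau> i < m" if "i < k" for i
    using that strict_mono_less_eq[OF mono, of i "k - 1"] by (auto simp: m_def)
  have high: "m \<le> \<tau> i" if "k \<le> i" for i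
    using that strict_mono_less[OF mono, of "k - 1" i] by (auto simp: m_def)
  have "k \<le> m" using Emb_ge[OF assms(1), of "k - 1"] by (auto simp: m_def)
  have "\<exists>f. m \<le> f \<and> f \<le> 2 * m \<and> prefix (path f) (path (\<tau> i))" if "k \<le> i" for i
    using frontier_below[OF high[OF that]] by metis
  then obtain f where f: "\<And>i. k \<le> i \<Longrightarrow> m \<le> f i \<and> f i \<le> 2 * m \<and> prefix (path (f i)) (path (\<tau> i))"
    by metis
  define g where "g = map (\<lambda>i. if i < k then \<tau> i else f i) [0..<Suc (2 * k)]"
  have g: "g ! i = (if i < k then \<tau> i else f i)" if "i \<le> 2 * k" for i
    using that unfolding g_def by (subst nth_map) (auto simp del: upt_Suc)
  show ?thesis
  proof (rule that)
    show "n \<le> m" using \<open>k \<le> m\<close> assms(2) by simp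
    have "set g \<subseteq> {..2 * m}" using low f by (fastforce simp: g_def intro: less_imp_le order.trans)
    then show "(k, g) \<in> frontier_types m"
      using \<open>k \<le> m\<close> low f g by (auto simp: frontier_types_def) (auto simp: g_def)
    show "conforms k g \<tau>" using g f by (auto simp: conforms_def)
  qed
qed

section \<open>Homogeneity for one step\<close>

text \<open>Letters are functions on the indices of the coordinates, so a word is a tuple of binary
  words of equal length, one for each coordinate.\<close>
definition coord :: "nat \<Rightarrow> (nat \<Rightarrow> bool) list \<Rightarrow> bool list" where
  "coord j w = map (\<lambda>f. f j) w"

lemma coord_append [simp]: "coord j (w @ w') = coord j w @ coord j w'"
  and length_coord [simp]: "length (coord j w) = length w"
  by (simp_all add: coord_def)

lemma coord_subst: "a j = a' j \<Longrightarrow> coord j (subst a y) = coord j (subst a' y)"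
  by (auto simp: coord_def subst_def split: option.splits)

lemma coord_word_of:
  "(\<And>i. i < l \<Longrightarrow> a i j = a' i j) \<Longrightarrow> coord j (word_of Y a l) = coord j (word_of Y a' l)"
  by (induction l) (auto intro: coord_subst)

lemma length_word_of: "length (word_of Y a l) = (\<Sum>i<l. length (Y i))"
  by (induction l) auto

lemma prefix_word_of: "l \<le> l' \<Longrightarrow> prefix (word_of Y a l) (word_of Y a l')"
  by (induction l' rule: dec_induct) (auto intro: prefix_prefix)

text \<open>The approximation at stage \<open>n + 1\<close> described by a word \<open>w\<close>: the numbers below \<open>n\<close> are
  fixed, the new value is \<open>x = desc n (coord 0 w)\<close>, the terminal node \<open>n + j\<close> has been extended
  by coordinate \<open>j\<close> of \<open>w\<close>, and the two new terminal nodes are the children of \<open>x\<close>.\<close>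
definition word_type :: "nat \<Rightarrow> (nat \<Rightarrow> bool) list \<Rightarrow> nat list" where
  "word_type n w = map (\<lambda>i. if i < n then i else if i \<le> 2 * n then desc i (coord (i - n) w)
     else i - 2 * n + 2 * desc n (coord 0 w)) [0..<Suc (2 * Suc n)]"

lemma word_type_nth:
  assumes "i \<le> 2 * Suc n"
  shows "word_type n w ! i = (if i < n then i else if i \<le> 2 * n then desc i (coord (i - n) w)
     else i - 2 * n + 2 * desc n (coord 0 w))"
  unfolding word_type_def using assms by (subst nth_map) (auto simp del: upt_Suc)

text \<open>With the level order, the descendants of \<open>n + 1, \<dots>, 2 * n\<close> by words of the same length as
  the one that leads from \<open>n\<close> to \<open>x\<close> lie exactly in the frontier at time \<open>x + 1\<close>. So words of
  \<open>n + 1\<close> coordinates describe all possible next steps.\<close>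
lemma word_type_in_frontier_types: "(Suc n, word_type n w) \<in> frontier_types (Suc (desc n (coord 0 w)))"
proof -
  let ?x = "desc n (coord 0 w)" and ?h = "2 ^ length w :: nat"
  have x: "n \<le> ?x" using desc_ge[of n "coord 0 w"] by simp
  have xb: "?h * Suc n \<le> Suc ?x" "Suc ?x < ?h * Suc (Suc n)"
    using desc_bounds[where i = n and z = "coord 0 w"] by simp_all
  have nth: "(i < Suc n \<longrightarrow> word_type n w ! i < Suc ?x) \<and> (Suc n \<le> i \<longrightarrow> Suc ?x \<le> word_type n w ! i)
      \<and> word_type n w ! i \<le> 2 * Suc ?x" if i: "i \<le> 2 * Suc n" for i
  proof -
    consider "i < n" | "i = n" | "n < i" "i \<le> 2 * n" | "2 * n < i" by linarith
    then show ?thesis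
    proof cases
      case 3
      let ?y = "desc i (coord (i - n) w)"
      have y: "?h * Suc i \<le> Suc ?y" "Suc ?y < ?h * Suc (Suc i)"
        using desc_bounds[where i = i and z = "coord (i - n) w"] by simp_all
      have "?h * Suc (Suc n) \<le> ?h * Suc i" using 3 by (intro mult_le_mono) auto
      then have "Suc ?x < Suc ?y" using xb(2) y(1) by (meson less_le_trans order.trans)
      have "?h * Suc (Suc i) \<le> ?h * (2 * Suc n)" using 3 by (intro mult_le_mono) auto
      then have "?h * Suc (Suc i) \<le> 2 * (?h * Suc n)" by simp
      moreover have "2 * (?h * Suc n) \<le> 2 * Suc ?x" using xb(1) by (intro mult_le_mono order_refl)
      ultimately have "?y \<le> 2 * Suc ?x" using y(2) by (meson Suc_leD less_imp_le order.trans)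
      with \<open>Suc ?x < Suc ?y\<close> show ?thesis using 3 i by (simp add: word_type_nth)
    qed (use x i in \<open>auto simp: word_type_nth\<close>)
  qed
  have "set (word_type n w) \<subseteq> {..2 * Suc ?x}"
  proof
    fix y assume "y \<in> set (word_type n w)"
    then obtain i where "i < length (word_type n w)" "y = word_type n w ! i" by (metis in_set_conv_nth)
    moreover from this have "i \<le> 2 * Suc n" by (simp add: word_type_def)
    ultimately show "y \<in> {..2 * Suc ?x}" using nth by auto
  qed
  moreover have "length (word_type n w) = Suc (2 * Suc n)" by (simp add: word_type_def)
  ultimately show ?thesis unfolding frontier_types_def using nth x by auto
qed

text \<open>The Halpern-Laeuchli step. Each coordinate of the words given by the Carlson-Simpson
  theorem spans a perfect subtree above one terminal node, which splits wherever a variable word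
  begins, because it begins with the variable. The embedding \<open>\<rho>\<close> takes its values there.\<close>
lemma homogeneous_types:
  fixes c :: "(nat \<Rightarrow> bool) list \<Rightarrow> 'c"
  assumes "finite (range c)"
  obtains \<rho> c0 where "\<rho> \<in> Emb n"
    "\<And>\<tau>. \<tau> \<in> Emb n \<Longrightarrow> \<exists>w. c w = c0 \<and> conforms (Suc n) (word_type n w) (\<rho> \<circ> \<tau>)"
proof -
  \<comment> \<open>The alphabet with \<open>2 ^ (n + 1)\<close> letters.\<close>
  define A where "A = {f :: nat \<Rightarrow> bool. \<forall>j. f j \<longrightarrow> j \<le> n}"
  have "A \<subseteq> (\<lambda>S j. j \<in> S) ` Pow {..n}"
  proof
    fix f assume "f \<in> A"
    then show "f \<in> (\<lambda>S j. j \<in> S) ` Pow {..n}" by (intro image_eqI[of _ _ "{j. f j}"]) (auto simp: A_def)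
  qed
  then have "finite A" by (rule finite_subset) simp
  then obtain w0 Y c0 where Y: "\<And>i. \<exists>y. Y i = None # y"
    and c0: "\<And>l a. (\<And>i. i < l \<Longrightarrow> a i \<in> A) \<Longrightarrow> c (w0 @ word_of Y a l) = c0"
    using carlson_simpson[OF _ assms] by metis
  define z where "z j a l = coord j (w0 @ word_of Y a l)" for j a l
  have len: "length (z j a l) = length w0 + (\<Sum>i<l. length (Y i))" for j a l
    by (simp add: z_def length_word_of)
  have Y_pos: "0 < length (Y i)" for i using Y[of i] by auto
  have z_len_mono: "l < l' \<Longrightarrow> length (z j a l) < length (z j' a' l')" for j a l j' a' l'
    unfolding len by (intro add_strict_left_mono sum_strict_mono2[where b = l]) (use Y_pos in auto)
  have z_ge: "l \<le> length (z j a l)" for j a l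
    unfolding len using sum_mono[of "{..<l}" "\<lambda>_. 1" "\<lambda>i. length (Y i)"] Y_pos
    by (fastforce simp: Suc_le_eq)
  have z_prefix: "l \<le> l' \<Longrightarrow> prefix (z j a l) (z j a l')" for j a l l'
    unfolding z_def coord_def by (intro map_mono_prefix) (simp add: prefix_word_of)
  have z_cong: "(\<And>i. i < l \<Longrightarrow> a i j = a' i j) \<Longrightarrow> z j a l = z j a' l" for j a a' l
    unfolding z_def coord_append by (simp add: coord_word_of[of l a j a'])
  \<comment> \<open>The nodes of the perfect subtrees at the lengths of the homogeneous words.\<close>
  define W where "W = {desc (n + j) (z j a l) | j a l. j \<le> n \<and> (\<forall>i. a i \<in> A)}"
  obtain \<rho> where \<rho>: "\<rho> \<in> Emb n" "\<And>i. n \<le> i \<Longrightarrow> \<rho> i \<in> W"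
  proof (rule exists_Emb_into[of n W "\<lambda>_. 0"])
    fix f N assume f: "n \<le> f" "f \<le> 2 * n"
    let ?w = "desc f (z (f - n) (\<lambda>_ _. False) N)"
    have "?w \<in> W" unfolding W_def using f
      by (intro CollectI exI[of _ "f - n"] exI[of _ "\<lambda>_ _. False"] exI[of _ N]) (auto simp: A_def)
    moreover have "N \<le> ?w" using desc_ge[of f "z (f - n) (\<lambda>_ _. False) N"] z_ge by (meson add_leD2 order.trans)
    ultimately show "\<exists>w\<in>W. N \<le> w \<and> prefix (path f) (path w)" by (intro bexI[of _ ?w]) auto
  next
    fix w b N assume "w \<in> W"
    then obtain j a l where w: "w = desc (n + j) (z j a l)" "j \<le> n" "\<And>i. a i \<in> A"
      by (auto simp: W_def)
    \<comment> \<open>The next letter is chosen so that coordinate \<open>j\<close> moves in direction \<open>b\<close>.\<close>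
    define a' where "a' i = (if i < l then a i else (\<lambda>j'. j' = j \<and> b))" for i
    have a': "a' i \<in> A" for i using w by (auto simp: a'_def A_def)
    let ?l = "max (Suc l) N"
    let ?w = "desc (n + j) (z j a' ?l)"
    obtain y where y: "Y l = None # y" using Y by blast
    have "z j a' l = z j a l" by (rule z_cong) (simp add: a'_def)
    then have "prefix (z j a l @ [b]) (z j a' (Suc l))"
      by (simp add: z_def y coord_def a'_def)
    also have "prefix \<dots> (z j a' ?l)" by (rule z_prefix) simp
    finally have "prefix (path w @ [b]) (path ?w)" by (simp add: w(1))
    moreover have "N \<le> ?w" using desc_ge[of "n + j" "z j a' ?l"] z_ge[of ?l j a'] by simp
    moreover have "?w \<in> W" using w(2) a' by (auto simp: W_def)
    ultimately show "\<exists>w'\<in>W. N \<le> w' \<and> prefix (path w @ [b]) (path w')" by blast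
  qed blast
  show ?thesis
  proof (rule that[OF \<rho>(1)])
    fix \<tau> assume \<tau>: "\<tau> \<in> Emb n"
    let ?\<pi> = "\<rho> \<circ> \<tau>"
    have \<pi>: "?\<pi> \<in> Emb n" using \<rho>(1) \<tau> by (rule Emb_comp)
    have "\<exists>a l. ?\<pi> (n + j) = desc (n + j) (z j a l) \<and> (\<forall>i. a i \<in> A)" if j: "j \<le> n" for j
    proof -
      have "n \<le> \<tau> (n + j)" using Emb_ge[OF \<tau>, of "n + j"] by simp
      then have "?\<pi> (n + j) \<in> W" using \<rho>(2) by simp
      then obtain j' a l where j': "?\<pi> (n + j) = desc (n + j') (z j' a l)" "j' \<le> n" "\<forall>i. a i \<in> A"
        by (auto simp: W_def)
      have "prefix (path (n + j)) (path (?\<pi> (n + j)))" using j by (intro Emb_above[OF \<pi>]) auto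
      moreover have "prefix (path (n + j')) (path (?\<pi> (n + j)))" using j'(1) by simp
      ultimately have "prefix (path (n + j)) (path (n + j')) \<or> prefix (path (n + j')) (path (n + j))"
        using prefix_same_cases by blast
      then have "j' = j" using frontier_antichain[of n "n + j" "n + j'"] frontier_antichain[of n "n + j'" "n + j"] j j'(2) by auto
      then show ?thesis using j' by blast
    qed
    then obtain a l where al: "\<And>j. j \<le> n \<Longrightarrow> ?\<pi> (n + j) = desc (n + j) (z j (a j) (l j))"
      "\<And>j i. j \<le> n \<Longrightarrow> a j i \<in> A" by metis
    \<comment> \<open>The values lie on subtrees of different coordinates, each with its own letters; one
      sequence of letters combines them.\<close>
    define b where "b i = (\<lambda>j. j \<le> n \<and> a j i j)" for i
    define w where "w = w0 @ word_of Y b (l 0)"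
    have w: "coord j w = z j (a j) (l 0)" if "j \<le> n" for j
      using z_cong[of "l 0" b j "a j"] that by (simp add: b_def w_def z_def)
    \<comment> \<open>The value at \<open>n\<close> is the smallest, so in level order the other words are at least as long.\<close>
    have l: "l 0 \<le> l j" if j: "j \<le> n" for j
    proof (rule ccontr)
      assume "\<not> l 0 \<le> l j"
      then have less: "length (z j (a j) (l j)) < length (z 0 (a 0) (l 0))" by (intro z_len_mono) simp
      let ?h = "2 ^ length (z 0 (a 0) (l 0)) :: nat"
      have "Suc (?\<pi> (n + j)) < 2 ^ length (z j (a j) (l j)) * Suc (Suc (n + j))"
        unfolding al(1)[OF j] by (rule desc_bounds)
      also have "\<dots> \<le> 2 ^ length (z j (a j) (l j)) * (2 * Suc n)" using j by (intro mult_le_mono) auto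
      also have "\<dots> = 2 ^ Suc (length (z j (a j) (l j))) * Suc n" by simp
      also have "\<dots> \<le> ?h * Suc n" using less by (intro mult_le_mono power_increasing) auto
      also have "\<dots> \<le> Suc (?\<pi> (n + 0))" unfolding al(1)[OF le0] using desc_bounds(1)[of "z 0 (a 0) (l 0)" n] by simp
      finally have "?\<pi> (n + j) < ?\<pi> (n + 0)" by simp
      then show False using strict_mono_less[OF Emb_strict_mono[OF \<pi>]] by simp
    qed
    have "conforms (Suc n) (word_type n w) ?\<pi>"
      unfolding conforms_def
    proof (intro conjI allI impI)
      show "?\<pi> i = word_type n w ! i" if "i < Suc n" for i
        using that Emb_fix[OF \<pi>, of i] al(1)[of 0] w[of 0]
        by (cases "i = n") (auto simp: word_type_nth)
    next
      fix i assume i: "Suc n \<le> i" "i \<le> 2 * Suc n"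
      show "prefix (path (word_type n w ! i)) (path (?\<pi> i))"
      proof (cases "i \<le> 2 * n")
        case True
        define j where "j = i - n"
        have j: "j \<le> n" "i = n + j" using True i by (auto simp: j_def)
        have "word_type n w ! i = desc i (z j (a j) (l 0))"
          using i True w[OF j(1)] by (simp add: word_type_nth j_def)
        moreover have "prefix (z j (a j) (l 0)) (z j (a j) (l j))" by (rule z_prefix[OF l[OF j(1)]])
        ultimately show ?thesis using al(1)[OF j(1)] j(2) by simp
      next
        case False
        then have "i = child (i \<noteq> 2 * n + 1) n" using i by (auto simp: child_def)
        then obtain b where b: "i = child b n" by blast
        have x: "?\<pi> n = desc n (coord 0 w)" using al(1)[of 0] w[of 0] by simp
        have "word_type n w ! i = child b (desc n (coord 0 w))"
          using False i by (auto simp: word_type_nth b child_def)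
        moreover have "prefix (path (?\<pi> n) @ [b]) (path (?\<pi> i))"
          unfolding b by (subst Emb_prefix_child[OF \<pi>]) simp
        ultimately show ?thesis using x by simp
      qed
    qed
    moreover have "c w = c0" unfolding w_def
    proof (rule c0)
      show "b i \<in> A" for i by (auto simp: b_def A_def)
    qed
    ultimately show "\<exists>w. c w = c0 \<and> conforms (Suc n) (word_type n w) ?\<pi>" by blast
  qed
qed

text \<open>Fusion makes the outcome of the next step depend only on its finite description, and
  \<open>homogeneous_types\<close> thins out until the outcome is constant.\<close>
theorem one_step_homogeneity:
  fixes Q :: "'c \<Rightarrow> nat \<Rightarrow> (nat \<Rightarrow> nat) \<Rightarrow> bool"
  assumes mono: "\<And>c k \<sigma> \<tau>. \<sigma> \<in> Emb 0 \<Longrightarrow> \<tau> \<in> Emb k \<Longrightarrow> Q c k \<sigma> \<Longrightarrow> Q c k (\<sigma> \<circ> \<tau>)"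
    and dense: "\<And>k \<sigma>. \<sigma> \<in> Emb 0 \<Longrightarrow> \<exists>\<tau>\<in>Emb k. \<exists>c\<in>C. Q c k (\<sigma> \<circ> \<tau>)"
    and \<sigma>: "\<sigma> \<in> Emb 0" and C: "finite C"
  obtains \<tau> c where "\<tau> \<in> Emb n" "c \<in> C" "\<And>\<tau>'. \<tau>' \<in> Emb n \<Longrightarrow> Q c (Suc n) (\<sigma> \<circ> \<tau> \<circ> \<tau>')"
proof -
  obtain \<tau> where \<tau>: "\<tau> \<in> Emb n"
    "\<And>m k g. n \<le> m \<Longrightarrow> (k, g) \<in> frontier_types m \<Longrightarrow>
       \<exists>c\<in>C. \<forall>\<tau>'\<in>Emb 0. conforms k g \<tau>' \<longrightarrow> Q c k (\<sigma> \<circ> \<tau> \<circ> \<tau>')"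
    by (rule fusion[where C = C and Q = Q and \<sigma> = \<sigma> and n = n, OF mono dense \<sigma>]) blast+
  have "\<exists>c\<in>C. \<forall>\<tau>'\<in>Emb 0. conforms (Suc n) (word_type n w) \<tau>' \<longrightarrow> Q c (Suc n) (\<sigma> \<circ> \<tau> \<circ> \<tau>')" for w
    using \<tau>(2)[OF _ word_type_in_frontier_types] desc_ge[of n "coord 0 w"] by simp
  then have "\<forall>w. \<exists>c. c \<in> C \<and> (\<forall>\<tau>'\<in>Emb 0. conforms (Suc n) (word_type n w) \<tau>' \<longrightarrow> Q c (Suc n) (\<sigma> \<circ> \<tau> \<circ> \<tau>'))"
    by blast
  from choice[OF this] obtain c where c: "\<And>w. c w \<in> C"
    "\<And>w \<tau>'. \<tau>' \<in> Emb 0 \<Longrightarrow> conforms (Suc n) (word_type n w) \<tau>' \<Longrightarrow> Q (c w) (Suc n) (\<sigma> \<circ> \<tau> \<circ> \<tau>')"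
    by blast
  have "finite (range c)" using c(1) C by (intro finite_subset[of "range c" C]) auto
  then obtain \<rho> c0 where \<rho>: "\<rho> \<in> Emb n"
    "\<And>\<tau>'. \<tau>' \<in> Emb n \<Longrightarrow> \<exists>w. c w = c0 \<and> conforms (Suc n) (word_type n w) (\<rho> \<circ> \<tau>')"
    using homogeneous_types[of c n] by blast
  show ?thesis
  proof (rule that)
    show "\<tau> \<circ> \<rho> \<in> Emb n" using \<tau>(1) \<rho>(1) by (rule Emb_comp)
    show "c0 \<in> C" using \<rho>(2)[OF id_Emb] c(1) by blast
    fix \<tau>' assume \<tau>': "\<tau>' \<in> Emb n"
    obtain w where "c w = c0" "conforms (Suc n) (word_type n w) (\<rho> \<circ> \<tau>')" using \<rho>(2)[OF \<tau>'] by blast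
    then have "Q c0 (Suc n) (\<sigma> \<circ> \<tau> \<circ> (\<rho> \<circ> \<tau>'))" using c(2) Emb_comp0[OF \<rho>(1) \<tau>'] by blast
    then show "Q c0 (Suc n) (\<sigma> \<circ> (\<tau> \<circ> \<rho>) \<circ> \<tau>')" by (simp only: comp_assoc)
  qed
qed

section \<open>Pure decision for embeddings\<close>

text \<open>\<open>A k \<sigma>\<close> and \<open>B k \<sigma>\<close> abstract from a condition with \<open>k\<close> fixed splitting nodes forcing a
  formula or its negation. The second pair of assumptions says that a condition forces what all
  its one-step extensions force.\<close>
theorem abstract_pure_decision:
  fixes A B :: "nat \<Rightarrow> (nat \<Rightarrow> nat) \<Rightarrow> bool"
  assumes mono: "\<And>k \<sigma> \<tau>. \<sigma> \<in> Emb 0 \<Longrightarrow> \<tau> \<in> Emb k \<Longrightarrow> A k \<sigma> \<Longrightarrow> A k (\<sigma> \<circ> \<tau>)"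
      "\<And>k \<sigma> \<tau>. \<sigma> \<in> Emb 0 \<Longrightarrow> \<tau> \<in> Emb k \<Longrightarrow> B k \<sigma> \<Longrightarrow> B k (\<sigma> \<circ> \<tau>)"
    and step: "\<And>k \<sigma>. \<sigma> \<in> Emb 0 \<Longrightarrow> (\<And>\<tau>. \<tau> \<in> Emb k \<Longrightarrow> A (Suc k) (\<sigma> \<circ> \<tau>)) \<Longrightarrow> A k \<sigma>"
      "\<And>k \<sigma>. \<sigma> \<in> Emb 0 \<Longrightarrow> (\<And>\<tau>. \<tau> \<in> Emb k \<Longrightarrow> B (Suc k) (\<sigma> \<circ> \<tau>)) \<Longrightarrow> B k \<sigma>"
    and dense: "\<And>k \<sigma>. \<sigma> \<in> Emb 0 \<Longrightarrow> \<exists>\<tau>\<in>Emb k. \<exists>m\<ge>k. A m (\<sigma> \<circ> \<tau>) \<or> B m (\<sigma> \<circ> \<tau>)"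
    and \<sigma>: "\<sigma> \<in> Emb 0"
  obtains \<tau> where "\<tau> \<in> Emb n" "A n (\<sigma> \<circ> \<tau>) \<or> B n (\<sigma> \<circ> \<tau>)"
proof -
  \<comment> \<open>No pure extension decides.\<close>
  define U where "U k \<sigma> \<longleftrightarrow> (\<forall>\<tau>\<in>Emb k. \<not> A k (\<sigma> \<circ> \<tau>) \<and> \<not> B k (\<sigma> \<circ> \<tau>))" for k \<sigma>
  have U_mono: "U k (\<sigma> \<circ> \<tau>)" if "U k \<sigma>" "\<tau> \<in> Emb k" for k \<sigma> \<tau>
    using that Emb_comp unfolding U_def by (metis comp_assoc)
  have U_not: "\<not> A k \<sigma>" "\<not> B k \<sigma>" if "U k \<sigma>" for k \<sigma>
    using that[unfolded U_def, rule_format, OF id_Emb] by auto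
  define Q where "Q c = [A, B, U] ! c" for c :: nat
  have Q: "Q 0 = A" "Q (Suc 0) = B" "Q 2 = U" by (simp_all add: Q_def)
  \<comment> \<open>A homogeneous colour \<open>A\<close> or \<open>B\<close> would decide at stage \<open>k\<close> already.\<close>
  have U_step: "\<exists>\<tau>\<in>Emb k. \<forall>\<tau>'\<in>Emb k. U (Suc k) (\<sigma> \<circ> \<tau> \<circ> \<tau>')" if \<sigma>: "\<sigma> \<in> Emb 0" and U: "U k \<sigma>" for k \<sigma>
  proof -
    have Q_dense: "\<exists>\<tau>\<in>Emb k. \<exists>c\<in>{0, Suc 0, 2}. Q c k (\<sigma> \<circ> \<tau>)" for k \<sigma>
    proof (cases "U k \<sigma>")
      case True
      then have "U k (\<sigma> \<circ> id)" by simp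
      then show ?thesis using Q id_Emb by blast
    next
      case False
      then show ?thesis using Q unfolding U_def by blast
    qed
    have Q_mono: "Q c k (\<sigma> \<circ> \<tau>)" if "\<sigma> \<in> Emb 0" "\<tau> \<in> Emb k" "Q c k \<sigma>" "c \<in> {0, Suc 0, 2}" for c k \<sigma> \<tau>
      using that Q mono U_mono by auto
    obtain \<tau> c where \<tau>: "\<tau> \<in> Emb k" "c \<in> {0, Suc 0, 2}"
      "\<And>\<tau>'. \<tau>' \<in> Emb k \<Longrightarrow> c \<in> {0, Suc 0, 2} \<and> Q c (Suc k) (\<sigma> \<circ> \<tau> \<circ> \<tau>')"
    proof (rule one_step_homogeneity[where Q = "\<lambda>c k \<sigma>. c \<in> {0, Suc 0, 2} \<and> Q c k \<sigma>"
          and C = "{0, Suc 0, 2}" and \<sigma> = \<sigma> and n = k])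
      show "\<exists>\<tau>\<in>Emb k. \<exists>c\<in>{0, Suc 0, 2}. c \<in> {0, Suc 0, 2} \<and> Q c k (\<sigma> \<circ> \<tau>)" for k \<sigma>
        using Q_dense[of k \<sigma>] by blast
    qed (use Q_mono \<sigma> in blast)+
    have \<sigma>\<tau>: "\<sigma> \<circ> \<tau> \<in> Emb 0" using Emb_comp0 \<sigma> \<tau>(1) by blast
    have "U k (\<sigma> \<circ> \<tau>)" using U \<tau>(1) by (rule U_mono)
    then have "c \<noteq> 0" "c \<noteq> Suc 0"
      using \<tau>(3) step(1)[OF \<sigma>\<tau>, of k] step(2)[OF \<sigma>\<tau>, of k] U_not Q by metis+
    then have "c = 2" using \<tau>(2) by blast
    then show ?thesis using \<tau>(1,3) Q by auto
  qed
  show ?thesis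
  proof (rule ccontr)
    assume "\<not> thesis"
    then have U0: "U n \<sigma>" using that unfolding U_def by blast
    \<comment> \<open>The property to be fused: decided, or undecided after every next step.\<close>
    define R where "R k \<sigma> \<longleftrightarrow> A k \<sigma> \<or> B k \<sigma> \<or> (\<forall>\<tau>\<in>Emb k. U (Suc k) (\<sigma> \<circ> \<tau>))" for k \<sigma>
    have R_mono: "R k (\<sigma> \<circ> \<tau>)" if "\<sigma> \<in> Emb 0" "\<tau> \<in> Emb k" "R k \<sigma>" for k \<sigma> \<tau>
      using that mono Emb_comp[OF that(2)] unfolding R_def by (metis comp_assoc)
    have R_dense: "\<exists>\<tau>\<in>Emb k. R k (\<sigma> \<circ> \<tau>)" if "\<sigma> \<in> Emb 0" for k \<sigma>
    proof (cases "U k \<sigma>")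
      case True
      then show ?thesis using U_step[OF that] unfolding R_def by blast
    next
      case False
      then show ?thesis unfolding U_def R_def by blast
    qed
    obtain \<tau> where \<tau>: "\<tau> \<in> Emb n"
      "\<And>m k g. n \<le> m \<Longrightarrow> (k, g) \<in> frontier_types m \<Longrightarrow>
         \<exists>c\<in>UNIV :: unit set. \<forall>\<tau>'\<in>Emb 0. conforms k g \<tau>' \<longrightarrow> R k (\<sigma> \<circ> \<tau> \<circ> \<tau>')"
    proof (rule fusion[where Q = "\<lambda>c :: unit. R" and C = UNIV and \<sigma> = \<sigma> and n = n])
      show "\<exists>\<tau>\<in>Emb k. \<exists>c\<in>UNIV :: unit set. R k (\<sigma> \<circ> \<tau>)" if "\<sigma> \<in> Emb 0" for k \<sigma>
        using R_dense[OF that] by blast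
    qed (use R_mono \<sigma> in blast)+
    have R: "R k (\<sigma> \<circ> \<tau> \<circ> \<tau>')" if "n \<le> k" "\<tau>' \<in> Emb n" for k \<tau>'
      using conforming_type[OF that(2,1)] \<tau>(2) Emb_0[OF that(2)] by metis
    have "\<forall>\<tau>'\<in>Emb n. U k (\<sigma> \<circ> \<tau> \<circ> \<tau>')" if "n \<le> k" for k
      using that
    proof (induction k rule: dec_induct)
      case base
      show ?case using U_mono[OF U0] Emb_comp[OF \<tau>(1)] by (metis comp_assoc)
    next
      case (step k)
      show ?case
      proof
        fix \<tau>' assume \<tau>': "\<tau>' \<in> Emb n"
        have "\<forall>\<tau>''\<in>Emb k. U (Suc k) (\<sigma> \<circ> \<tau> \<circ> \<tau>' \<circ> \<tau>'')"
          using R[OF step.hyps(1) \<tau>'] step.IH \<tau>' U_not unfolding R_def by blast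
        then have "U (Suc k) (\<sigma> \<circ> \<tau> \<circ> \<tau>' \<circ> id)" using id_Emb by blast
        then show "U (Suc k) (\<sigma> \<circ> \<tau> \<circ> \<tau>')" by (simp only: comp_id)
      qed
    qed
    moreover obtain \<tau>' m where "\<tau>' \<in> Emb n" "n \<le> m" "A m (\<sigma> \<circ> \<tau> \<circ> \<tau>') \<or> B m (\<sigma> \<circ> \<tau> \<circ> \<tau>')"
      using dense[OF Emb_comp0[OF \<sigma> \<tau>(1)], of n] by blast
    ultimately show False using U_not by blast
  qed
qed

section \<open>The forcing relation\<close>

lemma dense_below_antimono:
  assumes "transp le" "le q p" "dense_below P le p D"
  shows "dense_below P le q D"
  using assms unfolding dense_below_def by (blast dest: transpD)

lemma dense_below_dense:
  assumes trans: "transp le" and refl: "reflp_on P le"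
    and D: "dense_below P le p (\<lambda>q. dense_below P le q D)"
  shows "dense_below P le p D"
  unfolding dense_below_def
proof (intro ballI impI)
  fix r assume "r \<in> P" "le r p"
  then obtain q where q: "q \<in> P" "le q r" "dense_below P le q D" using D unfolding dense_below_def by blast
  then obtain s where "s \<in> P" "le s q" "D s" using reflp_onD[OF refl] unfolding dense_below_def by blast
  then show "\<exists>q\<in>P. le q r \<and> D q" using q trans by (blast dest: transpD)
qed

lemma dense_below_weaken:
  "dense_below P le p D \<Longrightarrow> (\<And>q. D q \<Longrightarrow> E q) \<Longrightarrow> dense_below P le p E"
  unfolding dense_below_def by blast

lemma forces_antimono:
  assumes trans: "transp le"
  shows "le q p \<Longrightarrow> forces P le nm p \<phi> e \<Longrightarrow> forces P le nm q \<phi> e"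
proof (induction \<phi> arbitrary: e)
  case (Eq i j)
  then show ?case
    using dense_below_antimono[OF trans Eq(1)]
    by (subst forces.simps, subst forces_eq.simps) (auto elim!: forces_eq.cases)
next
  case (Mem i j)
  then show ?case using dense_below_antimono[OF trans Mem(1)] by (simp add: forces_mem_def)
next
  case (Neg \<phi>) then show ?case using trans by (auto dest: transpD)
next
  case (Conj \<phi> \<psi>) then show ?case by auto
next
  case (Ex i \<phi>) then show ?case using dense_below_antimono[OF trans Ex(2)] by simp
qed

text \<open>Each clause of the recursion is itself a statement of density, except the one for
  negations, where an extension forcing the formula would have a further extension forcing both,
  and the one for conjunctions, which is immediate.\<close>
lemma forces_if_dense:
  assumes trans: "transp le" and refl: "reflp_on P le"
  shows "dense_below P le p (\<lambda>q. forces P le nm q \<phi> e) \<Longrightarrow> forces P le nm p \<phi> e"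
proof (induction \<phi> arbitrary: e)
  case (Eq i j)
  then have E: "dense_below P le p (\<lambda>q. forces_eq P le nm q (e i) (e j))" by simp
  show ?case unfolding forces.simps
  proof (rule forces_eq.intros)
    show "\<forall>(c, s)\<in>nm (e i). dense_below P le p
       (\<lambda>q. le q s \<longrightarrow> (\<exists>(d, r)\<in>nm (e j). le q r \<and> forces_eq P le nm q c d))"
    proof clarify
      fix c s assume c: "(c, s) \<in> nm (e i)"
      show "dense_below P le p (\<lambda>q. le q s \<longrightarrow> (\<exists>(d, r)\<in>nm (e j). le q r \<and> forces_eq P le nm q c d))"
        by (rule dense_below_dense[OF trans refl dense_below_weaken[OF E]])
           (use c in \<open>auto elim!: forces_eq.cases\<close>)
    qed
    show "\<forall>(d, r)\<in>nm (e j). dense_below P le p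
       (\<lambda>q. le q r \<longrightarrow> (\<exists>(c, s)\<in>nm (e i). le q s \<and> forces_eq P le nm q c d))"
    proof clarify
      fix d r assume d: "(d, r) \<in> nm (e j)"
      show "dense_below P le p (\<lambda>q. le q r \<longrightarrow> (\<exists>(c, s)\<in>nm (e i). le q s \<and> forces_eq P le nm q c d))"
        by (rule dense_below_dense[OF trans refl dense_below_weaken[OF E]])
           (use d in \<open>auto elim!: forces_eq.cases\<close>)
    qed
  qed
next
  case (Mem i j)
  then show ?case unfolding forces.simps forces_mem_def by (rule dense_below_dense[OF trans refl])
next
  case (Neg \<phi>)
  show ?case unfolding forces.simps
  proof (intro ballI impI notI)
    fix q assume q: "q \<in> P" "le q p" "forces P le nm q \<phi> e"
    then obtain r where r: "r \<in> P" "le r q" "forces P le nm r (Neg \<phi>) e"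
      using Neg.prems unfolding dense_below_def by blast
    then show False using forces_antimono[OF trans r(2) q(3)] reflp_onD[OF refl] by auto
  qed
next
  case (Conj \<phi> \<psi>)
  then show ?case by (auto intro: dense_below_weaken)
next
  case (Ex i \<phi>)
  show ?case using Ex.prems unfolding forces.simps by (rule dense_below_dense[OF trans refl])
qed

lemma exists_deciding_below:
  assumes "p \<in> P" and refl: "reflp_on P le"
  obtains q where "q \<in> P" "le q p" "forces P le nm q \<phi> e \<or> forces P le nm q (Neg \<phi>) e"
  using assms(1) reflp_onD[OF refl] that by (cases "forces P le nm p (Neg \<phi>) e") auto

lemma end_ext_trans:
  assumes "p \<sqsubseteq>\<^sub>e q" "q \<sqsubseteq>\<^sub>e r" shows "p \<sqsubseteq>\<^sub>e r"
proof -
  have "\<exists>s\<in>terminals p. prefix s t" if t: "t \<in> r - p" for t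
  proof (cases "t \<in> q")
    case True
    then show ?thesis using t assms(1) by (auto simp: end_ext_def)
  next
    case False
    then obtain s where s: "s \<in> terminals q" "prefix s t"
      using t assms(2) unfolding end_ext_def by blast
    then have "s \<in> q" by (simp add: terminals_def)
    show ?thesis
    proof (cases "s \<in> p")
      case True
      then have "s \<in> terminals p" using s(1) assms(1) by (auto simp: terminals_def end_ext_def)
      then show ?thesis using s(2) by blast
    next
      case False
      then obtain s' where "s' \<in> terminals p" "prefix s' s"
        using \<open>s \<in> q\<close> assms(1) unfolding end_ext_def by blast
      then show ?thesis using s(2) by (meson prefix_order.trans)
    qed
  qed
  then show ?thesis using assms by (auto simp: end_ext_def)
qed

lemma reflp_on_AS_le: "reflp_on AS AS_le"
  by (auto intro!: reflp_onI simp: AS_def AS_le_def end_ext_strict_def end_ext_def)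

lemma transp_AS_le: "transp AS_le"
  unfolding AS_le_def by (rule transpI) (use end_ext_trans in blast)

lemmas AS_forces_antimono = forces_antimono[OF transp_AS_le]
lemmas AS_forces_if_dense = forces_if_dense[OF transp_AS_le reflp_on_AS_le]

lemma AS_iff: "(p, T) \<in> AS \<longleftrightarrow> good T \<and> T \<noteq> {} \<and> p \<sqsubseteq>\<^sub>e T"
proof
  assume "(p, T) \<in> AS"
  then show "good T \<and> T \<noteq> {} \<and> p \<sqsubseteq>\<^sub>e T" by (auto simp: AS_def end_ext_strict_def end_ext_def)
next
  assume a: "good T \<and> T \<noteq> {} \<and> p \<sqsubseteq>\<^sub>e T"
  then have "infinite T" by (intro perfect_infinite) (auto simp: good_def)
  then show "(p, T) \<in> AS" using a by (auto simp: AS_def end_ext_strict_def end_ext_def)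
qed

text \<open>A condition forces whatever each pure extension forces after some enlargement \<open>r\<close> of its
  first component. An arbitrary extension \<open>(q, S)\<close> is compatible with \<open>(r, S)\<close>, since finite
  initial parts of the same tree can be united.\<close>
lemma AS_forces_if_pure_extensions:
  assumes "\<And>S. S \<subseteq> T \<Longrightarrow> (p, S) \<in> AS \<Longrightarrow> \<exists>r. (r, S) \<in> AS \<and> forces AS AS_le nm (r, S) \<phi> e"
  shows "forces AS AS_le nm (p, T) \<phi> e"
proof (rule AS_forces_if_dense)
  show "dense_below AS AS_le (p, T) (\<lambda>c. forces AS AS_le nm c \<phi> e)"
    unfolding dense_below_def
  proof (intro ballI impI)
    fix c assume c: "c \<in> AS" "AS_le c (p, T)"
    obtain q S where qS: "c = (q, S)" by force
    have q: "good S" "S \<noteq> {}" "q \<sqsubseteq>\<^sub>e S" "S \<subseteq> T" "p \<sqsubseteq>\<^sub>e q"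
      using c unfolding qS AS_iff by (auto simp: AS_le_def)
    then have "(p, S) \<in> AS" using end_ext_trans by (auto simp: AS_iff)
    then obtain r where r: "(r, S) \<in> AS" "forces AS AS_le nm (r, S) \<phi> e" using assms q(4) by blast
    have rS: "r \<sqsubseteq>\<^sub>e S" using r(1) by (simp add: AS_iff)
    have U: "(q \<union> r) \<sqsubseteq>\<^sub>e S" using q(3) rS by (rule end_ext_Un)
    have "q \<union> r \<subseteq> S" using U by (simp add: end_ext_def)
    then have "q \<sqsubseteq>\<^sub>e q \<union> r" "r \<sqsubseteq>\<^sub>e q \<union> r" using q(3) rS by (auto intro: end_ext_subset)
    then have "AS_le (q \<union> r, S) c" "AS_le (q \<union> r, S) (r, S)" by (simp_all add: AS_le_def qS)
    moreover have "(q \<union> r, S) \<in> AS" using U q by (simp add: AS_iff)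
    ultimately show "\<exists>c'\<in>AS. AS_le c' c \<and> forces AS AS_le nm c' \<phi> e"
      using r(2) AS_forces_antimono by blast
  qed
qed

section \<open>Good trees and their skeletons\<close>

definition tree_of :: "(nat \<Rightarrow> node) \<Rightarrow> node set" where
  "tree_of s = {t. \<exists>i. prefix t (s i)}"

lemma tree_tree_of: "tree (tree_of s)"
  by (auto simp: tree_def tree_of_def intro: prefix_order.trans)

lemma in_tree_of [simp]: "s i \<in> tree_of s"
  by (auto simp: tree_of_def)

lemma tree_of_nonempty [simp]: "tree_of s \<noteq> {}"
  using in_tree_of by blast

lemma tree_of_comp: "tree_of (s \<circ> \<tau>) \<subseteq> tree_of s"
  by (auto simp: tree_of_def)

text \<open>No other node splits: two nodes of a skeleton separate at a node of the skeleton.\<close>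
lemma splits_tree_of:
  assumes s: "skeleton s" shows "splits (tree_of s) = range s"
proof
  show "range s \<subseteq> splits (tree_of s)"
    using s by (auto simp: splits_def tree_of_def skeleton_def)
  show "splits (tree_of s) \<subseteq> range s"
  proof
    fix t assume "t \<in> splits (tree_of s)"
    then obtain i j where t: "prefix (t @ [False]) (s i)" "prefix (t @ [True]) (s j)"
      by (auto simp: splits_def tree_of_def)
    \<comment> \<open>Above \<open>t\<close> the nodes \<open>s i\<close> and \<open>s j\<close> lie on different sides.\<close>
    have no: False if "prefix (s i) (s j) \<or> prefix (s j) (s i)"
      using that t not_prefix_both[of t False] by (auto dest: prefix_order.trans)
    have below: "prefix t (s i)" "prefix t (s j)" using t by (auto dest: append_prefixD)
    show "t \<in> range s"
    proof (cases i j rule: heap_cases)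
      case (parallel p b)
      then have p: "prefix (s p @ [b]) (s i)" "prefix (s p @ [\<not> b]) (s j)"
        using skeleton_prefix_child_iff[OF s] by blast+
      then have "prefix (s p) (s i)" by (blast dest: append_prefixD)
      then consider "t = s p" | "strict_prefix t (s p)" | "strict_prefix (s p) t"
        using below(1) prefix_same_cases by (metis prefix_order.le_less)
      then show ?thesis
      proof cases
        case 2
        then obtain x where x: "prefix (t @ [x]) (s p)" by (rule strict_prefix_childE)
        then have "prefix (t @ [x]) (s i)" "prefix (t @ [x]) (s j)"
          using p by (meson append_prefixD prefix_order.trans)+
        then show ?thesis using t not_prefix_both[of t False] by (cases x) auto
      next
        case 3
        then obtain x where x: "prefix (s p @ [x]) t" by (rule strict_prefix_childE)
        then have "prefix (s p @ [x]) (s i)" "prefix (s p @ [x]) (s j)"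
          using below by (meson prefix_order.trans)+
        then show ?thesis using p not_prefix_both[of "s p" b] by (cases "x = b") auto
      qed blast
    next
      case eq then show ?thesis using no by simp
    next
      case (above b)
      then have "prefix (s i @ [b]) (s j)" using skeleton_prefix_child_iff[OF s] by blast
      then show ?thesis using no by (blast dest: append_prefixD)
    next
      case (below b)
      then have "prefix (s j @ [b]) (s i)" using skeleton_prefix_child_iff[OF s] by blast
      then show ?thesis using no by (blast dest: append_prefixD)
    qed
  qed
qed

lemma perfect_tree_of: "skeleton s \<Longrightarrow> perfect (tree_of s)"
  by (auto simp: perfect_def tree_tree_of splits_tree_of) (auto simp: tree_of_def)

lemma card_strict_prefixes: "card {z. strict_prefix z x} = length x"
proof -
  have "{z. strict_prefix z x} = (\<lambda>k. take k x) ` {..<length x}"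
  proof (intro set_eqI iffI)
    fix z assume "z \<in> {z. strict_prefix z x}"
    then have "z = take (length z) x" "length z < length x"
      by (auto simp: strict_prefix_def prefix_def prefix_length_less)
    then show "z \<in> (\<lambda>k. take k x) ` {..<length x}" by blast
  next
    fix z assume "z \<in> (\<lambda>k. take k x) ` {..<length x}"
    then obtain k where "z = take k x" "k < length x" by blast
    moreover from this have "z \<noteq> x" by auto
    ultimately show "z \<in> {z. strict_prefix z x}" by (auto simp: strict_prefix_def take_is_prefix)
  qed
  moreover have "inj_on (\<lambda>k. take k x) {..<length x}"
    by (rule inj_onI) (metis length_take lessThan_iff min.absorb4)
  ultimately show ?thesis by (simp add: card_image)
qed

lemma split_level_tree_of:
  assumes s: "skeleton s" shows "split_level (tree_of s) (s i) = length (path i)"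
proof -
  have "{u \<in> splits (tree_of s). strict_prefix u (s i)} = s ` {j. strict_prefix (path j) (path i)}"
    using skeleton_strict_prefix_iff[OF s] by (auto simp: splits_tree_of[OF s])
  moreover have "inj_on s A" for A using skeleton_inj[OF s] by (auto intro: inj_onI)
  moreover have "path ` {j. strict_prefix (path j) (path i)} = {z. strict_prefix z (path i)}"
    using path_surj by (auto simp: image_iff) metis
  moreover have "inj_on path A" for A by (auto intro: inj_onI)
  ultimately show ?thesis unfolding split_level_def by (metis card_image card_strict_prefixes)
qed

text \<open>The level order of the indices is the order \<open>\<preceq>\<close> of the splitting nodes. This makes the
  depth of \<open>s i\<close> equal to \<open>i\<close> and goodness equivalent to monotonicity of the lengths.\<close>
lemma split_le_tree_of:
  assumes s: "skeleton s" shows "split_le (tree_of s) (s i) (s j) \<longleftrightarrow> i \<le> j"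
proof -
  have lex: "lexordp_eq (u @ False # x) (u @ True # y)" "\<not> lexordp_eq (u @ True # y) (u @ False # x)"
    for u x y :: "bool list"
    by (induction u) simp_all
  have less: "lexordp_eq (s i) (s j) \<and> \<not> lexordp_eq (s j) (s i)"
    if ij: "i < j" "length (path i) = length (path j)" for i j
  proof -
    obtain p where "prefix (path p @ [False]) (path i)" "prefix (path p @ [True]) (path j)"
      using same_level_split[OF ij] .
    then have "prefix (s p @ [False]) (s i)" "prefix (s p @ [True]) (s j)"
      using skeleton_prefix_child_iff[OF s] by blast+
    then show ?thesis using lex by (auto simp: prefix_def)
  qed
  consider "i < j" | "i = j" | "j < i" by linarith
  then show ?thesis
  proof cases
    case 1
    then show ?thesis using length_path_mono[of i j] less[of i j]
      by (auto simp: split_le_def split_level_tree_of[OF s])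
  next
    case 2
    then show ?thesis by (simp add: split_le_def lexordp_eq_refl)
  next
    case 3
    then show ?thesis using length_path_mono[of j i] less[of j i]
      by (auto simp: split_le_def split_level_tree_of[OF s])
  qed
qed

lemma depth_tree_of:
  assumes s: "skeleton s" shows "depth (s i) (tree_of s) = i"
proof -
  have "{u \<in> splits (tree_of s). split_le (tree_of s) u (s i) \<and> u \<noteq> s i} = s ` {..<i}"
    using skeleton_inj[OF s, of _ i]
    by (auto simp: splits_tree_of[OF s] split_le_tree_of[OF s] le_less)
  moreover have "inj_on s A" for A using skeleton_inj[OF s] by (auto intro: inj_onI)
  ultimately show ?thesis by (simp add: depth_def card_image)
qed

lemma good_tree_of_iff:
  assumes s: "skeleton s"
  shows "good (tree_of s) \<longleftrightarrow> (\<forall>i j. i \<le> j \<longrightarrow> length (s i) \<le> length (s j))"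
  by (simp add: good_def perfect_tree_of[OF s] splits_tree_of[OF s] split_le_tree_of[OF s])

lemma restr_tree_of:
  assumes s: "skeleton s"
  shows "restr (tree_of s) n = {t. \<exists>k\<le>n. \<exists>b. prefix t (s k @ [b])}"
proof -
  have "t \<in> tree_of s" if "prefix t (s k @ [b])" for t k b
    using that s by (auto simp: tree_of_def skeleton_def intro: prefix_order.trans)
  then show ?thesis
    by (auto simp: restr_def splits_tree_of[OF s] depth_tree_of[OF s])
qed

lemma first_split_above:
  assumes T: "perfect T" and t: "t \<in> T"
  shows "\<exists>u\<in>splits T. prefix t u \<and> (\<forall>v\<in>splits T. prefix t v \<longrightarrow> prefix u v)"
proof -
  have tr: "\<And>x y. prefix x y \<Longrightarrow> y \<in> T \<Longrightarrow> x \<in> T" using T by (auto simp: perfect_def tree_def)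
  have "\<exists>u. u \<in> splits T \<and> prefix t u" using T t by (auto simp: perfect_def)
  then obtain u where u: "u \<in> splits T" "prefix t u"
    and min: "\<And>v. v \<in> splits T \<Longrightarrow> prefix t v \<Longrightarrow> length u \<le> length v"
    using ex_has_least_nat[of "\<lambda>u. u \<in> splits T \<and> prefix t u" _ length] by blast
  have "prefix u v" if v: "v \<in> splits T" "prefix t v" for v
  proof (rule ccontr)
    assume "\<not> prefix u v"
    moreover have "\<not> strict_prefix v u" using min[OF v] by (auto dest: prefix_length_less)
    ultimately have "u \<parallel> v" by (auto simp: prefix_order.le_less)
    then obtain w b x b' y where w: "b \<noteq> b'" "u = w @ b # x" "v = w @ b' # y"
      using parallel_decomp[OF \<open>u \<parallel> v\<close>] by auto
    have pu: "prefix (w @ [b]) u" and pv: "prefix (w @ [b']) v" using w by auto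
    then have "w @ [b] \<in> T" "w @ [b'] \<in> T" using u v tr by (auto simp: splits_def)
    then have "w \<in> splits T" using w(1) tr[of w "w @ [b]"] by (cases b; cases b') (auto simp: splits_def)
    moreover have "prefix t w"
    proof (rule ccontr)
      assume "\<not> prefix t w"
      moreover have "prefix w u" using w by simp
      ultimately have "strict_prefix w t" using u(2) prefix_same_cases by (metis prefix_order.le_less)
      then obtain c where c: "prefix (w @ [c]) t" by (rule strict_prefix_childE)
      then have "prefix (w @ [c]) u" "prefix (w @ [c]) v" using u(2) v(2) by (meson prefix_order.trans)+
      then show False using w by auto
    qed
    ultimately have "length u \<le> length w" by (rule min)
    then show False using w by simp
  qed
  with u show ?thesis by blast
qed

text \<open>The skeleton takes at \<open>child b i\<close> the first splitting node above \<open>s i @ [b]\<close>. It exhausts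
  the splitting nodes, because the longest \<open>s i\<close> below a splitting node \<open>u\<close> equals \<open>u\<close>.\<close>
lemma exists_skeleton:
  assumes T: "good T" "T \<noteq> {}"
  obtains s where "skeleton s" "T = tree_of s"
proof -
  have perf: "perfect T" and tr: "\<And>x y. prefix x y \<Longrightarrow> y \<in> T \<Longrightarrow> x \<in> T"
    using T(1) by (auto simp: good_def perfect_def tree_def)
  obtain nxt where nxt: "\<And>t. t \<in> T \<Longrightarrow> nxt t \<in> splits T \<and> prefix t (nxt t) \<and>
      (\<forall>v\<in>splits T. prefix t v \<longrightarrow> prefix (nxt t) v)"
    using first_split_above[OF perf] by metis
  define s where "s i = foldl (\<lambda>t b. nxt (t @ [b])) (nxt []) (path i)" for i
  have s: "s 0 = nxt []" "s (child b i) = nxt (s i @ [b])" for b i by (simp_all add: s_def)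
  have root: "[] \<in> T" using T(2) tr by fastforce
  have mem: "s i \<in> splits T" for i
  proof (induction i rule: heap_induct)
    case (child b i)
    then have "s i @ [b] \<in> T" by (cases b) (auto simp: splits_def)
    then show ?case using nxt by (simp add: s)
  qed (use root nxt s in simp)
  then have memT: "s i @ [b] \<in> T" for i b by (cases b) (use mem[of i] in \<open>auto simp: splits_def\<close>)
  have sk: "skeleton s" using nxt[OF memT] by (simp add: skeleton_def s)
  have all: "u \<in> range s" if u: "u \<in> splits T" for u
  proof -
    have "\<exists>i. prefix (s i) u" using nxt[OF root] u by (auto simp: s(1)[symmetric])
    moreover have "\<forall>i. prefix (s i) u \<longrightarrow> length (s i) < Suc (length u)" by (auto dest: prefix_length_le)
    ultimately obtain i where i: "prefix (s i) u" "\<And>j. prefix (s j) u \<Longrightarrow> length (s j) \<le> length (s i)"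
      using ex_has_greatest_nat[of "\<lambda>i. prefix (s i) u" _ "\<lambda>i. length (s i)" "Suc (length u)"] 
      by (metis less_imp_le)
    have "s i = u"
    proof (rule ccontr)
      assume "s i \<noteq> u"
      then obtain b where "prefix (s i @ [b]) u" using i(1) by (metis prefix_order.le_less strict_prefix_childE)
      then have "prefix (s (child b i)) u" using nxt[OF memT] u by (simp add: s)
      then have "length (s (child b i)) \<le> length (s i)" by (rule i(2))
      moreover have "prefix (s i @ [b]) (s (child b i))" using sk by (simp add: skeleton_def)
      ultimately show False by (auto dest: prefix_length_le)
    qed
    then show ?thesis by blast
  qed
  have "T = tree_of s"
  proof
    show "T \<subseteq> tree_of s"
    proof
      fix t assume "t \<in> T"
      then obtain u where "u \<in> splits T" "prefix t u" using perf by (auto simp: perfect_def)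
      then show "t \<in> tree_of s" using all by (auto simp: tree_of_def)
    qed
    show "tree_of s \<subseteq> T" using mem tr by (auto simp: tree_of_def splits_def)
  qed
  with sk that show ?thesis by blast
qed

lemma splits_mono: "S \<subseteq> T \<Longrightarrow> splits S \<subseteq> splits T"
  by (auto simp: splits_def)

text \<open>If only one successor of \<open>u\<close> were in \<open>p\<close>, the other one would extend a terminal node of
  \<open>p\<close> that lies strictly below a node of \<open>p\<close>.\<close>
lemma splits_end_ext:
  assumes "p \<sqsubseteq>\<^sub>e S" "u \<in> splits S" "v \<in> p" "strict_prefix u v"
  shows "u \<in> splits p"
proof -
  have tr: "\<And>x y. prefix x y \<Longrightarrow> y \<in> p \<Longrightarrow> x \<in> p" using assms(1) by (auto simp: end_ext_def tree_def)
  obtain b where b: "prefix (u @ [b]) v" using assms(4) by (rule strict_prefix_childE)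
  then have ub: "u @ [b] \<in> p" using tr assms(3) by blast
  have "u @ [\<not> b] \<in> p"
  proof (rule ccontr)
    assume n: "u @ [\<not> b] \<notin> p"
    moreover have "u @ [\<not> b] \<in> S" using assms(2) by (cases b) (auto simp: splits_def)
    ultimately obtain t where t: "t \<in> terminals p" "prefix t (u @ [\<not> b])"
      using assms(1) unfolding end_ext_def by blast
    then have "t \<noteq> u @ [\<not> b]" using n by (auto simp: terminals_def)
    then have "prefix t u" using t(2) by simp
    then have "u @ [b] = t" using t(1) ub by (auto simp: terminals_def)
    then show False using \<open>prefix t u\<close> by (auto dest: prefix_length_le)
  qed
  moreover have "u \<in> p" using tr[OF _ ub, of u] by simp
  ultimately show ?thesis using ub by (cases b) (auto simp: splits_def)
qed

text \<open>The index of a splitting node can be read off from the splitting nodes below it and from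
  the directions it takes there.\<close>
lemma same_splits_below_imp_same_index:
  assumes s: "skeleton s" and s': "skeleton s'" and "s i = s' j"
    and "{u \<in> range s. strict_prefix u (s i)} = {u \<in> range s'. strict_prefix u (s i)}"
  shows "i = j"
  using assms(3,4)
proof (induction i arbitrary: j rule: heap_induct)
  case root
  show ?case
  proof (rule ccontr)
    assume "0 \<noteq> j"
    then have "path j \<noteq> []" by (metis path_0 path_eq_iff)
    then have "strict_prefix (s' 0) (s' j)"
      using skeleton_strict_prefix_iff[OF s', of 0 j] by (cases "path j") simp_all
    then have "s' 0 \<in> {u \<in> range s. strict_prefix u (s 0)}" using root by auto
    then show False using skeleton_strict_prefix_iff[OF s, of _ 0] by auto
  qed
next
  case (child b i)
  have si: "prefix (s i @ [b]) (s (child b i))" using s by (simp add: skeleton_def)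
  then have si': "strict_prefix (s i) (s (child b i))" by (rule strict_prefix_if_child)
  then have "s i \<in> {u \<in> range s'. strict_prefix u (s (child b i))}" using child.prems(2) by blast
  then obtain k where k: "s i = s' k" "strict_prefix (s' k) (s' j)" using child.prems(1) by auto
  then have "0 < j" using skeleton_strict_prefix_iff[OF s', of k 0] by (cases "j = 0") auto
  then obtain b' j' where j: "j = child b' j'" using nonzero_child by blast
  have sj: "prefix (s' j' @ [b']) (s' j)" using s' by (simp add: skeleton_def j)
  then have "strict_prefix (s' j') (s (child b i))" using strict_prefix_if_child child.prems(1) by metis
  then have "s' j' \<in> {u \<in> range s. strict_prefix u (s (child b i))}" using child.prems(2) by blast
  then obtain l where l: "s' j' = s l" "strict_prefix (s l) (s (child b i))" by auto
  have "prefix (s' k) (s' j')"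
    using k(2) skeleton_strict_prefix_iff[OF s', of k j] skeleton_prefix_iff[OF s', of k j'] 
    by (auto simp: j strict_prefix_def prefix_snoc)
  moreover have "prefix (s l) (s i)"
    using l(2) skeleton_strict_prefix_iff[OF s, of l "child b i"] skeleton_prefix_iff[OF s, of l i] 
    by (auto simp: strict_prefix_def prefix_snoc)
  ultimately have eq: "s i = s' j'" using k(1) l(1) by (metis prefix_order.antisym)
  have "{u \<in> range s. strict_prefix u (s i)} = {u \<in> range s'. strict_prefix u (s i)}"
    using child.prems(2) prefix_order.less_trans[OF _ si'] by blast
  then have "i = j'" using child.IH eq by blast
  moreover have "b = b'"
    using si sj child.prems(1) eq not_prefix_both[of "s i" b] by (cases "b = b'") auto
  ultimately show ?case using j by simp
qed

text \<open>All splitting nodes below a splitting node of \<open>p\<close> belong to \<open>p\<close>, so its index does not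
  depend on the tree that end-extends \<open>p\<close>.\<close>
lemma same_index_if_split_of_common_part:
  assumes s: "skeleton s" and s': "skeleton s'" and p: "p \<sqsubseteq>\<^sub>e tree_of s" "p \<sqsubseteq>\<^sub>e tree_of s'"
    and i: "s i \<in> splits p"
  shows "s' i = s i"
proof -
  have sub: "splits p \<subseteq> range s" "splits p \<subseteq> range s'"
    using p splits_mono splits_tree_of[OF s] splits_tree_of[OF s'] by (auto simp: end_ext_def) blast+
  then obtain j where j: "s i = s' j" using i by blast
  have "s i \<in> p" using i by (simp add: splits_def)
  then have "{u \<in> range s. strict_prefix u (s i)} = {u \<in> range s'. strict_prefix u (s i)}"
    using splits_end_ext[OF p(1)] splits_end_ext[OF p(2)] sub
    by (auto simp: splits_tree_of[OF s] splits_tree_of[OF s'])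
  then have "i = j" using same_splits_below_imp_same_index[OF s s' j] by blast
  then show ?thesis using j by simp
qed

text \<open>The empty word is inserted so that the part for \<open>n = 0\<close> is the tree with only the root:
  the empty tree is not end-extended by a nonempty one.\<close>
definition initial_part :: "nat \<Rightarrow> (nat \<Rightarrow> node) \<Rightarrow> node set" where
  "initial_part n s = insert [] {t. \<exists>i<n. \<exists>b. prefix t (s i @ [b])}"

lemma initial_part_mono: "m \<le> n \<Longrightarrow> initial_part m s \<subseteq> initial_part n s"
  unfolding initial_part_def by (intro insert_mono Collect_mono) (meson less_le_trans)

lemma initial_part_cong: "(\<And>i. i < n \<Longrightarrow> s i = s' i) \<Longrightarrow> initial_part n s = initial_part n s'"
  by (auto simp: initial_part_def)

lemma splits_initial_part: "i < n \<Longrightarrow> s i \<in> splits (initial_part n s)"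
  by (auto simp: splits_def initial_part_def)

lemma initial_part_end_ext:
  assumes s: "skeleton s" shows "initial_part n s \<sqsubseteq>\<^sub>e tree_of s"
proof -
  let ?q = "initial_part n s"
  have "?q = insert [] (\<Union>i<n. \<Union>b. {t. prefix t (s i @ [b])})"
    by (auto simp: initial_part_def)
  moreover have "finite {t. prefix t u}" for u :: node
    by (metis finite_set set_prefixes_eq)
  ultimately have "finite ?q" by simp
  moreover have "tree ?q" by (auto simp: tree_def initial_part_def intro: prefix_order.trans)
  moreover have "?q \<subseteq> tree_of s"
    using s by (auto simp: initial_part_def tree_of_def skeleton_def intro: prefix_order.trans)
  moreover have "\<exists>u\<in>terminals ?q. prefix u t" if t: "t \<in> tree_of s - ?q" for t
  proof (cases "n = 0")
    case True
    then show ?thesis by (intro bexI[of _ "[]"]) (auto simp: initial_part_def terminals_def)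
  next
    case False
    obtain j where j: "prefix t (s j)" using t by (auto simp: tree_of_def)
    have "n \<le> j"
    proof (rule ccontr)
      assume "\<not> n \<le> j"
      then have "t \<in> ?q" using j by (auto simp: initial_part_def intro: prefix_prefix)
      then show False using t by simp
    qed
    then obtain f where f: "n \<le> f" "f \<le> 2 * n" "prefix (path f) (path j)" using frontier_below by blast
    obtain b p where fp: "f = child b p" using f(1) False nonzero_child[of f] by auto
    have p: "p < n" using f(2) by (auto simp: fp child_def split: if_splits)
    let ?u = "s p @ [b]"
    have uj: "prefix ?u (s j)" using f(3) skeleton_prefix_child_iff[OF s] by (simp add: fp)
    have "?u \<in> terminals ?q"
      unfolding terminals_def
    proof (intro CollectI conjI ballI impI)
      show "?u \<in> ?q" using p by (auto simp: initial_part_def)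
      fix v assume v: "v \<in> ?q" "prefix ?u v"
      then have "v \<noteq> []" by auto
      then obtain i b' where i: "i < n" "prefix v (s i @ [b'])" using v by (auto simp: initial_part_def)
      have "\<not> prefix ?u (s i)"
        using skeleton_prefix_child_iff[OF s, of p b i] prefix_path_le[of f i] f(1) i(1) by (auto simp: fp)
      then show "v = ?u" using i(2) v(2) by (metis prefix_order.antisym prefix_order.trans prefix_snoc)
    qed
    moreover have "\<not> prefix t ?u" using t p by (auto simp: initial_part_def)
    then have "prefix ?u t" using uj j prefix_same_cases by blast
    ultimately show ?thesis by blast
  qed
  ultimately show ?thesis by (auto simp: end_ext_def)
qed

lemma finite_subset_initial_part:
  assumes s: "skeleton s" and "finite q" "q \<subseteq> tree_of s"
  obtains m where "n \<le> m" "q \<subseteq> initial_part m s"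
proof -
  have "\<exists>m\<ge>n. q \<subseteq> initial_part m s" using assms(2,3)
  proof (induction q)
    case (insert t q)
    then obtain m where m: "n \<le> m" "q \<subseteq> initial_part m s" by auto
    obtain i where "prefix t (s i)" using insert.prems by (auto simp: tree_of_def)
    then have "t \<in> initial_part (max m (Suc i)) s"
      by (auto simp: initial_part_def intro!: disjI2 exI[of _ i] prefix_prefix)
    then show ?case using m initial_part_mono[of m "max m (Suc i)" s]
      by (intro exI[of _ "max m (Suc i)"]) auto
  qed auto
  with that show ?thesis by blast
qed

text \<open>Good subtrees are given by increasing embeddings. Strict growth of the lengths is needed
  here: with equal lengths a good subtree could list its nodes in a different order.\<close>
lemma subtree_factor:
  assumes s: "skeleton s" and s': "skeleton s'" "good (tree_of s')"
    and sub: "tree_of s' \<subseteq> tree_of s" and eq: "\<And>i. i < n \<Longrightarrow> s' i = s i"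
    and strict: "\<And>i j. n \<le> i \<Longrightarrow> i < j \<Longrightarrow> length (s i) < length (s j)"
  obtains \<tau> where "\<tau> \<in> Emb n" "s' = s \<circ> \<tau>"
proof -
  have "range s' \<subseteq> range s" using splits_mono[OF sub] by (simp add: splits_tree_of s s'(1))
  then have "\<forall>i. \<exists>j. s' i = s j" by blast
  then obtain \<tau> where \<tau>: "\<And>i. s' i = s (\<tau> i)" by metis
  have inj: "\<tau> i = \<tau> j \<Longrightarrow> i = j" for i j using skeleton_inj[OF s'(1)] \<tau> by metis
  have low: "\<tau> i = i" if "i < n" for i using skeleton_inj[OF s] \<tau> eq[OF that] by metis
  have high: "n \<le> \<tau> i" if "n \<le> i" for i using inj[of i "\<tau> i"] low[of "\<tau> i"] that by fastforce
  have "\<tau> i < \<tau> j" if ij: "i < j" for i j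
  proof (cases "n \<le> i")
    case True
    have "length (s (\<tau> i)) \<le> length (s (\<tau> j))"
      using s' ij \<tau> good_tree_of_iff by (metis less_imp_le)
    then have "\<not> \<tau> j < \<tau> i" using strict[of "\<tau> j" "\<tau> i"] high[of j] True ij by auto
    then show ?thesis using inj[of i j] ij by fastforce
  next
    case False
    then show ?thesis using low[of i] low[of j] high[of j] ij by (cases "n \<le> j") auto
  qed
  then have "strict_mono \<tau>" by (rule strict_monoI)
  moreover have "s' = s \<circ> \<tau>" using \<tau> by auto
  moreover have "skeleton (path \<circ> \<tau>)" using skeleton_factor[OF s] s'(1) calculation(2) by blast
  ultimately show ?thesis using low by (intro that[of \<tau>]) (auto simp: Emb_def)
qed

text \<open>Terminal nodes of \<open>p\<close> may lie above the immediate successors of its splitting nodes, but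
  not above the next splitting node of the tree, so thinning above the first \<open>M\<close> splitting nodes
  keeps them.\<close>
lemma end_ext_thinned:
  assumes s: "skeleton s" and \<tau>: "\<tau> \<in> Emb M" and p: "p \<sqsubseteq>\<^sub>e tree_of s" "splits p \<subseteq> s ` {..<M}"
  shows "p \<sqsubseteq>\<^sub>e tree_of (s \<circ> \<tau>)"
proof (rule end_ext_subset[OF p(1) _ tree_of_comp])
  show "p \<subseteq> tree_of (s \<circ> \<tau>)"
  proof
    fix t assume t: "t \<in> p"
    then obtain j where "prefix t (s j)" using p(1) by (auto simp: end_ext_def tree_of_def)
    then have tj: "prefix t (s (desc j (replicate M True)))"
      using skeleton_desc[OF s] prefix_order.trans by blast
    have "M \<le> desc j (replicate M True)" using desc_ge[of j "replicate M True"] by simp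
    then obtain f where f: "M \<le> f" "f \<le> 2 * M" "prefix (path f) (path (desc j (replicate M True)))"
      using frontier_below by blast
    have "\<not> strict_prefix (s f) t"
    proof
      assume "strict_prefix (s f) t"
      then have "s f \<in> splits p" using splits_end_ext[OF p(1) _ t] splits_tree_of[OF s] by blast
      then obtain i where "i < M" "s f = s i" using p(2) by auto
      then show False using skeleton_inj[OF s, of f i] f(1) by simp
    qed
    moreover have "prefix (s f) (s (desc j (replicate M True)))" using f(3) skeleton_prefix_iff[OF s] by blast
    ultimately have "prefix t (s f)" using tj prefix_same_cases by (metis prefix_order.le_less)
    also have "prefix (s f) (s (\<tau> f))" using Emb_above[OF \<tau> f(2), of f] skeleton_prefix_iff[OF s] by blast
    finally show "t \<in> tree_of (s \<circ> \<tau>)" by (auto simp: tree_of_def)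
  qed
qed

section \<open>The maximal forced part\<close>

lemma AS_tree_of:
  assumes "skeleton s" "\<And>i j. i \<le> j \<Longrightarrow> length (s i) \<le> length (s j)" "p \<sqsubseteq>\<^sub>e tree_of s"
  shows "(p, tree_of s) \<in> AS"
  using assms by (simp add: AS_iff good_tree_of_iff)

lemma AS_skeletonE:
  assumes "(p, T) \<in> AS"
  obtains s where "skeleton s" "T = tree_of s" "\<And>i j. i \<le> j \<Longrightarrow> length (s i) \<le> length (s j)" "p \<sqsubseteq>\<^sub>e T"
proof -
  have T: "good T" "T \<noteq> {}" "p \<sqsubseteq>\<^sub>e T" using assms by (simp_all add: AS_iff)
  obtain s where "skeleton s" "T = tree_of s" using exists_skeleton[OF T(1,2)] .
  then show ?thesis using that T good_tree_of_iff by blast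
qed

lemma bounded_split_indices:
  assumes s: "skeleton s" and p: "p \<sqsubseteq>\<^sub>e tree_of s"
  obtains M where "splits p \<subseteq> s ` {..<M}" "\<And>i. M = Suc i \<Longrightarrow> s i \<in> splits p"
proof -
  let ?I = "{i. s i \<in> splits p}"
  have range: "splits p \<subseteq> range s" using p splits_mono splits_tree_of[OF s] by (auto simp: end_ext_def) blast
  have "inj s" using skeleton_inj[OF s] by (auto intro: injI)
  moreover have "finite (splits p)" using p by (auto simp: end_ext_def splits_def)
  ultimately have fin: "finite ?I" using finite_vimageI[of "splits p" s] by (simp add: vimage_def)
  show ?thesis
  proof (cases "?I = {}")
    case True
    then show ?thesis using range by (intro that[of 0]) auto
  next
    case False
    show ?thesis
    proof (rule that[of "Suc (Max ?I)"])
      show "splits p \<subseteq> s ` {..<Suc (Max ?I)}"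
      proof
        fix u assume "u \<in> splits p"
        then obtain i where i: "u = s i" "i \<in> ?I" using range by auto
        then have "i < Suc (Max ?I)" using fin by (simp add: less_Suc_eq_le)
        then show "u \<in> s ` {..<Suc (Max ?I)}" using i by blast
      qed
      show "s i \<in> splits p" if "Suc (Max ?I) = Suc i" for i using Max_in[OF fin False] that by simp
    qed
  qed
qed

lemma end_ext_of_finite_tree: "(p, T) \<in> AS \<Longrightarrow> p \<sqsubseteq>\<^sub>e p"
  by (auto simp: AS_iff end_ext_def)

text \<open>Two such embeddings, for opposite directions, give subtrees with finite intersection,
  which will bound the forced parts.\<close>
lemma exists_Emb_one_sided:
  obtains \<tau> where "\<tau> \<in> Emb M" "\<And>i. M \<le> i \<Longrightarrow> \<exists>f. M \<le> f \<and> f \<le> 2 * M \<and> prefix (path f @ [b]) (path (\<tau> i))"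
proof -
  let ?W = "{w. \<exists>f. M \<le> f \<and> f \<le> 2 * M \<and> prefix (path f @ [b]) (path w)}"
  obtain \<tau> where "\<tau> \<in> Emb M" "\<And>i. M \<le> i \<Longrightarrow> \<tau> i \<in> ?W"
  proof (rule exists_Emb_into[of M ?W "\<lambda>_. 0"])
    fix f N assume f: "M \<le> f" "f \<le> 2 * M"
    let ?w = "desc (child b f) (replicate N True)"
    have "prefix (path f @ [b]) (path ?w)" "N \<le> ?w" using desc_ge[of "child b f" "replicate N True"] by simp_all
    moreover from this(1) have "prefix (path f) (path ?w)" by (rule append_prefixD)
    ultimately show "\<exists>w\<in>?W. N \<le> w \<and> prefix (path f) (path w)" using f by blast
  next
    fix w c N assume "w \<in> ?W"
    then obtain f where f: "M \<le> f" "f \<le> 2 * M" "prefix (path f @ [b]) (path w)" by blast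
    let ?w = "desc (child c w) (replicate N True)"
    have w: "prefix (path w @ [c]) (path ?w)" "N \<le> ?w"
      using desc_ge[of "child c w" "replicate N True"] by simp_all
    then have "prefix (path f @ [b]) (path ?w)" using f(3) append_prefixD prefix_order.trans by blast
    then show "\<exists>w'\<in>?W. N \<le> w' \<and> prefix (path w @ [c]) (path w')" using f w by blast
  qed blast
  then show ?thesis using that by blast
qed

lemma finite_Int_of_opposite_thinnings:
  assumes s: "skeleton s"
    and \<tau>: "\<And>i. i < M \<Longrightarrow> \<tau> i = i" "\<And>i. M \<le> i \<Longrightarrow> \<exists>f. M \<le> f \<and> f \<le> 2 * M \<and> prefix (path f @ [False]) (path (\<tau> i))"
    and \<tau>': "\<And>i. i < M \<Longrightarrow> \<tau>' i = i" "\<And>i. M \<le> i \<Longrightarrow> \<exists>f. M \<le> f \<and> f \<le> 2 * M \<and> prefix (path f @ [True]) (path (\<tau>' i))"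
  shows "finite (tree_of (s \<circ> \<tau>) \<inter> tree_of (s \<circ> \<tau>'))"
proof (rule finite_subset)
  let ?B = "\<Union>i\<le>2 * M. {t. prefix t (s i)}"
  have "finite {t. prefix t u}" for u :: node by (metis finite_set set_prefixes_eq)
  then show "finite ?B" by simp
  show "tree_of (s \<circ> \<tau>) \<inter> tree_of (s \<circ> \<tau>') \<subseteq> ?B"
  proof
    fix t assume "t \<in> tree_of (s \<circ> \<tau>) \<inter> tree_of (s \<circ> \<tau>')"
    then obtain i j where ij: "prefix t (s (\<tau> i))" "prefix t (s (\<tau>' j))" by (auto simp: tree_of_def)
    show "t \<in> ?B"
    proof (cases "i < M \<or> j < M")
      case True
      then show ?thesis using ij \<tau>(1)[of i] \<tau>'(1)[of j] by fastforce
    next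
      case False
      then obtain f f' where f: "M \<le> f" "f \<le> 2 * M" "prefix (s f @ [False]) (s (\<tau> i))"
        and f': "M \<le> f'" "f' \<le> 2 * M" "prefix (s f' @ [True]) (s (\<tau>' j))"
        using \<tau>(2)[of i] \<tau>'(2)[of j] skeleton_prefix_child_iff[OF s] by (metis not_less)
      show ?thesis
      proof (rule ccontr)
        assume "t \<notin> ?B"
        then have n: "\<not> prefix t (s f)" "\<not> prefix t (s f')" using f f' by auto
        have t: "prefix (s f @ [False]) t" "prefix (s f' @ [True]) t"
          using prefix_same_cases[OF ij(1) f(3)] prefix_same_cases[OF ij(2) f'(3)] n by (auto simp: prefix_snoc)
        then have "prefix (s f) t" "prefix (s f') t" by (blast dest: append_prefixD)+
        then have "prefix (path f) (path f') \<or> prefix (path f') (path f)"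
          using prefix_same_cases skeleton_prefix_iff[OF s] by blast
        then have "f = f'" using f f' frontier_antichain[of M f f'] frontier_antichain[of M f' f] by auto
        then show False using t not_prefix_both[of "s f" False t] by simp
      qed
    qed
  qed
qed

text \<open>A maximal forced part exists because forced parts are contained in a fixed finite set, the
  intersection of two thinnings in opposite directions.\<close>
lemma max_forced_part_in:
  assumes AS: "(p0, T) \<in> AS"
  shows "max_forced_part p0 T \<in> forced_parts p0 T"
proof -
  obtain s where s: "skeleton s" and T: "T = tree_of s"
    and len: "\<And>i j. i \<le> j \<Longrightarrow> length (s i) \<le> length (s j)" and p0: "p0 \<sqsubseteq>\<^sub>e T"
    using AS_skeletonE[OF AS] by blast
  obtain M where M: "splits p0 \<subseteq> s ` {..<M}" using bounded_split_indices[OF s p0[unfolded T]] .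
  have thin: "(p0, tree_of (s \<circ> \<tau>)) \<in> AS" if \<tau>: "\<tau> \<in> Emb M" for \<tau>
    using len strict_mono_less_eq[OF Emb_strict_mono[OF \<tau>]]
    by (intro AS_tree_of skeleton_comp[OF s \<tau>] end_ext_thinned[OF s \<tau> p0[unfolded T] M]) simp
  obtain \<tau> where \<tau>: "\<tau> \<in> Emb M" "\<And>i. M \<le> i \<Longrightarrow> \<exists>f. M \<le> f \<and> f \<le> 2 * M \<and> prefix (path f @ [False]) (path (\<tau> i))"
    using exists_Emb_one_sided[of M False] by blast
  obtain \<tau>' where \<tau>': "\<tau>' \<in> Emb M" "\<And>i. M \<le> i \<Longrightarrow> \<exists>f. M \<le> f \<and> f \<le> 2 * M \<and> prefix (path f @ [True]) (path (\<tau>' i))"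
    using exists_Emb_one_sided[of M True] by blast
  let ?B = "tree_of (s \<circ> \<tau>) \<inter> tree_of (s \<circ> \<tau>')"
  have B: "finite ?B"
    using finite_Int_of_opposite_thinnings[OF s Emb_fix[OF \<tau>(1)] \<tau>(2) Emb_fix[OF \<tau>'(1)] \<tau>'(2)] by blast
  have sub: "q \<subseteq> ?B" if "q \<in> forced_parts p0 T" for q
    using that thin[OF \<tau>(1)] thin[OF \<tau>'(1)] tree_of_comp[of s] T
    unfolding forced_parts_def end_ext_strict_def end_ext_def by blast
  have p0_forced: "p0 \<in> forced_parts p0 T"
    using end_ext_of_finite_tree[OF AS] by (auto simp: forced_parts_def AS_def end_ext_def)
  have "\<forall>q. q \<in> forced_parts p0 T \<longrightarrow> card q < Suc (card ?B)"
    using card_mono[OF B sub] by (simp add: less_Suc_eq_le)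
  from ex_has_greatest_nat[of "\<lambda>q. q \<in> forced_parts p0 T", OF p0_forced this]
  obtain p where p: "p \<in> forced_parts p0 T" "\<And>q. q \<in> forced_parts p0 T \<Longrightarrow> card q \<le> card p"
    by blast
  have "q = p" if q: "q \<in> forced_parts p0 T" "p \<sqsubseteq>\<^sub>e q" for q
  proof -
    have "p \<subseteq> q" "finite q" using q by (auto simp: end_ext_def forced_parts_def)
    then show ?thesis using card_seteq[of q p] p(2)[OF q(1)] by simp
  qed
  with p(1) have max: "p \<in> forced_parts p0 T \<and> (\<forall>q\<in>forced_parts p0 T. p \<sqsubseteq>\<^sub>e q \<longrightarrow> q = p)" by blast
  have "max_forced_part p0 T = p"
    unfolding max_forced_part_def
  proof (rule the_equality)
    fix q assume "q \<in> forced_parts p0 T \<and> (\<forall>q'\<in>forced_parts p0 T. q \<sqsubseteq>\<^sub>e q' \<longrightarrow> q' = q)"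
    then show "q = p" using max_forced_part_unique[OF AS] max by blast
  qed (rule max)
  with p(1) show ?thesis by simp
qed

text \<open>The depth is computed in \<open>p\<close>, so it is bounded by the number of splitting nodes of \<open>p\<close>,
  which is at most the bound for their indices in the larger tree.\<close>
lemma max_depth_less:
  assumes "splits p \<subseteq> s ` {..<M :: nat}"
  shows "max_depth p < int M"
proof (cases "splits p = {}")
  case False
  have fin: "finite (splits p)" using assms by (rule finite_subset) simp
  have "depth t p < M" if "t \<in> splits p" for t
  proof -
    have "{u \<in> splits p. split_le p u t \<and> u \<noteq> t} \<subset> splits p" using that by blast
    then have "depth t p < card (splits p)" unfolding depth_def by (rule psubset_card_mono[OF fin])
    also have "\<dots> \<le> card (s ` {..<M})" using assms by (intro card_mono) auto
    also have "\<dots> \<le> M" using card_image_le[of "{..<M}" s] by simp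
    finally show ?thesis .
  qed
  moreover have "{k. \<exists>t\<in>splits p. depth t p = k} = (\<lambda>t. depth t p) ` splits p" by auto
  ultimately show ?thesis using fin False by (simp add: max_depth_def)
qed (simp add: max_depth_def)

lemma sub_n_thinned:
  assumes s: "skeleton s" and \<tau>: "\<tau> \<in> Emb M" and N: "N < int M"
  shows "sub_n N (tree_of (s \<circ> \<tau>)) (tree_of s)"
proof -
  have "restr (tree_of (s \<circ> \<tau>)) n = restr (tree_of s) n" if n: "n < M" for n
  proof -
    have "(s \<circ> \<tau>) k = s k" if "k \<le> n" for k using Emb_fix[OF \<tau>, of k] that n by simp
    then show ?thesis unfolding restr_tree_of[OF s] restr_tree_of[OF skeleton_comp[OF s \<tau>]] by auto
  qed
  moreover have "nat N < M" if "N \<ge> 0" using N that by simp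
  ultimately show ?thesis using tree_of_comp by (auto simp: sub_n_def)
qed

section \<open>Pure decision for amoeba-Sacks forcing\<close>

lemma exists_strictly_growing_thinning:
  assumes s: "skeleton s" and len: "\<And>i j. i \<le> j \<Longrightarrow> length (s i) \<le> length (s j)"
  obtains \<tau> where "\<tau> \<in> Emb M" "\<And>i. M \<le> Suc i \<Longrightarrow> length (s (\<tau> i)) < length (s (\<tau> (Suc i)))"
proof -
  have ge: "length (path i) \<le> length (s i)" for i
  proof (induction i rule: heap_induct)
    case (child b i)
    have "prefix (s i @ [b]) (s (child b i))" using s by (simp add: skeleton_def)
    then show ?case using child by (auto dest!: prefix_length_le)
  qed simp
  define G where "G x = desc 0 (replicate (Suc (length (s x))) True)" for x
  obtain \<tau> where \<tau>: "\<tau> \<in> Emb M" "\<And>i. M \<le> Suc i \<Longrightarrow> G (\<tau> i) \<le> \<tau> (Suc i)"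
  proof (rule exists_Emb_into[of M UNIV G])
    show "\<exists>w\<in>UNIV. N \<le> w \<and> prefix (path f) (path w)" for f N
      using desc_ge[of f "replicate N True"] by (intro bexI[of _ "desc f (replicate N True)"]) auto
    show "\<exists>w'\<in>UNIV. N \<le> w' \<and> prefix (path w @ [b]) (path w')" for w b N
      using desc_ge[of "child b w" "replicate N True"]
      by (intro bexI[of _ "desc (child b w) (replicate N True)"]) auto
  qed blast
  show ?thesis
  proof (rule that[OF \<tau>(1)])
    fix i assume "M \<le> Suc i"
    then have "length (s (G (\<tau> i))) \<le> length (s (\<tau> (Suc i)))" using len \<tau>(2) by blast
    moreover have "Suc (length (s (\<tau> i))) \<le> length (s (G (\<tau> i)))"
      using ge[of "G (\<tau> i)"] by (simp add: G_def del: desc_simps replicate_Suc)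
    ultimately show "length (s (\<tau> i)) < length (s (\<tau> (Suc i)))" by simp
  qed
qed

text \<open>If the splitting node with index \<open>M - 1\<close> is kept at its place and all later ones are
  longer, then a good subtree must keep all earlier ones: its first \<open>M\<close> splitting nodes have at
  most the length of the last of them, and only \<open>M\<close> nodes are short enough.\<close>
lemma pinned_initial_part:
  assumes s: "skeleton s" "skeleton s'"
    and len': "\<And>i j. i \<le> j \<Longrightarrow> length (s' i) \<le> length (s' j)"
    and sub: "range s' \<subseteq> range s"
    and last: "\<And>i. M = Suc i \<Longrightarrow> s' i = s i"
    and long: "\<And>i j. M = Suc i \<Longrightarrow> i < j \<Longrightarrow> length (s i) < length (s j)"
    and i: "i < M"
  shows "s' i = s i"
proof -
  obtain m where m: "M = Suc m" using i by (cases M) auto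
  have into: "s' ` {..<M} \<subseteq> s ` {..<M}"
  proof
    fix u assume "u \<in> s' ` {..<M}"
    then obtain j where j: "j \<le> m" "u = s' j" using m by (auto simp: less_Suc_eq_le)
    then obtain k where jk: "j \<le> m" "u = s' j" "u = s k" using sub by blast
    then have "length (s k) \<le> length (s m)" using len'[of j m] last[OF m] by simp
    then have "k < M" using long[OF m, of k] m by (meson leD not_less_eq)
    then show "u \<in> s ` {..<M}" using jk by blast
  qed
  have inj: "inj_on s {..<M}" "inj_on s' {..<M}" using skeleton_inj s by (auto intro: inj_onI)
  have eq: "s' ` {..<M} = s ` {..<M}"
    by (rule card_seteq[OF _ into]) (simp_all add: card_image inj)
  have low: "{u \<in> range r. strict_prefix u (r j)} = {u \<in> r ` {..<M}. strict_prefix u (r j)}"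
    if r: "skeleton r" and j: "j < M" for r j
  proof -
    have "k < M" if "strict_prefix (r k) (r j)" for k
      using that prefix_path_le[of k j] j unfolding skeleton_strict_prefix_iff[OF r] by (simp add: strict_prefix_def)
    then show ?thesis by auto
  qed
  obtain k where k: "s' i = s k" "k < M" using eq i by blast
  have "{u \<in> range s'. strict_prefix u (s' i)} = {u \<in> range s. strict_prefix u (s' i)}"
    using low[OF s(2) i] low[OF s(1) k(2)] eq k(1) by simp
  then have "i = k" using same_splits_below_imp_same_index[OF s(2,1) k(1)] by blast
  then show ?thesis using k by simp
qed

theorem lemma15:
  fixes nm :: "'v \<Rightarrow> ('v \<times> cond) set"
    and \<phi> :: fm
    and e :: "nat \<Rightarrow> 'v"
    and p0 T :: "node set"
  assumes "name_universe AS nm"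
    and "(p0, T) \<in> AS"
  shows "\<exists>T'. AS_le_n 0 (p0, T') (p0, T) \<and> (p0, T') \<in> AS_deciding nm \<phi> e"
proof -
  obtain s where s: "skeleton s" and T: "T = tree_of s"
    and len: "\<And>i j. i \<le> j \<Longrightarrow> length (s i) \<le> length (s j)" and p0: "p0 \<sqsubseteq>\<^sub>e T"
    using AS_skeletonE[OF assms(2)] by blast
  define p where "p = max_forced_part p0 T"
  have p: "p0 \<sqsubseteq>\<^sub>e p" "\<And>S. S \<subseteq> T \<Longrightarrow> (p0, S) \<in> AS \<Longrightarrow> p \<sqsubseteq>\<^sub>e S"
    using max_forced_part_in[OF assms(2)] by (auto simp: p_def forced_parts_def end_ext_strict_def)
  \<comment> \<open>Either \<open>M = 0\<close> or \<open>M - 1\<close> is the largest index of a splitting node of \<open>p\<close>.\<close>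
  obtain M where M: "splits p \<subseteq> s ` {..<M}" "\<And>i. M = Suc i \<Longrightarrow> s i \<in> splits p"
    using bounded_split_indices[OF s p(2)[OF order_refl assms(2), unfolded T]] by blast
  have M0: "splits p0 \<subseteq> s ` {..<M}" using splits_mono[of p0 p] p(1) M(1) by (auto simp: end_ext_def)
  have thin: "(p0, tree_of (s \<circ> \<tau>)) \<in> AS" if \<tau>: "\<tau> \<in> Emb M" for \<tau>
    using len strict_mono_less_eq[OF Emb_strict_mono[OF \<tau>]]
    by (intro AS_tree_of skeleton_comp[OF s \<tau>] end_ext_thinned[OF s \<tau> p0[unfolded T] M0]) simp
  obtain \<tau>0 where \<tau>0: "\<tau>0 \<in> Emb M"
    "\<And>i. M \<le> Suc i \<Longrightarrow> length (s (\<tau>0 i)) < length (s (\<tau>0 (Suc i)))"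
    using exists_strictly_growing_thinning[OF s len, of M] by blast
  define s1 where "s1 = s \<circ> \<tau>0"
  have s1: "skeleton s1" unfolding s1_def by (rule skeleton_comp[OF s \<tau>0(1)])
  have s1_step: "length (s1 i) < length (s1 (Suc i))" if "M \<le> Suc i" for i
    using \<tau>0(2)[OF that] by (simp add: s1_def)
  have s1_strict: "length (s1 i) < length (s1 j)" if i: "M \<le> Suc i" and ij: "i < j" for i j
  proof -
    have "Suc i \<le> j" using ij by simp
    then show ?thesis
    proof (induction j rule: dec_induct)
      case base show ?case using i by (rule s1_step)
    next
      case (step j) then show ?case using s1_step[of j] i by simp
    qed
  qed
  have s1_len: "length (s1 i) \<le> length (s1 j)" if "i \<le> j" for i j
    using len that strict_mono_less_eq[OF Emb_strict_mono[OF \<tau>0(1)]] by (simp add: s1_def)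
  \<comment> \<open>After the thinning all pure extensions of \<open>p0\<close> share the first \<open>M\<close> splitting nodes.\<close>
  have pinned: "\<exists>s'. skeleton s' \<and> S = tree_of s' \<and> (\<forall>i<M. s' i = s1 i)"
    if S: "S \<subseteq> tree_of s1" "(p0, S) \<in> AS" for S
  proof -
    obtain s' where s': "skeleton s'" "S = tree_of s'" "\<And>i j. i \<le> j \<Longrightarrow> length (s' i) \<le> length (s' j)"
      using AS_skeletonE[OF S(2)] by metis
    have sT: "tree_of s1 \<subseteq> T" unfolding s1_def T by (rule tree_of_comp)
    have pS: "p \<sqsubseteq>\<^sub>e tree_of s'" using p(2)[of S] S sT s'(2) by blast
    have ps1: "p \<sqsubseteq>\<^sub>e tree_of s1" using p(2)[OF sT] thin[OF \<tau>0(1)] by (simp add: s1_def)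
    have "s' i = s1 i" if "i < M" for i
    proof (rule pinned_initial_part[OF s1 s'(1,3) _ _ _ that])
      show "range s' \<subseteq> range s1"
        using splits_mono[OF S(1)] by (simp add: s'(2) splits_tree_of s1 s'(1))
      show "s' i = s1 i" if i: "M = Suc i" for i
      proof (rule same_index_if_split_of_common_part[OF s1 s'(1) ps1 pS])
        show "s1 i \<in> splits p" using M(2)[OF i] Emb_fix[OF \<tau>0(1), of i] i by (simp add: s1_def)
      qed
    qed (use s1_strict in auto)
    then show ?thesis using s' by blast
  qed
  let ?F = "forces AS AS_le nm"
  \<comment> \<open>The condition given by the first \<open>n\<close> splitting nodes of the subtree for \<open>\<sigma>\<close>.\<close>
  define c where "c n \<sigma> = (initial_part n (s1 \<circ> \<sigma>), tree_of (s1 \<circ> \<sigma>))" for n \<sigma>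
  have c_AS: "c n \<sigma> \<in> AS" if \<sigma>: "\<sigma> \<in> Emb 0" for n \<sigma>
    unfolding c_def using s1_len strict_mono_less_eq[OF Emb_strict_mono[OF \<sigma>]]
    by (intro AS_tree_of skeleton_comp[OF s1 \<sigma>] initial_part_end_ext) simp
  have factor: "\<exists>\<tau>\<in>Emb n. S = tree_of (s1 \<circ> \<sigma> \<circ> \<tau>)"
    if n: "M \<le> n" and \<sigma>: "\<sigma> \<in> Emb 0" and S: "S \<subseteq> tree_of (s1 \<circ> \<sigma>)" "(initial_part n (s1 \<circ> \<sigma>), S) \<in> AS" for n \<sigma> S
  proof -
    have sk: "skeleton (s1 \<circ> \<sigma>)" using s1 \<sigma> by (rule skeleton_comp)
    obtain s' where s': "skeleton s'" "S = tree_of s'" "initial_part n (s1 \<circ> \<sigma>) \<sqsubseteq>\<^sub>e S"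
      using AS_skeletonE[OF S(2)] by metis
    have good: "good (tree_of s')" using S(2) s'(2) by (simp add: AS_iff)
    have "s' i = (s1 \<circ> \<sigma>) i" if "i < n" for i
      using same_index_if_split_of_common_part[OF sk s'(1) initial_part_end_ext[OF sk] s'(3)[unfolded s'(2)]]
        splits_initial_part[OF that] by blast
    moreover have "length ((s1 \<circ> \<sigma>) i) < length ((s1 \<circ> \<sigma>) j)" if "n \<le> i" "i < j" for i j
      using s1_strict[of "\<sigma> i" "\<sigma> j"] Emb_ge[OF \<sigma>, of i] that n strict_mono_less[OF Emb_strict_mono[OF \<sigma>]]
      by simp
    ultimately obtain \<tau> where "\<tau> \<in> Emb n" "s' = s1 \<circ> \<sigma> \<circ> \<tau>"
      using subtree_factor[OF sk s'(1) good S(1)[unfolded s'(2)], of n] by blast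
    then show ?thesis using s'(2) by blast
  qed
  have same_initial: "initial_part n (s1 \<circ> \<sigma> \<circ> \<tau>) = initial_part n (s1 \<circ> \<sigma>)" if "\<tau> \<in> Emb n" for n \<sigma> \<tau>
    using Emb_fix[OF that] by (intro initial_part_cong) simp
  have le: "AS_le (c n (\<sigma> \<circ> \<tau>)) (c n \<sigma>)" if "\<sigma> \<in> Emb 0" "\<tau> \<in> Emb n" for n \<sigma> \<tau>
    using same_initial[OF that(2), of \<sigma>] tree_of_comp[of "s1 \<circ> \<sigma>" \<tau>] end_ext_of_finite_tree c_AS[OF that(1), of n]
    by (auto simp: AS_le_def c_def comp_assoc)
  have forces_mono: "?F (c n (\<sigma> \<circ> \<tau>)) \<psi> e" if "\<sigma> \<in> Emb 0" "\<tau> \<in> Emb n" "?F (c n \<sigma>) \<psi> e" for n \<sigma> \<tau> \<psi>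
    using AS_forces_antimono[OF le[OF that(1,2)] that(3)] .
  have forces_step: "?F (c n \<sigma>) \<psi> e"
    if n: "M \<le> n" and \<sigma>: "\<sigma> \<in> Emb 0" and F: "\<And>\<tau>. \<tau> \<in> Emb n \<Longrightarrow> ?F (c (Suc n) (\<sigma> \<circ> \<tau>)) \<psi> e" for n \<sigma> \<psi>
    unfolding c_def
  proof (rule AS_forces_if_pure_extensions)
    fix S assume S: "S \<subseteq> tree_of (s1 \<circ> \<sigma>)" "(initial_part n (s1 \<circ> \<sigma>), S) \<in> AS"
    obtain \<tau> where \<tau>: "\<tau> \<in> Emb n" "S = tree_of (s1 \<circ> \<sigma> \<circ> \<tau>)" using factor[OF n \<sigma> S] by blast
    then have "c (Suc n) (\<sigma> \<circ> \<tau>) \<in> AS" "?F (c (Suc n) (\<sigma> \<circ> \<tau>)) \<psi> e"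
      using c_AS[OF Emb_comp0[OF \<sigma> \<tau>(1)]] F by blast+
    then show "\<exists>r. (r, S) \<in> AS \<and> ?F (r, S) \<psi> e" unfolding c_def \<tau>(2) comp_assoc by blast
  qed
  have dense: "\<exists>\<tau>\<in>Emb n. \<exists>m\<ge>n. ?F (c m (\<sigma> \<circ> \<tau>)) \<phi> e \<or> ?F (c m (\<sigma> \<circ> \<tau>)) (Neg \<phi>) e"
    if n: "M \<le> n" and \<sigma>: "\<sigma> \<in> Emb 0" for n \<sigma>
  proof -
    obtain d where d: "d \<in> AS" "AS_le d (c n \<sigma>)" "?F d \<phi> e \<or> ?F d (Neg \<phi>) e"
      using exists_deciding_below[OF c_AS[OF \<sigma>] reflp_on_AS_le] by blast
    obtain q S where qS: "d = (q, S)" by force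
    have q: "q \<sqsubseteq>\<^sub>e S" "S \<subseteq> tree_of (s1 \<circ> \<sigma>)" "initial_part n (s1 \<circ> \<sigma>) \<sqsubseteq>\<^sub>e q"
      using d(1,2) by (simp_all add: qS AS_iff AS_le_def c_def)
    then have "(initial_part n (s1 \<circ> \<sigma>), S) \<in> AS"
      using d(1) end_ext_trans unfolding qS AS_iff by blast
    then obtain \<tau> where \<tau>: "\<tau> \<in> Emb n" "S = tree_of (s1 \<circ> (\<sigma> \<circ> \<tau>))"
      using factor[OF n \<sigma> q(2)] unfolding comp_assoc by blast
    have \<sigma>\<tau>: "\<sigma> \<circ> \<tau> \<in> Emb 0" using Emb_comp0[OF \<sigma> \<tau>(1)] .
    then have sk: "skeleton (s1 \<circ> (\<sigma> \<circ> \<tau>))" by (rule skeleton_comp[OF s1])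
    obtain m where m: "n \<le> m" "q \<subseteq> initial_part m (s1 \<circ> (\<sigma> \<circ> \<tau>))"
      using finite_subset_initial_part[OF sk, of q n] q(1) by (auto simp: \<tau>(2) end_ext_def)
    have "q \<sqsubseteq>\<^sub>e initial_part m (s1 \<circ> (\<sigma> \<circ> \<tau>))"
      using end_ext_subset[OF q(1) m(2)] initial_part_end_ext[OF sk, of m] by (simp add: \<tau>(2) end_ext_def)
    then have "AS_le (c m (\<sigma> \<circ> \<tau>)) d" by (simp add: AS_le_def qS c_def \<tau>(2))
    then show ?thesis using d(3) AS_forces_antimono \<tau>(1) m(1) by blast
  qed
  \<comment> \<open>Good subtrees are given by embeddings only from stage \<open>M\<close> on, where the lengths grow
    strictly. Below \<open>M\<close> the property is set to hold, which keeps the assumptions of the abstract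
    theorem true at every stage.\<close>
  define A where "A \<psi> n \<sigma> \<longleftrightarrow> n < M \<or> ?F (c n \<sigma>) \<psi> e" for \<psi> n \<sigma>
  obtain \<tau> where \<tau>: "\<tau> \<in> Emb M" "A \<phi> M (id \<circ> \<tau>) \<or> A (Neg \<phi>) M (id \<circ> \<tau>)"
  proof (rule abstract_pure_decision[of "A \<phi>" "A (Neg \<phi>)" id M])
    show "A \<psi> k (\<sigma> \<circ> \<tau>)" if "\<sigma> \<in> Emb 0" "\<tau> \<in> Emb k" "A \<psi> k \<sigma>" for \<psi> k \<sigma> \<tau>
      using that forces_mono unfolding A_def by blast
    show "A \<psi> k (\<sigma> \<circ> \<tau>)" if "\<sigma> \<in> Emb 0" "\<tau> \<in> Emb k" "A \<psi> k \<sigma>" for \<psi> k \<sigma> \<tau>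
      using that forces_mono unfolding A_def by blast
    show "A \<psi> k \<sigma>" if "\<sigma> \<in> Emb 0" "\<And>\<tau>. \<tau> \<in> Emb k \<Longrightarrow> A \<psi> (Suc k) (\<sigma> \<circ> \<tau>)" for \<psi> k \<sigma>
      using that forces_step[of k \<sigma> \<psi>] unfolding A_def by (metis not_less less_Suc_eq_le leD le_SucI)
    show "A \<psi> k \<sigma>" if "\<sigma> \<in> Emb 0" "\<And>\<tau>. \<tau> \<in> Emb k \<Longrightarrow> A \<psi> (Suc k) (\<sigma> \<circ> \<tau>)" for \<psi> k \<sigma>
      using that forces_step[of k \<sigma> \<psi>] unfolding A_def by (metis not_less less_Suc_eq_le leD le_SucI)
    show "\<exists>\<tau>\<in>Emb k. \<exists>m\<ge>k. A \<phi> m (\<sigma> \<circ> \<tau>) \<or> A (Neg \<phi>) m (\<sigma> \<circ> \<tau>)" if "\<sigma> \<in> Emb 0" for k \<sigma>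
    proof (cases "k < M")
      case True
      then show ?thesis unfolding A_def using id_Emb by blast
    next
      case False
      then show ?thesis using dense[OF _ that, of k] unfolding A_def by (metis not_less)
    qed
  qed auto
  define T' where "T' = tree_of (s1 \<circ> \<tau>)"
  have \<tau>E: "\<tau>0 \<circ> \<tau> \<in> Emb M" using \<tau>0(1) \<tau>(1) by (rule Emb_comp)
  have T': "T' = tree_of (s \<circ> (\<tau>0 \<circ> \<tau>))" by (simp add: T'_def s1_def comp_assoc)
  have AS': "(p0, T') \<in> AS" unfolding T' by (rule thin[OF \<tau>E])
  have forces_p0: "?F (p0, T') \<psi> e" if F: "?F (c M \<tau>) \<psi> e" for \<psi>
  proof (rule AS_forces_if_pure_extensions)
    fix S assume S: "S \<subseteq> T'" "(p0, S) \<in> AS"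
    have "S \<subseteq> tree_of s1" using S(1) tree_of_comp unfolding T'_def by blast
    then obtain s' where s': "skeleton s'" "S = tree_of s'" "\<And>i. i < M \<Longrightarrow> s' i = s1 i"
      using pinned[OF _ S(2)] by blast
    let ?q = "initial_part M s'"
    have q: "?q = initial_part M (s1 \<circ> \<tau>)" using s'(3) Emb_fix[OF \<tau>(1)] by (intro initial_part_cong) simp
    have qS: "(?q, S) \<in> AS" using S(2) initial_part_end_ext[OF s'(1), of M] unfolding s'(2) AS_iff by blast
    then have "AS_le (?q, S) (c M \<tau>)"
      using S(1) end_ext_of_finite_tree[OF qS] by (simp add: AS_le_def c_def T'_def q)
    then show "\<exists>r. (r, S) \<in> AS \<and> ?F (r, S) \<psi> e" using qS AS_forces_antimono F by blast
  qed
  have "?F (p0, T') \<phi> e \<or> ?F (p0, T') (Neg \<phi>) e"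
    using \<tau>(2) forces_p0 unfolding A_def id_comp less_irrefl simp_thms by blast
  then have "(p0, T') \<in> AS_deciding nm \<phi> e" using AS' by (simp add: AS_deciding_def)
  moreover have "sub_n (int 0 + max_depth p) T' T"
    unfolding T' T using sub_n_thinned[OF s \<tau>E] max_depth_less[OF M(1)] by simp
  then have "AS_le_n 0 (p0, T') (p0, T)"
    using AS' assms(2) end_ext_of_finite_tree[OF AS'] tree_of_comp[of s]
    by (simp add: AS_le_n_def AS_le_def p_def T T')
  ultimately show ?thesis by blast
qed

end
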